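(* Let $k\geq 2$ and $m\in\{1,2,\dots,k\}$, and let $c_{k,m}(t)=\left|\{w\in\mathbf{F}_k: |w|=t,\ \pi(w)=m\}\right|$. Then \[ \limsup_{t\to\infty}c_{k,m}(t)^{1/t}=\begin{cases}\sqrt{2k-1} & 2m-1\leq\sqrt{2k-1},\\ 2m-1 & 2m-1\geq\sqrt{2k-1}.\end{cases} \]
   Context: $\mathbf{F}_k$ is the free group on a basis $X=\{x_1,\dots,x_k\}$ and $|w|$ is the length of the reduced word representing $w$. An element $w$ of a free group $J$ is primitive in $J$ if it belongs to a basis of $J$. The primitivity rank is $\pi(w)=\min\{\mathrm{rk}(J): w\in J\leq\mathbf{F}_k,\ w\text{ not primitive in }J\}$, with $\pi(w)=\infty$ if no such $J$ exists. *)

theory Defs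
  imports "HOL-Algebra.Group" "HOL-Library.Extended_Nat" "HOL-Library.Extended_Real"
begin

text \<open>Words over the alphabet \<open>A \<union> A\<^sup>-\<^sup>1\<close>: the letter \<open>(a, True)\<close> stands for \<open>a\<close> and
  \<open>(a, False)\<close> for \<open>a\<^sup>-\<^sup>1\<close>.\<close>

type_synonym 'a word = "('a \<times> bool) list"

definition flip :: "'a \<times> bool \<Rightarrow> 'a \<times> bool" where
  "flip x = (fst x, \<not> snd x)"

definition reduced :: "'a word \<Rightarrow> bool" where
  "reduced w \<longleftrightarrow> successively (\<lambda>x y. y \<noteq> flip x) w"

fun cancel_Cons :: "'a \<times> bool \<Rightarrow> 'a word \<Rightarrow> 'a word" where
  "cancel_Cons x [] = [x]"
| "cancel_Cons x (y # ys) = (if y = flip x then ys else x # y # ys)"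

text \<open>For a reduced word \<open>v\<close>, \<open>foldr cancel_Cons u v\<close> is the reduced form of the
  concatenation \<open>u @ v\<close>.\<close>

definition free_group :: "'a set \<Rightarrow> 'a word monoid" where
  "free_group A =
    \<lparr>carrier = {w. reduced w \<and> fst ` set w \<subseteq> A}, mult = foldr cancel_Cons, one = []\<rparr>"

definition word_value :: "('g, 'b) monoid_scheme \<Rightarrow> 'g word \<Rightarrow> 'g" where
  "word_value G w =
    foldr (\<lambda>(g, e) h. (if e then g else inv\<^bsub>G\<^esub> g) \<otimes>\<^bsub>G\<^esub> h) w \<one>\<^bsub>G\<^esub>"

definition is_basis :: "('g, 'b) monoid_scheme \<Rightarrow> 'g set \<Rightarrow> 'g set \<Rightarrow> bool" where
  "is_basis G J B \<longleftrightarrow> B \<subseteq> J \<and> word_value G \<in> iso (free_group B) (G\<lparr>carrier := J\<rparr>)"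

definition primitive_in :: "('g, 'b) monoid_scheme \<Rightarrow> 'g set \<Rightarrow> 'g \<Rightarrow> bool" where
  "primitive_in G J w \<longleftrightarrow> (\<exists>B. is_basis G J B \<and> w \<in> B)"

definition ecard :: "'a set \<Rightarrow> enat" where
  "ecard B = (if finite B then enat (card B) else \<infinity>)"

text \<open>All bases of a free group have the same cardinality, so the infimum is merely a way of
  naming this common value; infinite ranks are not distinguished from each other.\<close>

definition free_rank :: "('g, 'b) monoid_scheme \<Rightarrow> 'g set \<Rightarrow> enat" where
  "free_rank G J = Inf {ecard B |B. is_basis G J B}"

text \<open>In \<open>enat\<close> the infimum of a nonempty set is attained, and the infimum of the empty set
  is \<open>\<infinity>\<close>.\<close>

definition primitivity_rank :: "('g, 'b) monoid_scheme \<Rightarrow> 'g \<Rightarrow> enat" where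
  "primitivity_rank G w = Inf {free_rank G J |J. subgroup J G \<and> w \<in> J \<and> \<not> primitive_in G J w}"

abbreviation Fk :: "nat \<Rightarrow> nat word monoid" where
  "Fk k \<equiv> free_group {1..k}"

definition primitivity_rank_count :: "nat \<Rightarrow> nat \<Rightarrow> nat \<Rightarrow> nat" where
  "primitivity_rank_count k m t = card {w \<in> carrier (Fk k). length w = t \<and> primitivity_rank (Fk k) w = enat m}"


lemma flip_flip [simp]: "flip (flip x) = x"
  by (simp add: flip_def)

lemma flip_neq [simp]: "flip x \<noteq> x" "x \<noteq> flip x"
  by (auto simp: flip_def prod_eq_iff)

lemma reduced_Nil [simp]: "reduced []"
  by (simp add: reduced_def)

lemma reduced_Cons: "reduced (x # w) \<longleftrightarrow> reduced w \<and> (w \<noteq> [] \<longrightarrow> hd w \<noteq> flip x)"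
  by (cases w) (auto simp: reduced_def)

lemma reduced_cancel_Cons: "reduced w \<Longrightarrow> reduced (cancel_Cons x w)"
  by (cases w) (auto simp: reduced_Cons)

lemma reduced_mult: "reduced v \<Longrightarrow> reduced (foldr cancel_Cons u v)"
  by (induction u) (auto intro: reduced_cancel_Cons)

lemma set_cancel_Cons: "set (cancel_Cons x w) \<subseteq> insert x (set w)"
  by (cases w) auto

lemma set_mult: "set (foldr cancel_Cons u v) \<subseteq> set u \<union> set v"
proof (induction u)
  case (Cons x u)
  then show ?case using set_cancel_Cons[of x "foldr cancel_Cons u v"] by auto
qed auto

lemma cancel_Cons_flip: "reduced w \<Longrightarrow> cancel_Cons x (cancel_Cons (flip x) w) = w"
  by (cases w rule: remdups_adj.cases) (auto simp: reduced_Cons)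

lemma mult_cancel_Cons:
  "reduced w \<Longrightarrow> foldr cancel_Cons (cancel_Cons x z) w = cancel_Cons x (foldr cancel_Cons z w)"
  by (cases z) (auto simp: cancel_Cons_flip reduced_mult)

lemma mult_assoc_word:
  "reduced w \<Longrightarrow>
    foldr cancel_Cons (foldr cancel_Cons u v) w = foldr cancel_Cons u (foldr cancel_Cons v w)"
  by (induction u) (auto simp: mult_cancel_Cons)

lemma mult_Nil: "reduced u \<Longrightarrow> foldr cancel_Cons u [] = u"
proof (induction u)
  case (Cons x u)
  then show ?case by (cases u) (auto simp: reduced_Cons)
qed simp

lemma mult_inverse: "reduced v \<Longrightarrow> foldr cancel_Cons (rev (map flip u)) (foldr cancel_Cons u v) = v"
proof (induction u)
  case (Cons x u)
  then show ?case using cancel_Cons_flip[of "foldr cancel_Cons u v" "flip x"]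
    by (simp add: reduced_mult)
qed simp

lemma reduced_inverse: "reduced u \<Longrightarrow> reduced (rev (map flip u))"
  unfolding reduced_def
  by (auto simp: successively_map elim: successively_mono)

lemma group_free_group: "group (free_group A)"
proof (rule groupI)
  fix u assume u: "u \<in> carrier (free_group A)"
  let ?v = "rev (map flip u)"
  have "?v \<in> carrier (free_group A)"
    using u by (auto simp: free_group_def reduced_inverse flip_def)
  moreover have "?v \<otimes>\<^bsub>free_group A\<^esub> u = \<one>\<^bsub>free_group A\<^esub>"
    using u mult_inverse[of "[]" u] by (simp add: free_group_def mult_Nil)
  ultimately show "\<exists>v \<in> carrier (free_group A). v \<otimes>\<^bsub>free_group A\<^esub> u = \<one>\<^bsub>free_group A\<^esub>"
    by blast
next
  fix u v assume "u \<in> carrier (free_group A)" "v \<in> carrier (free_group A)"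
  then show "u \<otimes>\<^bsub>free_group A\<^esub> v \<in> carrier (free_group A)"
    using set_mult[of u v] by (fastforce simp: free_group_def reduced_mult)
qed (auto simp: free_group_def mult_assoc_word)

lemma finite_sphere: "finite {w \<in> carrier (Fk k). length w = t \<and> P w}"
proof (rule finite_subset)
  show "{w \<in> carrier (Fk k). length w = t \<and> P w}
    \<subseteq> {w. set w \<subseteq> {1..k} \<times> UNIV \<and> length w = t}"
    by (fastforce simp: free_group_def)
qed (simp add: finite_lists_length_eq)

lemma inv_gen:
  assumes "a \<in> A"
  shows "inv\<^bsub>free_group A\<^esub> [(a, True)] = [(a, False)]"
  by (rule group.inv_equality[OF group_free_group])
    (use assms in \<open>auto simp: free_group_def flip_def reduced_Cons\<close>)

lemma word_value_gens:
  assumes "fst ` set w \<subseteq> A" "reduced w"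
  shows "word_value (free_group A) (map (\<lambda>(a, e). ([(a, True)], e)) w) = w"
  using assms
proof (induction w)
  case Nil
  then show ?case by (simp add: word_value_def free_group_def)
next
  case (Cons x w)
  obtain a e where x: "x = (a, e)" by (cases x)
  have "(if e then [(a, True)] else inv\<^bsub>free_group A\<^esub> [(a, True)]) = [x]"
    using Cons.prems by (simp add: x inv_gen)
  moreover have "[x] \<otimes>\<^bsub>free_group A\<^esub> w = x # w"
    using Cons.prems by (cases w) (auto simp: free_group_def reduced_Cons)
  moreover have "word_value (free_group A) (map (\<lambda>(a, e). ([(a, True)], e)) w) = w"
    using Cons by (simp add: reduced_Cons)
  ultimately show ?case by (simp add: word_value_def x)
qed

lemma (in group) word_value_closed:
  "fst ` set u \<subseteq> carrier G \<Longrightarrow> word_value G u \<in> carrier G"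
  by (induction u) (auto simp: word_value_def split: prod.splits)

lemma (in group) word_value_cancel_Cons:
  assumes "fst x \<in> carrier G" "fst ` set u \<subseteq> carrier G"
  shows "word_value G (cancel_Cons x u) =
    (if snd x then fst x else inv (fst x)) \<otimes> word_value G u"
proof (cases "u \<noteq> [] \<and> hd u = flip x")
  case True
  then obtain v where u: "u = flip x # v" by (cases u) auto
  have "word_value G v \<in> carrier G"
    using assms u by (intro word_value_closed) auto
  then show ?thesis
    using assms(1) unfolding u
    by (cases x) (auto simp: flip_def word_value_def inv_solve_left m_assoc[symmetric])
next
  case False
  then have "cancel_Cons x u = x # u" by (cases u) auto
  then show ?thesis by (cases x) (simp add: word_value_def)
qed

lemma (in group) word_value_mult:
  assumes "fst ` set u \<subseteq> carrier G" "fst ` set v \<subseteq> carrier G"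
  shows "word_value G (foldr cancel_Cons u v) = word_value G u \<otimes> word_value G v"
  using assms(1)
proof (induction u)
  case Nil
  then show ?case using word_value_closed[OF assms(2)] by (simp add: word_value_def)
next
  case (Cons x u)
  have "fst ` set (foldr cancel_Cons u v) \<subseteq> carrier G"
    using set_mult[of u v] Cons.prems assms(2) by fastforce
  moreover have "word_value G u \<in> carrier G" "word_value G v \<in> carrier G"
    using Cons.prems assms(2) by (auto intro: word_value_closed)
  ultimately show ?case
    using Cons by (cases x) (auto simp: word_value_cancel_Cons m_assoc, auto simp: word_value_def m_assoc)
qed

lemma (in group) word_value_hom:
  assumes "B \<subseteq> carrier G"
  shows "word_value G \<in> hom (free_group B) G"
  using assms by (intro homI) (auto simp: free_group_def intro!: word_value_closed word_value_mult)

lemma is_basis_gens: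
  "is_basis (free_group A) (carrier (free_group A)) ((\<lambda>a. [(a, True)]) ` A)"
proof -
  interpret group "free_group A" by (rule group_free_group)
  let ?B = "(\<lambda>a. [(a, True)]) ` A"
  let ?f = "map (\<lambda>(a, e). ([(a, True)], e)) :: 'a word \<Rightarrow> 'a word word"
  let ?g = "map (\<lambda>(b, e). (fst (hd b), e)) :: 'a word word \<Rightarrow> 'a word"
  have B: "?B \<subseteq> carrier (free_group A)"
    by (auto simp: free_group_def reduced_Cons)
  have red: "reduced (?f w) \<longleftrightarrow> reduced w" for w
    by (induction w) (auto simp: reduced_Cons hd_map flip_def split: prod.splits)
  have fg: "?f (?g u) = u" if "fst ` set u \<subseteq> ?B" for u
    using that by (induction u) auto
  have f: "?f w \<in> carrier (free_group ?B) \<and> word_value (free_group A) (?f w) = w"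
    if "w \<in> carrier (free_group A)" for w
    using that word_value_gens[of w A] by (fastforce simp: free_group_def red)
  have g: "?g u \<in> carrier (free_group A) \<and> ?f (?g u) = u" if "u \<in> carrier (free_group ?B)" for u
  proof -
    have u: "fst ` set u \<subseteq> ?B" "reduced u" using that by (auto simp: free_group_def)
    have "reduced (?g u)" using fg[OF u(1)] u(2) red[of "?g u"] by simp
    moreover have "fst ` set (?g u) \<subseteq> A" using u(1) by fastforce
    ultimately show ?thesis using fg[OF u(1)] by (simp add: free_group_def)
  qed
  have "bij_betw (word_value (free_group A)) (carrier (free_group ?B)) (carrier (free_group A))"
  proof (rule bij_betw_byWitness[where f' = ?f])
    show "\<forall>u\<in>carrier (free_group ?B). ?f (word_value (free_group A) u) = u"
      by (metis f g)
    show "\<forall>w\<in>carrier (free_group A). word_value (free_group A) (?f w) = w"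
      using f by blast
    show "word_value (free_group A) ` carrier (free_group ?B) \<subseteq> carrier (free_group A)"
      using word_value_hom[OF B] by (auto simp: hom_def)
    show "?f ` carrier (free_group A) \<subseteq> carrier (free_group ?B)"
      using f by blast
  qed
  then show ?thesis
    using B word_value_hom[OF B] by (simp add: is_basis_def iso_def)
qed

end

theory Submission
  imports Defs "HOL-Algebra.Coset"
begin

text \<open>Upper bound. Let \<open>w\<close> lie in a subgroup \<open>J\<close> of rank \<open>r\<close> without being primitive in it. The part
  of the Schreier graph of \<open>J\<close> that is traced by \<open>w\<close> is contained in a finite connected graph
  whose loop group is \<open>J\<close>, so it has rank at most \<open>r\<close>; and \<open>w\<close> crosses each of its edges at least
  twice, since otherwise \<open>w\<close> would belong to a basis of its loop group, which extends to one
  of \<open>J\<close>. If \<open>w\<close> is cyclically reduced of length \<open>t\<close>, read it letter by letter and let \<open>q\<close> be the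
  number of edges that have been crossed exactly once so far. Up to a number of exceptional steps
  bounded in terms of \<open>r\<close>, a step explores a new edge (at most \<open>2k - 1\<close> choices, and \<open>q\<close> grows),
  is forced, or crosses an edge at least for the third time (at most \<open>2r - 1\<close> choices). As \<open>q\<close>
  returns to zero, there are at most polynomially many times \<open>max (sqrt (2k - 1)) (2r - 1) ^ t\<close>
  such words. Conjugates \<open>g c g\<^sup>-\<^sup>1\<close> do not change this rate.

  Lower bound. A word in the first \<open>m\<close> generators that contains every generator an even number of
  times is killed by all homomorphisms to the group of order two, hence is not primitive in
  \<open>F\<^sub>m\<close>. For \<open>m \<ge> 2\<close> such words grow at rate \<open>2m - 1\<close>, whereas by the upper bound, applied inside
  \<open>F\<^sub>m\<close>, those of primitivity rank less than \<open>m\<close> grow more slowly. Conjugating a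
  single word of primitivity rank \<open>m\<close> gives the rate \<open>sqrt (2k - 1)\<close>.\<close>

section \<open>Reduced words and bases\<close>

text \<open>The two regimes reflect two ways of spending letters. Exploring an edge offers up to
  \<open>2k - 1\<close> letters but must be paid for by a second crossing, which is forced outside
  the exceptional steps; each such pair gives a factor \<open>2k - 1\<close>, hence
  \<open>sqrt (2k - 1)\<close> per step. Later crossings carry no debt; they offer up to
  \<open>2r - 1\<close> letters, because a cyclically reduced closed walk leaves no vertex of degree
  one, and then rank \<open>r\<close> allows no degree above \<open>2r\<close>. The obstacle is that
  both kinds of step interleave arbitrarily in a graph that is discovered only while it is walked;
  hence a potential that charges each step as it is made. On the algebraic side one construction
  carries everything: an edge added between two old vertices adds one free generator, represented by
  any loop made of an old path, the new edge and another old path. Rank bounds, extension of bases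
  and primitivity of a word crossing some edge once all follow from it. In the lower bound, words of
  smaller rank have rate at most \<open>max (sqrt (2m - 1)) (2m - 3)\<close>, which is below
  \<open>2m - 1\<close> once \<open>m \<ge> 2\<close>.\<close>

abbreviation wmult :: "'a word \<Rightarrow> 'a word \<Rightarrow> 'a word" (infixr "\<star>" 70) where
  "u \<star> v \<equiv> foldr cancel_Cons u v"

definition winv :: "'a word \<Rightarrow> 'a word" where
  "winv w = rev (map flip w)"

lemma winv_simps [simp]: "winv [] = []" "winv (winv w) = w" "length (winv w) = length w"
  "winv (u @ v) = winv v @ winv u" "winv (x # u) = winv u @ [flip x]"
  by (auto simp: winv_def rev_map comp_def)

lemma reduced_winv [simp]: "reduced (winv w) \<longleftrightarrow> reduced w"
  using reduced_inverse[of w] reduced_inverse[of "winv w"] winv_simps(2)[of w]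
  unfolding winv_def by metis

lemma fst_flip [simp]: "fst (flip x) = fst x"
  by (simp add: flip_def)

lemma fst_set_winv [simp]: "fst ` set (winv w) = fst ` set w"
proof -
  have "fst ` set (winv w) = (fst \<circ> flip) ` set w" by (simp add: winv_def image_comp)
  then show ?thesis by (simp add: comp_def)
qed

lemma reduced_append:
  "reduced (u @ v) \<longleftrightarrow> reduced u \<and> reduced v \<and> (u \<noteq> [] \<longrightarrow> v \<noteq> [] \<longrightarrow> hd v \<noteq> flip (last u))"
  unfolding reduced_def by (auto simp: successively_append_iff)

lemma wmult_reduced_append: "reduced (u @ v) \<Longrightarrow> u \<star> v = u @ v"
proof (induction u)
  case (Cons x u)
  then show ?case by (cases "u @ v") (auto simp: reduced_Cons)
qed simp

lemma wmult_winv_left: "reduced u \<Longrightarrow> winv u \<star> u = []"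
  using mult_inverse[of "[]" u] by (simp add: winv_def mult_Nil)

lemma wmult_winv_right: "reduced u \<Longrightarrow> u \<star> winv u = []"
  using wmult_winv_left[of "winv u"] by simp

lemma winv_wmult_cancel: "reduced v \<Longrightarrow> winv u \<star> (u \<star> v) = v"
  using mult_inverse[of v u] by (simp add: winv_def)

lemma wmult_winv_cancel: "reduced v \<Longrightarrow> u \<star> (winv u \<star> v) = v"
  using winv_wmult_cancel[of v "winv u"] by simp

lemma wmult_assoc: "reduced w \<Longrightarrow> (u \<star> v) \<star> w = u \<star> (v \<star> w)"
  by (rule mult_assoc_word)

lemma winv_wmult:
  assumes "reduced u" "reduced v"
  shows "winv (u \<star> v) = winv v \<star> winv u"
proof -
  have r: "reduced (u \<star> v)" using assms by (simp add: reduced_mult)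
  have "winv (u \<star> v) = winv (u \<star> v) \<star> ((u \<star> v) \<star> (winv v \<star> winv u))"
    using assms by (simp add: wmult_assoc wmult_winv_cancel wmult_winv_right reduced_mult mult_Nil)
  also have "\<dots> = winv v \<star> winv u"
    using assms by (intro winv_wmult_cancel) (simp add: reduced_mult)
  finally show ?thesis .
qed

lemma carrier_free_group: "carrier (free_group A) = {w. reduced w \<and> fst ` set w \<subseteq> A}"
  and mult_free_group: "u \<otimes>\<^bsub>free_group A\<^esub> v = u \<star> v"
  and one_free_group: "\<one>\<^bsub>free_group A\<^esub> = []"
  by (auto simp: free_group_def)

lemma wmult_closed:
  assumes "u \<in> carrier (free_group A)" "v \<in> carrier (free_group A)"
  shows "u \<star> v \<in> carrier (free_group A)"
  using monoid.m_closed[OF group.is_monoid[OF group_free_group] assms] by (simp add: mult_free_group)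

lemma winv_closed: "u \<in> carrier (free_group A) \<Longrightarrow> winv u \<in> carrier (free_group A)"
  by (simp add: carrier_free_group)

lemma inv_free_group:
  assumes "u \<in> carrier (free_group A)"
  shows "inv\<^bsub>free_group A\<^esub> u = winv u"
  by (rule group.inv_equality[OF group_free_group])
    (use assms in \<open>auto simp: mult_free_group one_free_group winv_closed carrier_free_group wmult_winv_left\<close>)

lemma word_value_Nil: "word_value G [] = \<one>\<^bsub>G\<^esub>"
  and word_value_Cons: "word_value G ((g, e) # z) = (if e then g else inv\<^bsub>G\<^esub> g) \<otimes>\<^bsub>G\<^esub> word_value G z"
  by (auto simp: word_value_def)

lemma word_value_single:
  assumes "group G" "g \<in> carrier G"
  shows "word_value G [(g, True)] = g"
  using assms group.is_monoid by (auto simp: word_value_def intro!: monoid.r_one)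

lemma basis_generates:
  assumes "is_basis G J B" "g \<in> J"
  obtains z where "z \<in> carrier (free_group B)" "word_value G z = g"
  using assms by (auto simp: is_basis_def iso_def bij_betw_def)

lemma basis_word_value_closed:
  assumes "is_basis G J B" "z \<in> carrier (free_group B)"
  shows "word_value G z \<in> J"
  using assms by (auto simp: is_basis_def iso_def bij_betw_def)

lemma basis_inj:
  assumes "is_basis G J B"
  shows "inj_on (word_value G) (carrier (free_group B))"
  using assms by (auto simp: is_basis_def iso_def bij_betw_def)

lemma basis_mult:
  assumes "is_basis G J B" "y \<in> carrier (free_group B)" "z \<in> carrier (free_group B)"
  shows "word_value G (y \<star> z) = word_value G y \<otimes>\<^bsub>G\<^esub> word_value G z"
  using assms by (auto simp: is_basis_def iso_def hom_def mult_free_group)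

text \<open>Multiplicativity of \<open>word_value\<close> is automatic for a subset of a group, so a
  basis is certified by any map \<open>f\<close> that inverts it on both sides. Every basis
  constructed below is certified in this way.\<close>

lemma is_basisI:
  assumes G: "group G" and J: "subgroup J G" and B: "B \<subseteq> J"
    and f: "\<And>g. g \<in> J \<Longrightarrow> f g \<in> carrier (free_group B)"
    and vf: "\<And>g. g \<in> J \<Longrightarrow> word_value G (f g) = g"
    and fv: "\<And>z. z \<in> carrier (free_group B) \<Longrightarrow> f (word_value G z) = z"
  shows "is_basis G J B"
proof -
  interpret group G by fact
  interpret J: subgroup J G by fact
  have v: "word_value G z \<in> J" if "fst ` set z \<subseteq> B" for z
    using that
  proof (induction z)
    case Nil
    then show ?case by (simp add: word_value_Nil)
  next
    case (Cons x z)
    then show ?case using B by (cases x) (auto simp: word_value_Cons)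
  qed
  have "bij_betw (word_value G) (carrier (free_group B)) J"
    by (rule bij_betw_byWitness[where f' = f]) (use f vf fv v in \<open>auto simp: carrier_free_group\<close>)
  moreover have "word_value G \<in> hom (free_group B) (G\<lparr>carrier := J\<rparr>)"
    using word_value_mult v B J.subset
    by (intro homI) (simp_all add: carrier_free_group mult_free_group subset_trans[OF _ subset_trans[OF B J.subset]])
  ultimately show ?thesis using B by (simp add: is_basis_def iso_def)
qed

text \<open>Homomorphisms to the group with two elements, with \<open>\<noteq>\<close> as addition on \<open>bool\<close>.\<close>

definition parity_hom :: "('g, 'b) monoid_scheme \<Rightarrow> 'g set \<Rightarrow> ('g \<Rightarrow> bool) \<Rightarrow> bool" where
  "parity_hom G J f \<longleftrightarrow> (\<forall>x\<in>J. \<forall>y\<in>J. f (x \<otimes>\<^bsub>G\<^esub> y) \<longleftrightarrow> f x \<noteq> f y)"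

lemma odd_filter_cancel_Cons:
  "odd (length (filter (\<lambda>y. P (fst y)) (cancel_Cons x w))) \<longleftrightarrow>
    (P (fst x) \<noteq> odd (length (filter (\<lambda>y. P (fst y)) w)))"
  by (cases w) auto

lemma odd_filter_wmult:
  "odd (length (filter (\<lambda>y. P (fst y)) (u \<star> v))) \<longleftrightarrow>
    (odd (length (filter (\<lambda>y. P (fst y)) u)) \<noteq> odd (length (filter (\<lambda>y. P (fst y)) v)))"
  by (induction u) (use odd_filter_cancel_Cons[of P] in auto)

text \<open>Values on a basis can be prescribed at will: write an element as a word over
  \<open>B\<close> and count, modulo 2, the letters taken from \<open>S\<close>. Cancellation
  removes two letters over the same basis element, so this count is additive.\<close>

lemma basis_parity_hom:
  assumes G: "group G" and J: "J \<subseteq> carrier G" and B: "is_basis G J B"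
  obtains f where "parity_hom G J f" "\<And>b. b \<in> B \<Longrightarrow> f b \<longleftrightarrow> b \<in> S"
proof
  let ?\<kappa> = "the_inv_into (carrier (free_group B)) (word_value G)"
  let ?f = "\<lambda>g. odd (length (filter (\<lambda>y. fst y \<in> S) (?\<kappa> g)))"
  have \<kappa>: "?\<kappa> (word_value G z) = z" if "z \<in> carrier (free_group B)" for z
    using that basis_inj[OF B] by (rule the_inv_into_f_f[rotated])
  show "parity_hom G J ?f"
    unfolding parity_hom_def
  proof (intro ballI)
    fix x y assume "x \<in> J" "y \<in> J"
    then obtain u v where uv: "u \<in> carrier (free_group B)" "word_value G u = x"
      "v \<in> carrier (free_group B)" "word_value G v = y"
      using basis_generates[OF B] by metis
    have "?\<kappa> (x \<otimes>\<^bsub>G\<^esub> y) = u \<star> v"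
      using \<kappa>[of "u \<star> v"] uv basis_mult[OF B, of u v] by (auto simp: wmult_closed)
    then show "?f (x \<otimes>\<^bsub>G\<^esub> y) \<longleftrightarrow> ?f x \<noteq> ?f y"
      using uv \<kappa> odd_filter_wmult[of "\<lambda>b. b \<in> S" u v] by auto
  qed
  fix b assume b: "b \<in> B"
  have "b \<in> carrier G" using B J b by (auto simp: is_basis_def)
  then have "?\<kappa> b = [(b, True)]"
    using \<kappa>[of "[(b, True)]"] b word_value_single[OF G] by (simp add: carrier_free_group reduced_Cons)
  then show "?f b \<longleftrightarrow> b \<in> S" by simp
qed

lemma parity_hom_one:
  assumes "group G" "subgroup J G" "parity_hom G J f"
  shows "\<not> f \<one>\<^bsub>G\<^esub>"
proof -
  interpret group G by fact
  show ?thesis using assms(3) subgroup.one_closed[OF assms(2)] l_one[OF one_closed]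
    unfolding parity_hom_def by metis
qed

lemma parity_hom_inv:
  assumes "group G" "subgroup J G" "parity_hom G J f" "g \<in> J"
  shows "f (inv\<^bsub>G\<^esub> g) = f g"
proof -
  interpret group G by fact
  have "g \<in> carrier G" using subgroup.mem_carrier[OF assms(2,4)] .
  then have "\<not> f (g \<otimes>\<^bsub>G\<^esub> inv\<^bsub>G\<^esub> g)" using parity_hom_one[OF assms(1-3)] by simp
  then show ?thesis
    using assms(3,4) subgroup.m_inv_closed[OF assms(2,4)] by (auto simp: parity_hom_def)
qed

lemma parity_hom_eq_on_basis:
  assumes G: "group G" and J: "subgroup J G" and B: "is_basis G J B"
    and f: "parity_hom G J f" "parity_hom G J h" and eq: "\<And>b. b \<in> B \<Longrightarrow> f b = h b" and g: "g \<in> J"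
  shows "f g = h g"
proof -
  interpret group G by fact
  interpret J: subgroup J G by fact
  have BJ: "B \<subseteq> J" using B by (auto simp: is_basis_def)
  have "word_value G z \<in> J \<and> f (word_value G z) = h (word_value G z)" if "fst ` set z \<subseteq> B" for z
    using that
  proof (induction z)
    case Nil
    then show ?case using parity_hom_one[OF G J f(1)] parity_hom_one[OF G J f(2)] by (simp add: word_value_Nil)
  next
    case (Cons x z)
    obtain b e where x: "x = (b, e)" by (cases x)
    have b: "b \<in> B" "b \<in> J" "inv\<^bsub>G\<^esub> b \<in> J" using Cons.prems BJ by (auto simp: x)
    moreover have "f (inv\<^bsub>G\<^esub> b) = h (inv\<^bsub>G\<^esub> b)"
      using parity_hom_inv[OF G J f(1)] parity_hom_inv[OF G J f(2)] eq b by simp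
    ultimately show ?case using Cons f eq
      by (auto simp: x word_value_Cons parity_hom_def)
  qed
  then show ?thesis
    using basis_generates[OF B g] by (metis (mono_tags, lifting) carrier_free_group mem_Collect_eq)
qed

text \<open>Homomorphisms to the group of order two take arbitrary values on \<open>C\<close> and
  are determined by their values on \<open>B\<close>. So subsets of \<open>C\<close> inject into
  subsets of \<open>B\<close>, and \<open>2 ^ card C \<le> 2 ^ card B\<close>.\<close>

lemma basis_card_le:
  assumes G: "group G" and J: "subgroup J G" and B: "is_basis G J B" "finite B"
    and C: "is_basis G J C" "finite C"
  shows "card C \<le> card B"
proof -
  have JG: "J \<subseteq> carrier G" using J by (rule subgroup.subset)
  have "\<exists>f. parity_hom G J f \<and> (\<forall>c\<in>C. f c \<longleftrightarrow> c \<in> S)" for S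
    using basis_parity_hom[OF G JG C(1), of S] by metis
  then obtain F where F: "\<And>S. parity_hom G J (F S)" "\<And>S c. c \<in> C \<Longrightarrow> F S c \<longleftrightarrow> c \<in> S"
    by metis
  have CJ: "C \<subseteq> J" using C by (auto simp: is_basis_def)
  have "inj_on (\<lambda>S. {b \<in> B. F S b}) (Pow C)"
  proof (rule inj_onI)
    fix S T assume S: "S \<in> Pow C" "T \<in> Pow C" and e: "{b \<in> B. F S b} = {b \<in> B. F T b}"
    have "F S c = F T c" if "c \<in> C" for c
      by (rule parity_hom_eq_on_basis[OF G J B(1) F(1) F(1)]) (use e that CJ in auto)
    then show "S = T" using S F(2) by blast
  qed
  then have "card (Pow C) \<le> card (Pow B)"
    by (rule card_inj_on_le) (use B in auto)
  then show ?thesis using B C by (simp add: card_Pow)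
qed

section \<open>Labelled graphs and their loop groups\<close>

text \<open>A graph with edges labelled by letters is given as an inverse-closed set of darts (a vertex
  and an outgoing label); the end of a dart is prescribed by \<open>act\<close>, so that every graph is
  deterministic. Vertices are those reachable from the base point \<open>v0\<close>.\<close>

locale dart_graph =
  fixes act :: "'v \<Rightarrow> 'a \<times> bool \<Rightarrow> 'v" and v0 :: 'v and A :: "'a set"
begin

abbreviation FA :: "'a word monoid" where
  "FA \<equiv> free_group A"

definition is_graph :: "('v \<times> 'a \<times> bool) set \<Rightarrow> bool" where
  "is_graph D \<longleftrightarrow> (\<forall>a x. (a, x) \<in> D \<longrightarrow>
    fst x \<in> A \<and> (act a x, flip x) \<in> D \<and> act (act a x) (flip x) = a)"

abbreviation endp :: "'v \<Rightarrow> 'a word \<Rightarrow> 'v" where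
  "endp a w \<equiv> foldl act a w"

fun path :: "('v \<times> 'a \<times> bool) set \<Rightarrow> 'v \<Rightarrow> 'a word \<Rightarrow> bool" where
  "path D a [] \<longleftrightarrow> True"
| "path D a (x # w) \<longleftrightarrow> (a, x) \<in> D \<and> path D (act a x) w"

definition verts :: "('v \<times> 'a \<times> bool) set \<Rightarrow> 'v set" where
  "verts D = insert v0 (fst ` D)"

definition conn :: "('v \<times> 'a \<times> bool) set \<Rightarrow> bool" where
  "conn D \<longleftrightarrow> (\<forall>a\<in>verts D. \<exists>w. path D v0 w \<and> endp v0 w = a)"

definition loops :: "('v \<times> 'a \<times> bool) set \<Rightarrow> 'a word set" where
  "loops D = {w. reduced w \<and> path D v0 w \<and> endp v0 w = v0}"

definition add_edge :: "'v \<Rightarrow> 'a \<times> bool \<Rightarrow> ('v \<times> 'a \<times> bool) set \<Rightarrow> ('v \<times> 'a \<times> bool) set" where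
  "add_edge u x D = insert (u, x) (insert (act u x, flip x) D)"

lemma is_graphD:
  assumes "is_graph D" "(a, x) \<in> D"
  shows "fst x \<in> A" "(act a x, flip x) \<in> D" "act (act a x) (flip x) = a"
  using assms unfolding is_graph_def by blast+

lemma path_append: "path D a (u @ w) \<longleftrightarrow> path D a u \<and> path D (endp a u) w"
  by (induction u arbitrary: a) auto

lemma path_mono: "path D a w \<Longrightarrow> D \<subseteq> E \<Longrightarrow> path E a w"
  by (induction w arbitrary: a) auto

lemma path_letters: "is_graph D \<Longrightarrow> path D a w \<Longrightarrow> fst ` set w \<subseteq> A"
  by (induction w arbitrary: a) (auto dest: is_graphD(1))

lemma v0_in_verts [simp]: "v0 \<in> verts D"
  by (simp add: verts_def)

lemma act_in_verts: "is_graph D \<Longrightarrow> (a, x) \<in> D \<Longrightarrow> act a x \<in> verts D"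
  using is_graphD(2)[of D a x] by (force simp: verts_def)

lemma endp_in_verts: "is_graph D \<Longrightarrow> path D a w \<Longrightarrow> a \<in> verts D \<Longrightarrow> endp a w \<in> verts D"
  by (induction w arbitrary: a) (auto simp: act_in_verts)

lemma path_cancel_Cons:
  assumes "is_graph D" "path D a (x # w)"
  shows "path D a (cancel_Cons x w) \<and> endp a (cancel_Cons x w) = endp a (x # w)"
  using assms by (cases w) (auto dest: is_graphD(3))

lemma path_wmult:
  assumes "is_graph D" "path D a (u @ w)"
  shows "path D a (u \<star> w) \<and> endp a (u \<star> w) = endp a (u @ w)"
  using assms(2)
proof (induction u arbitrary: a)
  case (Cons x u)
  then show ?case using path_cancel_Cons[OF assms(1), of a x "u \<star> w"] by simp
qed simp

lemma path_winv:
  assumes "is_graph D" "path D a w"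
  shows "path D (endp a w) (winv w) \<and> endp (endp a w) (winv w) = a"
  using assms(2)
proof (induction w arbitrary: a)
  case (Cons x w)
  then show ?case using is_graphD[OF assms(1), of a x] by (simp add: path_append)
qed simp

lemma loops_closed: "is_graph D \<Longrightarrow> loops D \<subseteq> carrier FA"
  using path_letters[of D v0] by (auto simp: loops_def carrier_free_group)

lemma Nil_in_loops [simp]: "[] \<in> loops D"
  by (simp add: loops_def)

lemma loops_wmult: "is_graph D \<Longrightarrow> g \<in> loops D \<Longrightarrow> h \<in> loops D \<Longrightarrow> g \<star> h \<in> loops D"
  using path_wmult[of D v0 g h] by (simp add: loops_def reduced_mult path_append)

lemma loops_winv: "is_graph D \<Longrightarrow> g \<in> loops D \<Longrightarrow> winv g \<in> loops D"
  using path_winv[of D v0 g] by (simp add: loops_def)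

lemma loops_mono: "D \<subseteq> E \<Longrightarrow> loops D \<subseteq> loops E"
  by (auto simp: loops_def path_mono)

lemma subgroup_loops:
  assumes "is_graph D"
  shows "subgroup (loops D) FA"
proof (rule group.subgroupI[OF group_free_group loops_closed[OF assms]])
  show "loops D \<noteq> {}" using Nil_in_loops by blast
next
  fix g assume g: "g \<in> loops D"
  then show "inv\<^bsub>FA\<^esub> g \<in> loops D"
    using loops_winv[OF assms g] inv_free_group[of g A] loops_closed[OF assms] by auto
qed (simp add: mult_free_group loops_wmult assms)

lemma loopsI:
  assumes "is_graph D" "path D v0 p" "path D v0 q" "endp v0 p = endp v0 q" "reduced q"
  shows "p \<star> winv q \<in> loops D"
  using path_wmult[OF assms(1), of v0 p "winv q"] path_winv[OF assms(1,3)] assms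
  by (auto simp: loops_def path_append reduced_mult)

lemma is_graph_add_edge:
  assumes "is_graph D" "fst x \<in> A" "act (act u x) (flip x) = u"
  shows "is_graph (add_edge u x D)"
  using assms by (auto simp: is_graph_def add_edge_def)

lemma verts_add_edge: "u \<in> verts D \<Longrightarrow> verts (add_edge u x D) = insert (act u x) (verts D)"
  by (auto simp: verts_def add_edge_def)

lemma conn_reduced_path:
  assumes "is_graph D" "conn D" "a \<in> verts D"
  obtains w where "reduced w" "path D v0 w" "endp v0 w = a"
proof -
  obtain w where w: "path D v0 w" "endp v0 w = a" using assms by (auto simp: conn_def)
  then show ?thesis using path_wmult[OF assms(1), of v0 w "[]"] that[of "w \<star> []"]
    by (simp add: reduced_mult)
qed

lemma conn_add_edge:
  assumes "conn D" "u \<in> verts D"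
  shows "conn (add_edge u x D)"
  unfolding conn_def
proof
  fix a assume "a \<in> verts (add_edge u x D)"
  then consider "a \<in> verts D" | "a = act u x" using verts_add_edge[OF assms(2)] by auto
  then show "\<exists>w. path (add_edge u x D) v0 w \<and> endp v0 w = a"
  proof cases
    case 1
    then show ?thesis using assms(1) path_mono[of D v0 _ "add_edge u x D"]
      by (force simp: conn_def add_edge_def)
  next
    case 2
    obtain w where w: "path D v0 w" "endp v0 w = u" using assms by (auto simp: conn_def)
    then have "path (add_edge u x D) v0 (w @ [x])"
      using path_mono[of D v0 w "add_edge u x D"] by (auto simp: path_append add_edge_def)
    then show ?thesis using w 2 by (intro exI[of _ "w @ [x]"]) simp
  qed
qed

text \<open>A path that has entered the new vertex can leave it only by the dart it came from, which
  a reduced path may not do. Hence reduced paths between old vertices never use the new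
  edge.\<close>

lemma loops_add_edge_new_vertex:
  assumes D: "is_graph D" and u: "u \<in> verts D" and v: "act u x \<notin> verts D"
  shows "loops (add_edge u x D) = loops D"
proof
  have "path D a w" if "path (add_edge u x D) a w" "reduced w" "a \<in> verts D" "endp a w \<in> verts D" for a w
    using that
  proof (induction w arbitrary: a)
    case (Cons y w)
    have "(a, y) \<noteq> (act u x, flip x)" using Cons.prems v by auto
    moreover have "(a, y) \<noteq> (u, x)"
    proof
      assume e: "(a, y) = (u, x)"
      with Cons.prems v obtain z w' where w: "w = z # w'" by (cases w) auto
      then have "(act u x, z) \<in> add_edge u x D" "z \<noteq> flip x"
        using Cons.prems e by (auto simp: reduced_Cons)
      moreover have "act u x \<noteq> u" "(act u x, z) \<notin> D"
        using u v by (auto simp: verts_def image_iff)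
      ultimately show False by (auto simp: add_edge_def)
    qed
    ultimately have "(a, y) \<in> D" using Cons.prems by (auto simp: add_edge_def)
    then show ?case using Cons act_in_verts[OF D] by (auto simp: reduced_Cons)
  qed simp
  then show "loops (add_edge u x D) \<subseteq> loops D" by (auto simp: loops_def)
qed (rule loops_mono, auto simp: add_edge_def)

section \<open>Cocycles on darts, and the free generator added by a new edge\<close>

fun cocycle :: "('v \<Rightarrow> 'a \<times> bool \<Rightarrow> 'b word) \<Rightarrow> 'v \<Rightarrow> 'a word \<Rightarrow> 'b word" where
  "cocycle c a [] = []"
| "cocycle c a (x # w) = c a x \<star> cocycle c (act a x) w"

text \<open>The condition on inverse darts makes the product along a path invariant under
  cancellation, so on the loops at \<open>v0\<close> it is a homomorphism into the free group on
  \<open>B\<close>.\<close>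

definition is_cocycle :: "('v \<times> 'a \<times> bool) set \<Rightarrow> 'b set \<Rightarrow> ('v \<Rightarrow> 'a \<times> bool \<Rightarrow> 'b word) \<Rightarrow> bool" where
  "is_cocycle D B c \<longleftrightarrow>
    (\<forall>(a, x)\<in>D. c a x \<in> carrier (free_group B) \<and> c (act a x) (flip x) = winv (c a x))"

lemma cocycle_closed:
  "is_cocycle D B c \<Longrightarrow> path D a w \<Longrightarrow> cocycle c a w \<in> carrier (free_group B)"
proof (induction w arbitrary: a)
  case (Cons x w)
  then show ?case by (auto simp: is_cocycle_def intro!: wmult_closed)
qed (simp add: carrier_free_group)

lemma cocycle_reduced: "is_cocycle D B c \<Longrightarrow> path D a w \<Longrightarrow> reduced (cocycle c a w)"
  using cocycle_closed by (fastforce simp: carrier_free_group)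

lemma cocycle_cancel_Cons:
  assumes "is_graph D" "is_cocycle D B c" "path D a (x # w)"
  shows "cocycle c a (cancel_Cons x w) = cocycle c a (x # w)"
proof (cases "w \<noteq> [] \<and> hd w = flip x")
  case True
  then obtain w' where w: "w = flip x # w'" by (cases w) auto
  then show ?thesis
    using assms is_graphD(3)[OF assms(1), of a x] cocycle_reduced[OF assms(2), of a w']
    by (auto simp: is_cocycle_def wmult_winv_cancel)
next
  case False
  then show ?thesis by (cases w) auto
qed

lemma cocycle_append:
  assumes "is_cocycle D B c" "path D a (u @ w)"
  shows "cocycle c a (u @ w) = cocycle c a u \<star> cocycle c (endp a u) w"
  using assms(2)
proof (induction u arbitrary: a)
  case (Cons x u)
  then show ?case using cocycle_reduced[OF assms(1), of "endp a (x # u)" w]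
    by (simp add: path_append wmult_assoc)
qed simp

lemma cocycle_wmult:
  assumes "is_graph D" "is_cocycle D B c" "path D a (u @ w)"
  shows "cocycle c a (u \<star> w) = cocycle c a u \<star> cocycle c (endp a u) w"
proof -
  have "cocycle c a (u \<star> w) = cocycle c a (u @ w)"
    using assms(3)
  proof (induction u arbitrary: a)
    case (Cons x u)
    then show ?case
      using cocycle_cancel_Cons[OF assms(1,2), of a x "u \<star> w"] path_wmult[OF assms(1), of "act a x" u w]
      by simp
  qed simp
  then show ?thesis using cocycle_append[OF assms(2,3)] by simp
qed

lemma cocycle_winv:
  assumes "is_graph D" "is_cocycle D B c" "g \<in> loops D"
  shows "cocycle c v0 (winv g) = winv (cocycle c v0 g)"
proof -
  have g: "path D v0 g" "path D v0 (winv g)" "endp v0 g = v0" "reduced g"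
    using assms loops_winv[OF assms(1,3)] by (auto simp: loops_def)
  have "cocycle c v0 g \<star> cocycle c v0 (winv g) = cocycle c v0 (g \<star> winv g)"
    using cocycle_wmult[OF assms(1,2), of v0 g "winv g"] g by (simp add: path_append)
  then have "cocycle c v0 g \<star> cocycle c v0 (winv g) = []" using g by (simp add: wmult_winv_right)
  then have "winv (cocycle c v0 g) \<star> [] = cocycle c v0 (winv g)"
    using winv_wmult_cancel[OF cocycle_reduced[OF assms(2) g(2)], of "cocycle c v0 g"] by simp
  then show ?thesis using cocycle_reduced[OF assms(2) g(1)] by (simp add: mult_Nil)
qed

lemma free_group_word_value:
  assumes B: "B \<subseteq> carrier FA" and z: "z \<in> carrier (free_group B)"
  shows word_value_in_free_group: "word_value FA z \<in> carrier FA"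
    and word_value_winv: "word_value FA (winv z) = winv (word_value FA z)"
    and word_value_wmult: "\<And>y. y \<in> carrier (free_group B) \<Longrightarrow>
      word_value FA (y \<star> z) = word_value FA y \<star> word_value FA z"
proof -
  interpret group FA by (rule group_free_group)
  show m: "word_value FA (y \<star> z) = word_value FA y \<star> word_value FA z"
    if "y \<in> carrier (free_group B)" for y
    using word_value_mult[of y z] that z B by (auto simp: carrier_free_group mult_free_group)
  have c: "word_value FA y \<in> carrier FA" if "y \<in> carrier (free_group B)" for y
    using word_value_closed[of y] that B by (auto simp: carrier_free_group)
  show "word_value FA z \<in> carrier FA" by (rule c[OF z])
  have "word_value FA (winv z \<star> z) = word_value FA (winv z) \<star> word_value FA z"
    by (rule m[OF winv_closed[OF z]])
  then have "word_value FA (winv z) \<otimes>\<^bsub>FA\<^esub> word_value FA z = \<one>\<^bsub>FA\<^esub>"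
    using z by (simp add: wmult_winv_left carrier_free_group word_value_Nil mult_free_group one_free_group)
  then have "inv\<^bsub>FA\<^esub> (word_value FA z) = word_value FA (winv z)"
    by (rule inv_equality) (use c[OF z] c[OF winv_closed[OF z]] in auto)
  then show "word_value FA (winv z) = winv (word_value FA z)"
    using inv_free_group[OF c[OF z]] by simp
qed

text \<open>The inverse of \<open>word_value\<close> is built as a cocycle on the darts: with a fixed path \<open>\<tau> a\<close> to every
  vertex \<open>a\<close>, a dart from \<open>a\<close> to \<open>a'\<close> labelled \<open>y\<close> gets the \<open>B\<close>-word of the loop
  \<open>\<tau> a \<star> [y] \<star> winv (\<tau> a')\<close>, and the new dart gets the value that makes \<open>b\<close> a letter.\<close>

lemma is_basis_add_edge:
  assumes D: "is_graph D" and conn: "conn D" and B: "is_basis FA (loops D) B"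
    and ux: "(u, x) \<notin> D" "fst x \<in> A" "act (act u x) (flip x) = u"
    and uv: "u \<in> verts D" "act u x \<in> verts D"
    and \<alpha>: "path D v0 \<alpha>" "endp v0 \<alpha> = u" "reduced \<alpha>"
    and \<beta>: "path D v0 \<beta>" "endp v0 \<beta> = act u x" "reduced \<beta>"
  defines "b \<equiv> \<alpha> \<star> ([x] \<star> winv \<beta>)"
  shows "is_basis FA (loops (add_edge u x D)) (insert b B)" and "b \<notin> B"
proof -
  define v where "v = act u x"
  define E where "E = add_edge u x D"
  have E: "is_graph E" unfolding E_def by (rule is_graph_add_edge[OF D ux(2,3)])
  have DE: "D \<subseteq> E" by (auto simp: E_def add_edge_def)
  have vE: "verts E = verts D" using verts_add_edge[OF uv(1)] uv by (auto simp: E_def)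
  have uxE: "(u, x) \<in> E" "(v, flip x) \<in> E" by (auto simp: E_def add_edge_def v_def)
  have vx: "(v, flip x) \<notin> D" using is_graphD[OF D, of v "flip x"] ux by (auto simp: v_def)
  have \<alpha>x: "path E v0 (\<alpha> @ [x])" "endp v0 (\<alpha> @ [x]) = v"
    using \<alpha> path_mono[OF _ DE] uxE by (auto simp: path_append v_def)
  have \<beta>': "path E v0 \<beta>" "path E v (winv \<beta>)" "endp v (winv \<beta>) = v0" "path D v (winv \<beta>)"
    using \<beta> path_mono[OF _ DE] path_winv[OF D \<beta>(1)] by (auto simp: v_def)
  have pb: "path E v0 (\<alpha> @ [x] @ winv \<beta>)" "path E v0 (\<alpha> @ ([x] \<star> winv \<beta>))"
    "endp v0 (\<alpha> @ ([x] \<star> winv \<beta>)) = v0"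
    using \<alpha>x \<beta>' path_wmult[OF E, of u "[x]" "winv \<beta>"] uxE \<alpha>
    by (auto simp: path_append v_def)
  have bE: "b \<in> loops E"
    using path_wmult[OF E pb(2)] pb(3) \<beta>(3) by (auto simp: loops_def b_def reduced_cancel_Cons reduced_mult)
  \<comment> \<open>If \<open>b\<close> were a loop of \<open>D\<close>, cancelling
    \<open>\<alpha>\<close> and \<open>\<beta>\<close> from its two ends would leave the one-letter
    path \<open>[x]\<close> from \<open>u\<close> inside \<open>D\<close>.\<close>
  have bD: "b \<notin> loops D"
  proof
    assume "b \<in> loops D"
    then have "path D (endp v0 (winv \<alpha> \<star> b)) []" by simp
    have pa: "path D u (winv \<alpha>)" "endp u (winv \<alpha>) = v0" using path_winv[OF D \<alpha>(1)] \<alpha> by auto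
    have bp: "path D v0 b" "endp v0 b = v0" using \<open>b \<in> loops D\<close> by (auto simp: loops_def)
    have *: "winv \<alpha> \<star> b = [x] \<star> winv \<beta>"
      unfolding b_def using \<beta>(3) by (intro winv_wmult_cancel) (simp add: reduced_cancel_Cons)
    have **: "([x] \<star> winv \<beta>) \<star> \<beta> = [x]"
      using wmult_assoc[OF \<beta>(3), of "[x]" "winv \<beta>"] wmult_winv_left[OF \<beta>(3)] by simp
    have "path D u ([x] \<star> winv \<beta>) \<and> endp u ([x] \<star> winv \<beta>) = v0"
      using path_wmult[OF D, of u "winv \<alpha>" b] pa bp * by (auto simp: path_append)
    then have "path D u [x]"
      using path_wmult[OF D, of u "[x] \<star> winv \<beta>" \<beta>] ** \<beta>(1) by (auto simp: path_append)
    then show False using ux by simp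
  qed
  have BD: "B \<subseteq> loops D" using B by (simp add: is_basis_def)
  then show "b \<notin> B" using bD by auto

  define B' where "B' = insert b B"
  have B'E: "B' \<subseteq> loops E" using BD loops_mono[OF DE] bE by (auto simp: B'_def)
  have B'F: "B' \<subseteq> carrier FA" using B'E loops_closed[OF E] by auto
  have BF: "B \<subseteq> carrier FA" using B'F by (auto simp: B'_def)
  have cBB': "carrier (free_group B) \<subseteq> carrier (free_group B')"
    by (auto simp: carrier_free_group B'_def)
  let ?val = "word_value FA"
  define \<kappa> where "\<kappa> = the_inv_into (carrier (free_group B)) ?val"
  have \<kappa>val: "\<kappa> (?val z) = z" if "z \<in> carrier (free_group B)" for z
    unfolding \<kappa>_def using basis_inj[OF B] that by (rule the_inv_into_f_f)
  have val\<kappa>: "?val (\<kappa> g) = g" and \<kappa>c: "\<kappa> g \<in> carrier (free_group B)" if "g \<in> loops D" for g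
    using basis_generates[OF B that] \<kappa>val by metis+
  have \<kappa>r: "reduced (\<kappa> g)" if "g \<in> loops D" for g
    using \<kappa>c[OF that] by (simp add: carrier_free_group)
  have \<kappa>mult: "\<kappa> (g \<star> h) = \<kappa> g \<star> \<kappa> h" if "g \<in> loops D" "h \<in> loops D" for g h
    using \<kappa>val[of "\<kappa> g \<star> \<kappa> h"] word_value_wmult[OF BF, of "\<kappa> h" "\<kappa> g"] val\<kappa> \<kappa>c that
    by (simp add: wmult_closed)
  have \<kappa>Nil: "\<kappa> [] = []"
    using \<kappa>val[of "[]"] by (simp add: word_value_Nil carrier_free_group one_free_group)
  have \<kappa>winv: "\<kappa> (winv g) = winv (\<kappa> g)" if "g \<in> loops D" for g
    using \<kappa>val[of "winv (\<kappa> g)"] word_value_winv[OF BF \<kappa>c[OF that]] val\<kappa>[OF that] \<kappa>c[OF that]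
    by (simp add: winv_closed)

  \<comment> \<open>The base point gets the empty path, so that in the formulas for
    \<open>?\<psi>\<close> below the connecting paths disappear for loops at
    \<open>v0\<close>.\<close>
  have "\<exists>w. reduced w \<and> path D v0 w \<and> endp v0 w = a \<and> (a = v0 \<longrightarrow> w = [])" if "a \<in> verts D" for a
  proof (cases "a = v0")
    case False
    then show ?thesis using conn_reduced_path[OF D conn that] by metis
  qed (auto intro!: exI[of _ "[]"])
  then obtain \<tau> where \<tau>: "\<And>a. a \<in> verts D \<Longrightarrow> reduced (\<tau> a)" "\<And>a. a \<in> verts D \<Longrightarrow> path D v0 (\<tau> a)"
    "\<And>a. a \<in> verts D \<Longrightarrow> endp v0 (\<tau> a) = a" and \<tau>0: "\<tau> v0 = []"
    using v0_in_verts by metis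
  have lp: "\<tau> a \<star> (w \<star> winv (\<tau> (endp a w))) \<in> loops D" if "path D a w" "a \<in> verts D" for a w
  proof -
    have e: "endp a w \<in> verts D" by (rule endp_in_verts[OF D that])
    then have "path D v0 (\<tau> a @ w)" "endp v0 (\<tau> a @ w) = endp a w"
      using \<tau>[OF that(2)] that by (auto simp: path_append)
    moreover have "path D (endp a w) (winv (\<tau> (endp a w)))" "endp (endp a w) (winv (\<tau> (endp a w))) = v0"
      using path_winv[OF D \<tau>(2)[OF e]] \<tau>(3)[OF e] by auto
    ultimately have "path D v0 ((\<tau> a @ w) \<star> winv (\<tau> (endp a w))) \<and>
        endp v0 ((\<tau> a @ w) \<star> winv (\<tau> (endp a w))) = v0"
      using path_wmult[OF D, of v0 "\<tau> a @ w" "winv (\<tau> (endp a w))"]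
      by (simp add: path_append)
    then show ?thesis using \<tau>(1)[OF e] by (simp add: loops_def reduced_mult)
  qed
  \<comment> \<open>\<open>p\<close> and \<open>q\<close> measure how the given paths
    \<open>\<alpha>\<close>, \<open>\<beta>\<close> differ from the fixed ones. Along
    \<open>b\<close>, the part \<open>\<alpha>\<close> contributes \<open>winv (\<kappa> p)\<close>
    and the part \<open>winv \<beta>\<close> contributes \<open>winv (\<kappa> q)\<close>; the value
    \<open>cb\<close> of the new dart is chosen to cancel both and to leave the single letter
    \<open>b\<close>.\<close>
  define p where "p = \<tau> u \<star> winv \<alpha>"
  define q where "q = \<beta> \<star> winv (\<tau> v)"
  have vv: "v \<in> verts D" using uv by (simp add: v_def)
  have p: "p \<in> loops D" unfolding p_def by (rule loopsI[OF D]) (use \<tau> uv \<alpha> in auto)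
  have q: "q \<in> loops D" unfolding q_def by (rule loopsI[OF D]) (use \<tau> vv \<beta> in \<open>auto simp: v_def\<close>)
  define cb where "cb = \<kappa> p \<star> ([(b, True)] \<star> \<kappa> q)"
  define c where "c a y = (if (a, y) = (u, x) then cb else if (a, y) = (v, flip x) then winv cb
      else \<kappa> (\<tau> a \<star> ([y] \<star> winv (\<tau> (act a y)))))" for a y
  have b1: "[(b, True)] \<in> carrier (free_group B')" by (simp add: carrier_free_group B'_def reduced_Cons)
  have cbc: "cb \<in> carrier (free_group B')"
    unfolding cb_def using \<kappa>c[OF p] \<kappa>c[OF q] cBB' b1 by (auto intro!: wmult_closed simp del: foldr.simps)
  have valb: "?val [(b, True)] = b"
    using word_value_single[OF group_free_group] B'F by (auto simp: B'_def)
  have \<tau>r: "reduced (\<tau> u)" "reduced (\<tau> v)" using \<tau>(1) uv vv by auto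
  have valcb: "?val cb = \<tau> u \<star> ([x] \<star> winv (\<tau> v))"
  proof -
    have "?val cb = p \<star> (b \<star> q)"
      unfolding cb_def
      using word_value_wmult[OF B'F, of "[(b, True)] \<star> \<kappa> q" "\<kappa> p"]
        word_value_wmult[OF B'F, of "\<kappa> q" "[(b, True)]"]
        subsetD[OF cBB' \<kappa>c[OF p]] subsetD[OF cBB' \<kappa>c[OF q]] b1
        wmult_closed[of "[(b, True)]" B' "\<kappa> q"] val\<kappa>[OF p] val\<kappa>[OF q] valb
      by (auto simp del: foldr.simps)
    also have "b \<star> q = \<alpha> \<star> ([x] \<star> (winv \<beta> \<star> q))"
      unfolding b_def using q by (simp add: wmult_assoc loops_def mult_cancel_Cons del: foldr.simps)
    also have "winv \<beta> \<star> q = winv (\<tau> v)"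
      unfolding q_def using \<tau>r by (simp add: winv_wmult_cancel)
    also have "p \<star> (\<alpha> \<star> ([x] \<star> winv (\<tau> v))) = \<tau> u \<star> (winv \<alpha> \<star> (\<alpha> \<star> ([x] \<star> winv (\<tau> v))))"
      unfolding p_def using \<tau>r by (intro wmult_assoc) (simp add: reduced_mult reduced_cancel_Cons)
    also have "winv \<alpha> \<star> (\<alpha> \<star> ([x] \<star> winv (\<tau> v))) = [x] \<star> winv (\<tau> v)"
      using \<tau>r by (intro winv_wmult_cancel) (simp add: reduced_cancel_Cons)
    finally show ?thesis .
  qed
  have cD: "c a y = \<kappa> (\<tau> a \<star> ([y] \<star> winv (\<tau> (act a y))))" if "(a, y) \<in> D" for a y
    using that ux vx by (auto simp: c_def)
  have wlp: "winv (\<tau> a \<star> ([y] \<star> winv (\<tau> (act a y)))) = \<tau> (act a y) \<star> ([flip y] \<star> winv (\<tau> a))"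
    if "a \<in> verts D" "act a y \<in> verts D" for a y
    using \<tau>(1)[OF that(1)] \<tau>(1)[OF that(2)] winv_wmult[of "\<tau> a" "[y] \<star> winv (\<tau> (act a y))"]
      winv_wmult[of "[y]" "winv (\<tau> (act a y))"] wmult_assoc[of "winv (\<tau> a)" "\<tau> (act a y)" "[flip y]"]
    by (simp add: reduced_cancel_Cons reduced_Cons)
  have valc: "?val (c a y) = \<tau> a \<star> ([y] \<star> winv (\<tau> (act a y)))" if ay: "(a, y) \<in> E" for a y
  proof -
    consider "(a, y) \<in> D" | "a = u" "y = x" | "a = v" "y = flip x"
      using ay by (auto simp: E_def add_edge_def v_def)
    then show ?thesis
    proof cases
      case 1
      then have "a \<in> verts D" by (force simp: verts_def)
      then show ?thesis using 1 val\<kappa> lp[of a "[y]"] cD by simp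
    next
      case 2
      then show ?thesis using valcb by (simp add: c_def v_def)
    next
      case 3
      then have "c a y = winv cb" by (auto simp: c_def)
      then show ?thesis
        using word_value_winv[OF B'F cbc] valcb wlp[of u x] uv ux 3 by (simp add: v_def)
    qed
  qed
  have coc: "is_cocycle E B' c"
    unfolding is_cocycle_def
  proof (intro ballI, clarify)
    fix a y assume ay: "(a, y) \<in> E"
    consider "(a, y) \<in> D" | "a = u" "y = x" | "a = v" "y = flip x"
      using ay by (auto simp: E_def add_edge_def v_def)
    then show "c a y \<in> carrier (free_group B') \<and> c (act a y) (flip y) = winv (c a y)"
    proof cases
      case 1
      then have a: "a \<in> verts D" "act a y \<in> verts D" using act_in_verts[OF D 1] by (force simp: verts_def, simp)
      have l: "\<tau> a \<star> ([y] \<star> winv (\<tau> (act a y))) \<in> loops D" using lp[of a "[y]"] 1 a by simp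
      have "c (act a y) (flip y) = \<kappa> (\<tau> (act a y) \<star> ([flip y] \<star> winv (\<tau> a)))"
        using cD is_graphD(2,3)[OF D 1] by simp
      also have "\<dots> = winv (c a y)" using wlp[OF a] \<kappa>winv[OF l] cD[OF 1] by simp
      finally show ?thesis using \<kappa>c[OF l] cD[OF 1] cBB' by auto
    next
      case 2
      then show ?thesis using cbc by (auto simp: c_def v_def)
    next
      case 3
      then show ?thesis using cbc ux winv_closed[OF cbc] by (auto simp: c_def v_def)
    qed
  qed
  let ?\<psi> = "cocycle c"
  \<comment> \<open>The product telescopes: at each intermediate vertex the connecting path of one
    dart cancels against that of the next.\<close>
  have val\<psi>: "?val (?\<psi> a w) = \<tau> a \<star> (w \<star> winv (\<tau> (endp a w)))" if "path E a w" "a \<in> verts D" for a w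
    using that
  proof (induction w arbitrary: a)
    case Nil
    then show ?case using \<tau>(1) by (simp add: word_value_Nil one_free_group wmult_winv_right)
  next
    case (Cons y w)
    let ?a = "act a y" and ?s = "w \<star> winv (\<tau> (endp (act a y) w))"
    have a: "?a \<in> verts D" "endp ?a w \<in> verts D"
      using Cons.prems act_in_verts[OF E] endp_in_verts[OF E, of a "y # w"] vE by auto
    have r: "reduced ?s" using \<tau>(1)[OF a(2)] by (simp add: reduced_mult)
    have "?val (?\<psi> a (y # w)) = ?val (c a y) \<star> ?val (?\<psi> ?a w)"
      using word_value_wmult[OF B'F, of "?\<psi> ?a w" "c a y"] cocycle_closed[OF coc, of ?a w] Cons.prems coc
      by (auto simp: is_cocycle_def)
    also have "\<dots> = (\<tau> a \<star> ([y] \<star> winv (\<tau> ?a))) \<star> (\<tau> ?a \<star> ?s)"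
      using Cons a valc by simp
    also have "\<dots> = \<tau> a \<star> (([y] \<star> winv (\<tau> ?a)) \<star> (\<tau> ?a \<star> ?s))"
      by (rule wmult_assoc[OF reduced_mult[OF r]])
    also have "([y] \<star> winv (\<tau> ?a)) \<star> (\<tau> ?a \<star> ?s) = [y] \<star> (winv (\<tau> ?a) \<star> (\<tau> ?a \<star> ?s))"
      by (rule wmult_assoc[OF reduced_mult[OF r]])
    also have "winv (\<tau> ?a) \<star> (\<tau> ?a \<star> ?s) = ?s"
      using r by (rule winv_wmult_cancel)
    finally show ?case by simp
  qed
  \<comment> \<open>The same telescoping on the side of \<open>B\<close>-words. It is confined to
    \<open>D\<close>, because \<open>\<kappa>\<close> is an inverse of \<open>?val\<close> only on
    \<open>loops D\<close>.\<close>
  have \<psi>D: "?\<psi> a w = \<kappa> (\<tau> a \<star> (w \<star> winv (\<tau> (endp a w))))" if "path D a w" "a \<in> verts D" for a w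
    using that
  proof (induction w arbitrary: a)
    case Nil
    then show ?case using \<tau>(1) by (simp add: \<kappa>Nil wmult_winv_right)
  next
    case (Cons y w)
    let ?a = "act a y" and ?s = "w \<star> winv (\<tau> (endp (act a y) w))"
    have a: "?a \<in> verts D" "endp ?a w \<in> verts D"
      using Cons.prems act_in_verts[OF D] endp_in_verts[OF D, of a "y # w"] by auto
    have r: "reduced ?s" using \<tau>(1)[OF a(2)] by (simp add: reduced_mult)
    have "?\<psi> a (y # w) = \<kappa> (\<tau> a \<star> ([y] \<star> winv (\<tau> ?a))) \<star> \<kappa> (\<tau> ?a \<star> ?s)"
      using Cons a cD by simp
    also have "\<dots> = \<kappa> ((\<tau> a \<star> ([y] \<star> winv (\<tau> ?a))) \<star> (\<tau> ?a \<star> ?s))"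
      using lp[of a "[y]"] lp[of ?a w] Cons.prems a by (intro \<kappa>mult[symmetric]) auto
    also have "(\<tau> a \<star> ([y] \<star> winv (\<tau> ?a))) \<star> (\<tau> ?a \<star> ?s) = \<tau> a \<star> (([y] \<star> winv (\<tau> ?a)) \<star> (\<tau> ?a \<star> ?s))"
      by (rule wmult_assoc[OF reduced_mult[OF r]])
    also have "([y] \<star> winv (\<tau> ?a)) \<star> (\<tau> ?a \<star> ?s) = [y] \<star> (winv (\<tau> ?a) \<star> (\<tau> ?a \<star> ?s))"
      by (rule wmult_assoc[OF reduced_mult[OF r]])
    also have "winv (\<tau> ?a) \<star> (\<tau> ?a \<star> ?s) = ?s"
      using r by (rule winv_wmult_cancel)
    finally show ?case by simp
  qed
  have \<psi>B: "?\<psi> v0 g = [(g, True)]" if "g \<in> B" for g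
  proof -
    have g: "path D v0 g" "endp v0 g = v0" "reduced g" using that BD by (auto simp: loops_def)
    then have "?\<psi> v0 g = \<kappa> g" using \<psi>D[of v0 g] by (simp add: \<tau>0 mult_Nil)
    also have "\<dots> = [(g, True)]"
      using \<kappa>val[of "[(g, True)]"] that word_value_single[OF group_free_group, of g A] BF
      by (auto simp: carrier_free_group reduced_Cons)
    finally show ?thesis .
  qed
  have \<psi>b: "?\<psi> v0 b = [(b, True)]"
  proof -
    have "?\<psi> v0 b = ?\<psi> v0 \<alpha> \<star> ?\<psi> u ([x] \<star> winv \<beta>)"
      unfolding b_def using cocycle_wmult[OF E coc pb(2)] \<alpha> by simp
    also have "?\<psi> v0 \<alpha> = \<kappa> (\<alpha> \<star> winv (\<tau> u))"
      using \<psi>D[of v0 \<alpha>] \<alpha> by (simp add: \<tau>0)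
    also have "\<alpha> \<star> winv (\<tau> u) = winv p"
      unfolding p_def using winv_wmult[of "\<tau> u" "winv \<alpha>"] \<alpha>(3) \<tau>r by simp
    also have "\<kappa> (winv p) = winv (\<kappa> p)" by (rule \<kappa>winv[OF p])
    also have "?\<psi> u ([x] \<star> winv \<beta>) = c u x \<star> ?\<psi> v (winv \<beta>)"
      using cocycle_wmult[OF E coc, of u "[x]" "winv \<beta>"] uxE \<beta>' coc
      by (auto simp: v_def is_cocycle_def carrier_free_group mult_Nil)
    also have "c u x = cb" by (simp add: c_def)
    also have "?\<psi> v (winv \<beta>) = \<kappa> (\<tau> v \<star> winv \<beta>)"
      using \<psi>D[of v "winv \<beta>"] \<beta>' vv \<beta>(3) by (simp add: \<tau>0 mult_Nil)
    also have "\<tau> v \<star> winv \<beta> = winv q"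
      unfolding q_def using winv_wmult[of \<beta> "winv (\<tau> v)"] \<beta>(3) \<tau>r by simp
    also have "\<kappa> (winv q) = winv (\<kappa> q)" by (rule \<kappa>winv[OF q])
    also have "cb \<star> winv (\<kappa> q) = \<kappa> p \<star> (([(b, True)] \<star> \<kappa> q) \<star> winv (\<kappa> q))"
      unfolding cb_def using \<kappa>r[OF q] by (intro wmult_assoc) simp
    also have "([(b, True)] \<star> \<kappa> q) \<star> winv (\<kappa> q) = [(b, True)] \<star> (\<kappa> q \<star> winv (\<kappa> q))"
      using \<kappa>r[OF q] by (intro wmult_assoc) simp
    also have "\<kappa> q \<star> winv (\<kappa> q) = []" by (rule wmult_winv_right[OF \<kappa>r[OF q]])
    also have "winv (\<kappa> p) \<star> (\<kappa> p \<star> ([(b, True)] \<star> [])) = [(b, True)]"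
      by (subst winv_wmult_cancel) (auto simp: reduced_Cons)
    finally show ?thesis .
  qed
  have \<psi>val: "?\<psi> v0 (?val z) = z \<and> ?val z \<in> loops E" if "reduced z" "fst ` set z \<subseteq> B'" for z
    using that
  proof (induction z)
    case Nil
    then show ?case by (simp add: word_value_Nil one_free_group)
  next
    case (Cons y z)
    obtain g e where y: "y = (g, e)" by (cases y)
    have g: "g \<in> loops E" "g \<in> carrier FA" "?\<psi> v0 g = [(g, True)]"
      using Cons.prems B'E B'F \<psi>B \<psi>b by (auto simp: y B'_def)
    define h where "h = (if e then g else winv g)"
    have h: "h \<in> loops E" "?\<psi> v0 h = [y]"
      using g loops_winv[OF E] cocycle_winv[OF E coc g(1)] by (auto simp: h_def y flip_def)
    have z: "?\<psi> v0 (?val z) = z" "?val z \<in> loops E"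
      using Cons by (auto simp: reduced_Cons)
    have v: "?val (y # z) = h \<star> ?val z"
      using g by (simp add: word_value_Cons y h_def inv_free_group mult_free_group)
    have "?\<psi> v0 (h \<star> ?val z) = [y] \<star> z"
      using cocycle_wmult[OF E coc, of v0 h "?val z"] h z by (auto simp: loops_def path_append)
    also have "\<dots> = y # z" using wmult_reduced_append[of "[y]" z] Cons.prems by simp
    finally show ?case using v loops_wmult[OF E h(1) z(2)] by simp
  qed
  have "is_basis FA (loops E) B'"
  proof (rule is_basisI[OF group_free_group subgroup_loops[OF E] B'E])
    fix g assume "g \<in> loops E"
    then have g: "path E v0 g" "endp v0 g = v0" "reduced g" by (auto simp: loops_def)
    show "?\<psi> v0 g \<in> carrier (free_group B')" by (rule cocycle_closed[OF coc g(1)])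
    show "?val (?\<psi> v0 g) = g" using val\<psi>[OF g(1)] g by (simp add: \<tau>0 mult_Nil)
  next
    fix z assume "z \<in> carrier (free_group B')"
    then show "?\<psi> v0 (?val z) = z" using \<psi>val by (simp add: carrier_free_group)
  qed
  then show "is_basis FA (loops (add_edge u x D)) (insert b B)"
    by (simp add: E_def B'_def)
qed

end

section \<open>Extending bases from a subgraph, and rank as an Euler characteristic\<close>

context dart_graph
begin

lemma finite_verts: "finite D \<Longrightarrow> finite (verts D)"
  by (simp add: verts_def)

lemma exists_outer_edge:
  assumes "conn D0" "is_graph D0" "conn D" "D0 \<subseteq> D" "D0 \<noteq> D"
  obtains u x where "(u, x) \<in> D" "(u, x) \<notin> D0" "u \<in> verts D0"
proof (rule ccontr)
  assume "\<not> thesis"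
  then have no: "(u, x) \<in> D0" if "(u, x) \<in> D" "u \<in> verts D0" for u x
    using that \<open>\<And>u x. \<lbrakk>(u, x) \<in> D; (u, x) \<notin> D0; u \<in> verts D0\<rbrakk> \<Longrightarrow> thesis\<close> by blast
  have "endp a w \<in> verts D0" if "path D a w" "a \<in> verts D0" for a w
    using that
  proof (induction w arbitrary: a)
    case (Cons x w)
    then show ?case using no act_in_verts[OF assms(2)] by auto
  qed simp
  then have "verts D \<subseteq> verts D0"
    using assms(3) v0_in_verts[of D0] unfolding conn_def by (metis subsetI)
  then have "D \<subseteq> D0" using no by (force simp: verts_def)
  then show False using assms by auto
qed

text \<open>Edges are added one at a time at an old vertex. If the other end is new, loop group and
  basis stay as they are; if it is old, the basis gains one element. As every edge is two darts, the
  equation is twice the statement that vertices minus edges plus rank does not change.\<close>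

lemma extend_basis:
  assumes "is_graph D0" "conn D0" "is_graph D" "conn D" "D0 \<subseteq> D" "finite D"
    and "is_basis FA (loops D0) B0" "finite B0"
  shows "\<exists>B. B0 \<subseteq> B \<and> finite B \<and> is_basis FA (loops D) B \<and>
    card D + 2 * card (verts D0) + 2 * card B0 = card D0 + 2 * card (verts D) + 2 * card B"
  using assms
proof (induction "card (D - D0)" arbitrary: D0 B0 rule: less_induct)
  case less
  show ?case
  proof (cases "D0 = D")
    case True
    then show ?thesis using less.prems by auto
  next
    case False
    obtain u x where ux: "(u, x) \<in> D" "(u, x) \<notin> D0" "u \<in> verts D0"
      using exists_outer_edge[OF less.prems(2,1,4,5) False] by metis
    define D1 where "D1 = add_edge u x D0"
    note i = is_graphD[OF less.prems(3) ux(1)]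
    have vx: "(act u x, flip x) \<notin> D0" using is_graphD[OF less.prems(1), of "act u x" "flip x"] ux i by auto
    have fin: "finite D0" using less.prems finite_subset by blast
    have D1: "is_graph D1" "conn D1" "D1 \<subseteq> D" "verts D1 = insert (act u x) (verts D0)"
      using less.prems ux i is_graph_add_edge conn_add_edge verts_add_edge by (auto simp: D1_def add_edge_def)
    have c1: "card D1 = card D0 + 2"
      using ux vx fin by (simp add: D1_def add_edge_def card_insert_if)
    have less1: "card (D - D1) < card (D - D0)"
      using less.prems ux by (intro psubset_card_mono) (auto simp: D1_def add_edge_def)
    have "\<exists>B1. B0 \<subseteq> B1 \<and> finite B1 \<and> is_basis FA (loops D1) B1 \<and>
      card D1 + 2 * card (verts D0) + 2 * card B0 = card D0 + 2 * card (verts D1) + 2 * card B1"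
    proof (cases "act u x \<in> verts D0")
      case True
      obtain \<alpha> where \<alpha>: "reduced \<alpha>" "path D0 v0 \<alpha>" "endp v0 \<alpha> = u"
        using conn_reduced_path[OF less.prems(1,2) ux(3)] by metis
      obtain \<beta> where \<beta>: "reduced \<beta>" "path D0 v0 \<beta>" "endp v0 \<beta> = act u x"
        using conn_reduced_path[OF less.prems(1,2) True] by metis
      note b = is_basis_add_edge[OF less.prems(1,2,7) ux(2) i(1,3) ux(3) True \<alpha>(2,3,1) \<beta>(2,3,1)]
      show ?thesis
        using b less.prems(8) c1 D1(4) True
        by (intro exI[of _ "insert (\<alpha> \<star> ([x] \<star> winv \<beta>)) B0"]) (auto simp: D1_def insert_absorb)
    next
      case False
      then show ?thesis
        using loops_add_edge_new_vertex[OF less.prems(1) ux(3) False] c1 less.prems(7,8) D1(4)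
          finite_verts[OF fin]
        by (intro exI[of _ B0]) (auto simp: D1_def)
    qed
    then obtain B1 where B1: "B0 \<subseteq> B1" "finite B1" "is_basis FA (loops D1) B1"
      "card D1 + 2 * card (verts D0) + 2 * card B0 = card D0 + 2 * card (verts D1) + 2 * card B1" by blast
    obtain B where "B1 \<subseteq> B" "finite B" "is_basis FA (loops D) B"
      "card D + 2 * card (verts D1) + 2 * card B1 = card D1 + 2 * card (verts D) + 2 * card B"
      using less.hyps[OF less1 D1(1,2) less.prems(3,4) D1(3) less.prems(6) B1(3,2)] by blast
    then show ?thesis using B1 by (intro exI[of _ B]) auto
  qed
qed

lemma is_basis_loops_empty: "is_basis FA (loops {}) {}"
proof (rule is_basisI[OF group_free_group subgroup_loops, where f = "\<lambda>_. []"])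
  have l: "loops {} = {[]}"
  proof -
    have "w = []" if "path {} v0 w" for w using that by (cases w) auto
    then show ?thesis by (auto simp: loops_def)
  qed
  show "g \<in> loops {} \<Longrightarrow> word_value FA [] = g" for g
    by (simp add: l word_value_Nil one_free_group)
qed (auto simp: is_graph_def carrier_free_group)

text \<open>Starting from the empty graph with its single vertex \<open>v0\<close> and trivial loop
  group, the invariant becomes the formula rank = edges - vertices + 1, doubled.\<close>

lemma exists_basis:
  assumes "is_graph D" "conn D" "finite D"
  shows "\<exists>B. finite B \<and> is_basis FA (loops D) B \<and> card D + 2 = 2 * card (verts D) + 2 * card B"
proof -
  have e: "is_graph {}" "conn {}"
    by (auto simp: is_graph_def conn_def verts_def intro!: exI[of _ "[]"])
  show ?thesis
    using extend_basis[OF e assms(1,2) _ assms(3) is_basis_loops_empty]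
    by (auto simp: verts_def[of "{}"])
qed

section \<open>The subgraph traced by a word\<close>

fun dset :: "'v \<Rightarrow> 'a word \<Rightarrow> ('v \<times> 'a \<times> bool) set" where
  "dset a [] = {}"
| "dset a (x # w) = add_edge a x (dset (act a x) w)"

lemma finite_dset: "finite (dset a w)"
  by (induction w arbitrary: a) (auto simp: add_edge_def)

lemma dset_append: "dset a (u @ w) = dset a u \<union> dset (endp a u) w"
  by (induction u arbitrary: a) (auto simp: add_edge_def)

lemma path_dset: "path (dset a w) a w"
proof (induction w arbitrary: a)
  case (Cons x w)
  then show ?case using path_mono[OF Cons[of "act a x"], of "dset a (x # w)"] by (auto simp: add_edge_def)
qed simp

lemma conn_dset: "conn (dset v0 w)"
proof -
  have "\<exists>u. path (dset a w) a u \<and> endp a u = b" if "(b, y) \<in> dset a w" for a b y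
    using that
  proof (induction w arbitrary: a)
    case (Cons x w)
    consider "b = a" | "b = act a x" | "(b, y) \<in> dset (act a x) w"
      using Cons.prems by (auto simp: add_edge_def)
    then show ?case
    proof cases
      case 1
      then show ?thesis by (intro exI[of _ "[]"]) simp
    next
      case 2
      then show ?thesis by (intro exI[of _ "[x]"]) (simp add: add_edge_def)
    next
      case 3
      then obtain u where "path (dset (act a x) w) (act a x) u" "endp (act a x) u = b"
        using Cons.IH by blast
      then show ?thesis
        using path_mono[of "dset (act a x) w" "act a x" u "dset a (x # w)"]
        by (intro exI[of _ "x # u"]) (auto simp: add_edge_def)
    qed
  qed simp
  then show ?thesis by (force simp: conn_def verts_def intro: exI[of _ "[]"])
qed

lemma verts_Union: "verts (\<Union>\<D>) = insert v0 (\<Union>(verts ` \<D>))"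
  by (auto simp: verts_def)

lemma conn_Union:
  assumes "\<And>D. D \<in> \<D> \<Longrightarrow> conn D"
  shows "conn (\<Union>\<D>)"
  unfolding conn_def
proof
  fix a assume "a \<in> verts (\<Union>\<D>)"
  then consider "a = v0" | D where "D \<in> \<D>" "a \<in> verts D" by (auto simp: verts_Union)
  then show "\<exists>w. path (\<Union>\<D>) v0 w \<and> endp v0 w = a"
  proof cases
    case 1
    then show ?thesis by (intro exI[of _ "[]"]) simp
  next
    case 2
    then obtain w where "path D v0 w" "endp v0 w = a" using assms by (auto simp: conn_def)
    then show ?thesis using path_mono[of D v0 w "\<Union>\<D>"] 2 by blast
  qed
qed

lemma is_graph_Union: "(\<And>D. D \<in> \<D> \<Longrightarrow> is_graph D) \<Longrightarrow> is_graph (\<Union>\<D>)"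
  unfolding is_graph_def by blast

end

text \<open>Letters of \<open>A\<close> act on \<open>V\<close> by mutually inverse maps, so every
  word over \<open>A\<close> traces a graph. In the application \<open>V\<close> consists of the
  right cosets of a subgroup, while \<open>act\<close> is defined on arbitrary sets of
  words.\<close>

locale action_graph = dart_graph +
  fixes V :: "'a set"
  assumes v0_V: "v0 \<in> V"
    and act_V: "\<And>a x. a \<in> V \<Longrightarrow> fst x \<in> A \<Longrightarrow> act a x \<in> V"
    and act_flip: "\<And>a x. a \<in> V \<Longrightarrow> fst x \<in> A \<Longrightarrow> act (act a x) (flip x) = a"
begin

lemma endp_V: "a \<in> V \<Longrightarrow> fst ` set w \<subseteq> A \<Longrightarrow> endp a w \<in> V"
  by (induction w arbitrary: a) (auto simp: act_V)

lemma is_graph_dset: "a \<in> V \<Longrightarrow> fst ` set w \<subseteq> A \<Longrightarrow> is_graph (dset a w)"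
proof (induction w arbitrary: a)
  case (Cons x w)
  then show ?case using is_graph_add_edge[of "dset (act a x) w" x a] act_V act_flip by auto
qed (simp add: is_graph_def)

lemma dset_winv: "a \<in> V \<Longrightarrow> fst ` set w \<subseteq> A \<Longrightarrow> dset (endp a w) (winv w) = dset a w"
proof (induction w arbitrary: a)
  case (Cons x w)
  have "endp (endp a (x # w)) (winv w) = act a x"
    using path_winv[OF is_graph_dset path_dset, of "act a x" w] Cons.prems act_V by auto
  then show ?case
    using Cons act_V act_flip[of a x] by (auto simp: dset_append add_edge_def)
qed simp

text \<open>With the two halves of the word as connecting paths, the basis element contributed by the
  edge that is crossed once is the word itself.\<close>

lemma basis_of_single_crossing:
  assumes w: "reduced (w1 @ x # w2)" "fst ` set (w1 @ x # w2) \<subseteq> A" "endp v0 (w1 @ x # w2) = v0"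
    and nx: "(endp v0 w1, x) \<notin> dset v0 w1" "(endp v0 w1, x) \<notin> dset (endp v0 (w1 @ [x])) w2"
  shows "\<exists>B. finite B \<and> is_basis FA (loops (dset v0 (w1 @ x # w2))) B \<and> w1 @ x # w2 \<in> B"
proof -
  define u where "u = endp v0 w1"
  define v where "v = act u x"
  define D where "D = dset v0 w1 \<union> dset v w2"
  have ev: "endp v w2 = v0" using w by (simp add: u_def v_def)
  have V: "u \<in> V" "v \<in> V" using endp_V[OF v0_V, of w1] act_V w by (auto simp: u_def v_def image_Un)
  \<comment> \<open>The second half, read backwards from \<open>v0\<close>, reaches the far end of
    the crossed edge. So the graph stays connected without that edge, and adding it back is the case
    of an edge between two old vertices.\<close>
  have inv: "dset v w2 = dset v0 (winv w2)"
    using dset_winv[of v w2] V w ev dset_winv[OF v0_V, of "winv w2"] by (simp add: image_Un)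
  have D': "D = \<Union>{dset v0 w1, dset v0 (winv w2)}" by (simp add: D_def inv)
  have gD: "is_graph D" unfolding D'
    by (rule is_graph_Union) (use is_graph_dset[OF v0_V] w in \<open>auto simp: image_Un\<close>)
  have cD: "conn D" unfolding D' by (rule conn_Union) (auto simp: conn_dset)
  have fD: "finite D" by (simp add: D_def finite_dset)
  obtain B where B: "finite B" "is_basis FA (loops D) B" using exists_basis[OF gD cD fD] by blast
  have p1: "path D v0 w1" by (rule path_mono[OF path_dset]) (simp add: D_def)
  have p2: "path D v0 (winv w2)" by (rule path_mono[OF path_dset]) (simp add: D')
  have e2: "endp v0 (winv w2) = v"
    using path_winv[OF is_graph_dset path_dset, of v w2] V w ev by auto
  have "is_basis FA (loops (add_edge u x D)) (insert (w1 \<star> ([x] \<star> winv (winv w2))) B)"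
  proof (rule is_basis_add_edge[OF gD cD B(2)])
    show "(u, x) \<notin> D" using nx by (simp add: D_def u_def v_def)
    show "u \<in> verts D" using endp_in_verts[OF gD p1] by (simp add: u_def)
    show "act u x \<in> verts D" using endp_in_verts[OF gD p2] by (simp add: e2 v_def)
  qed (use w V act_flip p1 p2 e2 in \<open>auto simp: u_def v_def reduced_append reduced_Cons\<close>)
  moreover have "w1 \<star> ([x] \<star> winv (winv w2)) = w1 @ x # w2"
    using w wmult_reduced_append[of "[x]" w2] wmult_reduced_append[of w1 "x # w2"] 
    by (auto simp: reduced_append reduced_Cons simp del: foldr.simps)
  moreover have "add_edge u x D = dset v0 (w1 @ x # w2)"
    by (auto simp: dset_append D_def u_def v_def add_edge_def)
  ultimately show ?thesis using B(1) by auto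
qed

end

section \<open>Walks that cross every edge twice\<close>

text \<open>Unlike the darts of the graphs above, these record their targets, so that a walk makes
  sense without an action and its vertices can be renamed into another type.\<close>

type_synonym ('v, 'a) dart = "'v \<times> ('a \<times> bool) \<times> 'v"

definition dinv :: "('v, 'a) dart \<Rightarrow> ('v, 'a) dart" where
  "dinv d = (snd (snd d), flip (fst (snd d)), fst d)"

abbreviation src :: "('v, 'a) dart \<Rightarrow> 'v" where "src d \<equiv> fst d"
abbreviation lab :: "('v, 'a) dart \<Rightarrow> 'a \<times> bool" where "lab d \<equiv> fst (snd d)"
abbreviation tgt :: "('v, 'a) dart \<Rightarrow> 'v" where "tgt d \<equiv> snd (snd d)"

fun walk_end :: "'v \<Rightarrow> ('v, 'a) dart list \<Rightarrow> 'v" where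
  "walk_end a [] = a"
| "walk_end a (d # z) = walk_end (tgt d) z"

fun is_walk :: "'v \<Rightarrow> ('v, 'a) dart list \<Rightarrow> bool" where
  "is_walk a [] \<longleftrightarrow> True"
| "is_walk a (d # z) \<longleftrightarrow> src d = a \<and> is_walk (tgt d) z"

definition darts :: "('v, 'a) dart list \<Rightarrow> ('v, 'a) dart set" where
  "darts z = set z \<union> dinv ` set z"

definition crossings :: "('v, 'a) dart list \<Rightarrow> ('v, 'a) dart \<Rightarrow> nat" where
  "crossings z d = length (filter (\<lambda>e. e = d \<or> e = dinv d) z)"

text \<open>The inequality says that the graph traced by the walk has rank at most \<open>r\<close>: each of its
  edges contributes two darts.\<close>

definition covers_twice :: "nat \<Rightarrow> 'v \<Rightarrow> ('v, 'a) dart list \<Rightarrow> bool" where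
  "covers_twice r a z \<longleftrightarrow> is_walk a z \<and> walk_end a z = a \<and>
    card (darts z) + 2 \<le> 2 * card (insert a (tgt ` set z)) + 2 * r \<and>
    (\<forall>d\<in>set z. crossings z d \<ge> 2)"

lemma dinv_simps [simp]: "src (dinv d) = tgt d" "tgt (dinv d) = src d" "lab (dinv d) = flip (lab d)"
  "dinv (dinv d) = d"
  by (auto simp: dinv_def)

lemma dinv_neq [simp]: "dinv d \<noteq> d"
  by (metis dinv_simps(3) flip_neq(1))

lemma dinv_eq_iff: "dinv d = e \<longleftrightarrow> d = dinv e"
  by auto

lemma walk_append: "is_walk a (y @ z) \<longleftrightarrow> is_walk a y \<and> is_walk (walk_end a y) z"
  by (induction y arbitrary: a) auto

lemma walk_end_append: "walk_end a (y @ z) = walk_end (walk_end a y) z"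
  by (induction y arbitrary: a) auto

context dart_graph
begin

fun trace :: "'v \<Rightarrow> 'a word \<Rightarrow> ('v, 'a) dart list" where
  "trace a [] = []"
| "trace a (x # w) = (a, x, act a x) # trace (act a x) w"

lemma trace_walk: "is_walk a (trace a w)" "walk_end a (trace a w) = endp a w"
  "map lab (trace a w) = w"
  by (induction w arbitrary: a) auto

lemma trace_append: "trace a (u @ w) = trace a u @ trace (endp a u) w"
  by (induction u arbitrary: a) auto

lemma length_trace [simp]: "length (trace a w) = length w"
  by (metis length_map trace_walk(3))

end

context action_graph
begin

lemma dset_trace:
  "a \<in> V \<Longrightarrow> fst ` set w \<subseteq> A \<Longrightarrow> darts (trace a w) = (\<lambda>(b, x). (b, x, act b x)) ` dset a w"
proof (induction w arbitrary: a)
  case (Cons x w)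
  then show ?case using act_V[of a x] act_flip[of a x]
    by (auto simp: darts_def add_edge_def dinv_def)
qed (simp add: darts_def)

lemma card_darts_trace:
  assumes "a \<in> V" "fst ` set w \<subseteq> A"
  shows "card (darts (trace a w)) = card (dset a w)"
  unfolding dset_trace[OF assms] by (rule card_image) (auto simp: inj_on_def)

lemma dset_iff_trace:
  assumes "a \<in> V" "fst ` set w \<subseteq> A"
  shows "(b, x) \<in> dset a w \<longleftrightarrow> (b, x, act b x) \<in> darts (trace a w)"
  unfolding dset_trace[OF assms] by auto

lemma tgt_trace:
  assumes "fst ` set w \<subseteq> A" "endp v0 w = v0"
  shows "insert v0 (tgt ` set (trace v0 w)) = verts (dset v0 w)"
proof -
  have *: "insert a (fst ` dset a w) = insert a (tgt ` set (trace a w))" for a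
  proof (induction w arbitrary: a)
    case (Cons x w)
    have "insert a (fst ` dset a (x # w)) = insert a (insert (act a x) (fst ` dset (act a x) w))"
      by (auto simp: add_edge_def)
    then show ?case using Cons[of "act a x"] by auto
  qed simp
  show ?thesis using *[of v0] by (simp add: verts_def)
qed

text \<open>Turns a low crossing count into the hypotheses of
  \<open>basis_of_single_crossing\<close>: the occurrence of \<open>d\<close> at the split already
  accounts for one crossing, so neither \<open>d\<close> nor its inverse occurs before or after
  it.\<close>

lemma split_single_crossing:
  assumes w: "fst ` set w \<subseteq> A" and d: "d \<in> set (trace v0 w)" "crossings (trace v0 w) d < 2"
  obtains w1 x w2 where "w = w1 @ x # w2" "(endp v0 w1, x) \<notin> dset v0 w1"
    "(endp v0 w1, x) \<notin> dset (endp v0 (w1 @ [x])) w2"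
proof -
  obtain z1 z2 where z: "trace v0 w = z1 @ d # z2" using d(1) by (meson split_list)
  define w1 where "w1 = take (length z1) w"
  obtain x w2 where w2: "drop (length z1) w = x # w2"
    using arg_cong[OF z, of length] by (cases "drop (length z1) w") auto
  have e: "w = w1 @ x # w2" using w2 unfolding w1_def by (metis append_take_drop_id)
  have l: "length w1 = length z1" using arg_cong[OF z, of length] by (simp add: w1_def)
  have t: "z1 = trace v0 w1" "d = (endp v0 w1, x, act (endp v0 w1) x)" "z2 = trace (endp v0 (w1 @ [x])) w2"
    using z l unfolding e by (auto simp: trace_append)
  have wA: "fst ` set w1 \<subseteq> A" "fst x \<in> A" "fst ` set w2 \<subseteq> A" using w by (auto simp: e)
  have n: "e \<notin> set z1 \<union> set z2" if "e = d \<or> e = dinv d" for e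
  proof
    assume "e \<in> set z1 \<union> set z2"
    then have "0 < length (filter (\<lambda>e. e = d \<or> e = dinv d) z1) + length (filter (\<lambda>e. e = d \<or> e = dinv d) z2)"
      using that by (auto simp: filter_empty_conv length_greater_0_conv[symmetric] simp del: length_greater_0_conv) 
    then show False using d(2) by (simp add: crossings_def z)
  qed
  then have "d \<notin> darts z1" "d \<notin> darts z2" unfolding darts_def by (auto simp: dinv_eq_iff)
  moreover have "endp v0 (w1 @ [x]) \<in> V" using endp_V[OF v0_V, of "w1 @ [x]"] wA by auto
  ultimately show ?thesis
    using that[OF e] dset_iff_trace[OF v0_V wA(1)] dset_iff_trace[OF _ wA(3)] t by metis
qed

end

lemma nonprimitive_covers_twice:
  assumes J: "subgroup J (free_group A)" and w: "w \<in> J" "\<not> primitive_in (free_group A) J w"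
    and C: "is_basis (free_group A) J C" "finite C"
  shows "\<exists>a (z :: ('a word set, 'a) dart list). map lab z = w \<and> covers_twice (card C) a z"
proof -
  define F where "F = free_group A"
  interpret F: group F unfolding F_def by (rule group_free_group)
  have JF: "subgroup J F" "J \<subseteq> carrier F" using J subgroup.subset[OF J] by (auto simp: F_def)
  \<comment> \<open>the Schreier graph of \<open>J\<close>\<close>
  define act where "act a x = a #>\<^bsub>F\<^esub> [x]" for a and x :: "'a \<times> bool"
  define V where "V = (\<lambda>g. J #>\<^bsub>F\<^esub> g) ` carrier F"
  have x: "[x] \<in> carrier F" "[x] \<otimes>\<^bsub>F\<^esub> [flip x] = \<one>\<^bsub>F\<^esub>" if xA: "fst x \<in> A" for x
    using xA by (auto simp: F_def carrier_free_group reduced_Cons mult_free_group one_free_group)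
  interpret action_graph act J A V
  proof
    show "J \<in> V" using F.coset_mult_one[OF JF(2)] by (force simp: V_def)
    fix a and x :: "'a \<times> bool" assume a: "a \<in> V" and fx: "fst x \<in> A"
    obtain g where g: "g \<in> carrier F" "a = J #>\<^bsub>F\<^esub> g" using a by (auto simp: V_def)
    have fl: "[flip x] \<in> carrier F" using x(1)[of "flip x"] fx by simp
    show "act a x \<in> V"
      using g x[OF fx] F.coset_mult_assoc[OF JF(2) g(1), of "[x]"] by (auto simp: act_def V_def)
    have "act (act a x) (flip x) = J #>\<^bsub>F\<^esub> (g \<otimes>\<^bsub>F\<^esub> ([x] \<otimes>\<^bsub>F\<^esub> [flip x]))"
      using g x[OF fx] fl JF by (simp add: act_def F.coset_mult_assoc F.m_assoc)
    then show "act (act a x) (flip x) = a" using g x[OF fx] by simp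
  qed
  have endp: "endp J v = J #>\<^bsub>F\<^esub> v" if "reduced v" "fst ` set v \<subseteq> A" for v
    using that
  proof (induction v rule: rev_induct)
    case Nil
    then show ?case using F.coset_mult_one[OF JF(2)] by (simp add: F_def one_free_group)
  next
    case (snoc y v)
    have v: "v \<in> carrier F" using snoc.prems by (auto simp: F_def carrier_free_group reduced_append)
    have "v \<otimes>\<^bsub>F\<^esub> [y] = v @ [y]"
      using wmult_reduced_append[OF snoc.prems(1)] by (simp add: F_def mult_free_group)
    then show ?case
      using snoc F.coset_mult_assoc[OF JF(2) v, of "[y]"] x[of y] by (simp add: reduced_append act_def)
  qed
  have J_iff: "v \<in> J \<longleftrightarrow> endp J v = J" if "v \<in> carrier F" for v
    using F.coset_join1[OF _ that JF(1)] F.coset_join2[OF that JF(1)] endp that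
    by (auto simp: F_def carrier_free_group)
  have car: "reduced v" "fst ` set v \<subseteq> A" if "v \<in> J" for v
    using that JF(2) by (auto simp: F_def carrier_free_group)
  have ew: "endp J w = J" using J_iff w JF by auto
  have CJ: "C \<subseteq> J" using C by (auto simp: is_basis_def)
  \<comment> \<open>The Schreier graph may be infinite. The part traced by \<open>w\<close> and by
    the finite basis \<open>C\<close> is finite and connected, and its loop group is already all of
    \<open>J\<close> because it contains \<open>C\<close>.\<close>
  define G where "G = \<Union>(dset J ` insert w C)"
  have gG: "is_graph G" unfolding G_def
    
  proof (rule is_graph_Union)
    fix D assume "D \<in> dset J ` insert w C"
    then obtain g where "D = dset J g" "g \<in> J" using w CJ by blast
    then show "is_graph D" using is_graph_dset[OF v0_V car(2)] by simp
  qed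
  have cG: "conn G" unfolding G_def by (rule conn_Union) (auto simp: conn_dset)
  have fG: "finite G" using C(2) by (simp add: G_def finite_dset)
  have lG: "loops G = J"
  proof
    show "loops G \<subseteq> J"
    proof
      fix g assume g: "g \<in> loops G"
      then have "g \<in> carrier F" "endp J g = J" using loops_closed[OF gG] by (auto simp: F_def loops_def)
      then show "g \<in> J" using J_iff[of g] by simp
    qed
    have CG: "C \<subseteq> loops G"
    proof
      fix g assume g: "g \<in> C"
      then have "path G J g" by (intro path_mono[OF path_dset]) (auto simp: G_def)
      moreover have "g \<in> J" using g CJ by blast
      moreover from this have "endp J g = J" using J_iff[of g] JF(2) by blast
      ultimately show "g \<in> loops G" using car[of g] by (simp add: loops_def)
    qed
    have "word_value F z \<in> loops G" if "fst ` set z \<subseteq> C" for z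
      using that
    proof (induction z)
      case Nil
      then show ?case by (simp add: word_value_Nil F_def one_free_group)
    next
      case (Cons y z)
      then have y: "fst y \<in> loops G" "fst y \<in> carrier F" and z: "word_value F z \<in> loops G"
        using CG loops_closed[OF gG] by (simp_all add: F_def subset_eq)
      define h where "h = (if snd y then fst y else inv\<^bsub>F\<^esub> (fst y))"
      have "h \<in> loops G" using y loops_winv[OF gG] by (simp add: h_def F_def inv_free_group)
      then have "h \<star> word_value F z \<in> loops G" using z by (rule loops_wmult[OF gG])
      then show ?case using word_value_Cons[of F "fst y" "snd y" z]
        by (simp add: h_def F_def mult_free_group)
    qed
    then have gen: "word_value (free_group A) z \<in> loops G" if "z \<in> carrier (free_group C)" for z
      using that by (simp add: F_def carrier_free_group)
    show "J \<subseteq> loops G"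
    proof
      fix g assume "g \<in> J"
      from basis_generates[OF C(1) this] show "g \<in> loops G" using gen by metis
    qed
  qed
  let ?D = "dset J w" and ?z = "trace J w"
  note wA = car[OF w(1)]
  have gD: "is_graph ?D" by (rule is_graph_dset[OF v0_V wA(2)])
  have DG: "?D \<subseteq> G" by (auto simp: G_def)
  note ext = extend_basis[OF gD conn_dset gG cG DG fG]
  obtain B where B: "finite B" "is_basis (free_group A) (loops ?D) B"
    "card ?D + 2 = 2 * card (verts ?D) + 2 * card B"
    using exists_basis[OF gD conn_dset finite_dset] by blast
  \<comment> \<open>Ranks are compared inside \<open>J\<close>: the basis of the loop group of the
    traced part extends to one of \<open>J\<close>, which has at most \<open>card C\<close>
    elements.\<close>
  obtain B' where B': "B \<subseteq> B'" "finite B'" "is_basis (free_group A) J B'"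
    using ext[OF B(2,1)] lG by auto
  have "card B \<le> card B'" using B' by (simp add: card_mono)
  also have "\<dots> \<le> card C" by (rule basis_card_le[OF group_free_group J C B'(3,2)])
  finally have rank: "card ?D + 2 \<le> 2 * card (verts ?D) + 2 * card C" using B(3) by simp
  have "crossings ?z d \<ge> 2" if d: "d \<in> set ?z" for d
  proof (rule ccontr)
    assume "\<not> crossings ?z d \<ge> 2"
    then obtain w1 y w2 where s: "w = w1 @ y # w2" "(endp J w1, y) \<notin> dset J w1"
      "(endp J w1, y) \<notin> dset (endp J (w1 @ [y])) w2"
      using split_single_crossing[OF wA(2) d] by (metis not_le)
    obtain B0 where B0: "finite B0" "is_basis (free_group A) (loops ?D) B0" "w \<in> B0"
      using basis_of_single_crossing[OF wA[unfolded s(1)] _ s(2,3)] ew s(1) by auto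
    then obtain B1 where "B0 \<subseteq> B1" "is_basis (free_group A) J B1" using ext[OF B0(2,1)] lG by auto
    then show False using w(2) B0(3) by (auto simp: primitive_in_def)
  qed
  moreover have "card (darts ?z) + 2 \<le> 2 * card (insert J (tgt ` set ?z)) + 2 * card C"
    unfolding card_darts_trace[OF v0_V wA(2)] tgt_trace[OF wA(2) ew] by (rule rank)
  moreover have "walk_end J ?z = J" unfolding trace_walk(2) by (rule ew)
  ultimately have "covers_twice (card C) J ?z"
    unfolding covers_twice_def using trace_walk(1)[of J w] by blast
  then show ?thesis using trace_walk(3)[of J w] by blast
qed

section \<open>Counting walks\<close>

definition visited :: "'v \<Rightarrow> ('v, 'a) dart list \<Rightarrow> 'v set" where
  "visited a z = insert a (tgt ` set z)"

lemma walk_end_take: "i < length z \<Longrightarrow> walk_end a (take (Suc i) z) = tgt (z ! i)"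
  by (simp add: take_Suc_conv_app_nth walk_end_append)

lemma walk_end_last: "z \<noteq> [] \<Longrightarrow> walk_end a z = tgt (last z)"
  by (induction z arbitrary: a) auto

lemma src_in_visited: "is_walk a z \<Longrightarrow> d \<in> set z \<Longrightarrow> src d \<in> visited a z"
proof (induction z arbitrary: a)
  case (Cons e z)
  then show ?case by (cases "d = e") (force simp: visited_def)+
qed simp

lemma darts_visited: "is_walk a z \<Longrightarrow> d \<in> darts z \<Longrightarrow> src d \<in> visited a z \<and> tgt d \<in> visited a z"
proof -
  assume z: "is_walk a z" and "d \<in> darts z"
  then consider "d \<in> set z" | "dinv d \<in> set z" by (auto simp: darts_def)
  then show ?thesis
  proof cases
    case 1
    then show ?thesis using src_in_visited[OF z 1] by (simp add: visited_def)
  next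
    case 2
    then show ?thesis using src_in_visited[OF z 2] by (force simp: visited_def)
  qed
qed

lemma is_walk_map:
  "is_walk a z \<Longrightarrow> is_walk (f a) (map (\<lambda>(b, x, c). (f b, x, f c)) z)"
  by (induction z arbitrary: a) (auto split: prod.splits)

lemma walk_end_map: "walk_end (f a) (map (\<lambda>(b, x, c). (f b, x, f c)) z) = f (walk_end a z)"
  by (induction z arbitrary: a) (auto split: prod.splits)

lemma covers_twice_map:
  assumes z: "covers_twice r a z" and f: "inj_on f (visited a z)"
  shows "covers_twice r (f a) (map (\<lambda>(b, x, c). (f b, x, f c)) z)"
proof -
  define F where "F = (\<lambda>(b, x, c). (f b, x :: 'b \<times> bool, f c))"
  have F: "src (F d) = f (src d)" "lab (F d) = lab d" "tgt (F d) = f (tgt d)" for d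
    by (auto simp: F_def split: prod.splits)
  have Fdinv: "F (dinv d) = dinv (F d)" for d
    by (auto simp: F_def dinv_def split: prod.splits)
  have w: "is_walk a z" using z by (simp add: covers_twice_def)
  have inj: "inj_on F (darts z)"
  proof (rule inj_onI)
    fix d e assume "d \<in> darts z" "e \<in> darts z" "F d = F e"
    then have "src d = src e" "lab d = lab e" "tgt d = tgt e"
      using darts_visited[OF w] F inj_onD[OF f] by metis+
    then show "d = e" by (simp add: prod_eq_iff)
  qed
  have Fz: "darts (map F z) = F ` darts z"
    by (force simp: darts_def Fdinv image_Un image_image)
  have "crossings (map F z) (F d) = crossings z d" if d: "d \<in> set z" for d
  proof -
    have "(F e = F d \<or> F e = dinv (F d)) \<longleftrightarrow> (e = d \<or> e = dinv d)" if "e \<in> set z" for e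
      using inj_on_eq_iff[OF inj, of e d] inj_on_eq_iff[OF inj, of e "dinv d"] that d
      by (auto simp: darts_def Fdinv[symmetric])
    then show ?thesis by (auto simp: crossings_def filter_map comp_def cong: filter_cong)
  qed
  moreover have "insert (f a) (tgt ` set (map F z)) = f ` visited a z"
    by (force simp: visited_def F)
  moreover have "card (f ` visited a z) = card (visited a z)" by (rule card_image[OF f])
  moreover have "card (darts (map F z)) = card (darts z)" unfolding Fz by (rule card_image[OF inj])
  ultimately show ?thesis
    using z is_walk_map[OF w, of f] walk_end_map[of f a z]
    by (auto simp: covers_twice_def visited_def F_def[symmetric])
qed

text \<open>Vertices are named by the time of their first visit.\<close>

definition canonical :: "(nat, 'a) dart list \<Rightarrow> bool" where
  "canonical z \<longleftrightarrow> (\<forall>i<length z. tgt (z ! i) \<in> insert (Suc i) (visited 0 (take i z)))"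

text \<open>A vertex is renamed to the length of the shortest prefix ending there, which is
  injective since a prefix determines its end. This bounds the names by the length of the walk and
  leaves a single possible target for a step to a new vertex, so that only the label of such a step
  has to be counted.\<close>

lemma covers_twice_canonical:
  assumes z: "covers_twice r a z"
  shows "\<exists>z'. map lab z' = map lab z \<and> covers_twice r 0 z' \<and> canonical z'"
proof -
  define f where "f b = (LEAST j. walk_end a (take j z) = b)" for b
  have ex: "\<exists>j. walk_end a (take j z) = b" if b: "b \<in> visited a z" for b
  proof (cases "b = a")
    case True
    then show ?thesis by (intro exI[of _ 0]) simp
  next
    case False
    then obtain i where "i < length z" "tgt (z ! i) = b"
      using b by (auto simp: visited_def in_set_conv_nth)
    then show ?thesis using walk_end_take[of i z a] by blast
  qed
  have f: "walk_end a (take (f b) z) = b" if "b \<in> visited a z" for b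
    using ex[OF that] unfolding f_def by (rule LeastI_ex)
  have inj: "inj_on f (visited a z)" by (rule inj_onI) (metis f)
  have fa: "f a = 0" unfolding f_def by (rule Least_equality) auto
  define z' where "z' = map (\<lambda>(b, x, c). (f b, x, f c)) z"
  have nth: "tgt (z' ! i) = f (tgt (z ! i))" if "i < length z" for i
    using that by (simp add: z'_def split: prod.splits)
  have "canonical z'"
    unfolding canonical_def
  proof (intro allI impI)
    fix i assume "i < length z'"
    then have i: "i < length z" by (simp add: z'_def)
    let ?b = "tgt (z ! i)"
    have b: "?b \<in> visited a z" using i by (auto simp: visited_def)
    have "f ?b \<le> Suc i" unfolding f_def by (rule Least_le) (use walk_end_take[OF i] in auto)
    moreover have "f ?b \<in> visited 0 (take i z')" if le: "f ?b \<le> i"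
    proof (cases "f ?b")
      case 0
      then show ?thesis by (simp add: visited_def)
    next
      case (Suc j)
      then have "tgt (z ! j) = ?b" using f[OF b] walk_end_take[of j z a] i le by auto
      then have "f ?b = tgt (take i z' ! j)" "j < length (take i z')"
        using nth[of j] Suc le i by (auto simp: z'_def)
      then show ?thesis unfolding visited_def by (metis imageI insertI2 nth_mem)
    qed
    ultimately show "tgt (z' ! i) \<in> insert (Suc i) (visited 0 (take i z'))"
      using nth[OF i] by (metis insertI1 insertI2 le_SucE)
  qed
  moreover have "map lab z' = map lab z" by (auto simp: z'_def split: prod.splits)
  moreover have "covers_twice r 0 z'" using covers_twice_map[OF z inj] by (simp add: fa z'_def)
  ultimately show ?thesis by blast
qed

text \<open>A prefix \<open>u\<close> has at most \<open>(1 + n * D) ^ j * M powi (n - q u)\<close> completions by \<open>n\<close> further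
  steps, at most \<open>j\<close> of them special. The extensions of a prefix \<open>u\<close>, weighted by the loss of potential
  \<open>M powi (q u - 1 - q (u @ [x]))\<close>, contribute at most \<open>1\<close> in ordinary steps and at most \<open>D\<close> in
  the special steps, of which every sequence has at most \<open>s\<close>.\<close>

lemma card_tree_le:
  fixes L :: "'x list set" and q :: "'x list \<Rightarrow> int" and M D :: real
  defines "ext u \<equiv> {x. \<exists>z\<in>L. take (Suc (length u)) z = u @ [x]}"
  assumes fin: "finite L" and len: "\<And>z. z \<in> L \<Longrightarrow> length z = t"
    and M: "M > 0" and D: "D \<ge> 0"
    and ordinary: "\<And>u. length u < t \<Longrightarrow>
      (\<Sum>x\<in>{x\<in>ext u. \<not> sp u x}. M powi (q u - 1 - q (u @ [x]))) \<le> 1"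
    and special: "\<And>u. length u < t \<Longrightarrow>
      (\<Sum>x\<in>{x\<in>ext u. sp u x}. M powi (q u - 1 - q (u @ [x]))) \<le> D"
    and tokens: "\<And>z. z \<in> L \<Longrightarrow> card {i. i < t \<and> sp (take i z) (z ! i)} \<le> s"
    and q0: "q [] = 0" and qL: "\<And>z. z \<in> L \<Longrightarrow> q z = 0"
  shows "real (card L) \<le> (1 + real t * D) ^ s * M ^ t"
proof -
  define N where "N u = {z\<in>L. take (length u) z = u}" for u
  define tok where "tok u = card {i. i < length u \<and> sp (take i u) (u ! i)}" for u
  have finN: "finite (N u)" for u using fin by (simp add: N_def)
  have fin_ext: "finite (ext u)" for u
  proof (rule finite_subset)
    show "ext u \<subseteq> (\<lambda>z. last (take (Suc (length u)) z)) ` L"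
    proof
      fix x assume "x \<in> ext u"
      then obtain z where z: "z \<in> L" "take (Suc (length u)) z = u @ [x]" by (auto simp: ext_def)
      then have "x = last (take (Suc (length u)) z)" by simp
      then show "x \<in> (\<lambda>z. last (take (Suc (length u)) z)) ` L" using z(1) by (rule image_eqI)
    qed
  qed (simp add: fin)
  have tok_snoc: "tok (u @ [x]) = tok u + (if sp u x then 1 else 0)" for u x
  proof -
    have "{i. i < length (u @ [x]) \<and> sp (take i (u @ [x])) ((u @ [x]) ! i)} =
        {i. i < length u \<and> sp (take i u) (u ! i)} \<union> (if sp u x then {length u} else {})"
      by (auto simp: nth_append less_Suc_eq)
    then show ?thesis by (simp add: tok_def card_insert_if)
  qed
  have tok_le: "tok (take n z) \<le> s" if "z \<in> L" for z n
  proof -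
    have "{i. i < length (take n z) \<and> sp (take i (take n z)) (take n z ! i)} \<subseteq>
        {i. i < t \<and> sp (take i z) (z ! i)}"
      using len[OF that] by (auto simp: min_def)
    then have "tok (take n z) \<le> card {i. i < t \<and> sp (take i z) (z ! i)}"
      unfolding tok_def by (rule card_mono[rotated]) auto
    then show ?thesis using tokens[OF that] by linarith
  qed
  \<comment> \<open>The exponent \<open>n - q u\<close> is \<open>t - (length u + q u)\<close>;
    moving its second part to the left keeps \<open>M ^ t\<close> fixed during the induction.
    Passing from \<open>u\<close> to \<open>u @ [x]\<close> then costs exactly the weight of the
    step.\<close>
  have main: "real (card (N u)) * M powi (int (length u) + q u) \<le> (1 + real n * D) ^ (s - tok u) * M ^ t"
    if "length u + n = t" for u n
    using that
  proof (induction n arbitrary: u)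
    case 0
    show ?case
    proof (cases "N u = {}")
      case False
      have zu: "z = u" if "z \<in> N u" for z
      proof -
        have "length z \<le> length u" using that 0 len[of z] by (simp add: N_def)
        then show ?thesis using that by (simp add: N_def)
      qed
      then have u: "u \<in> L" using False by (auto simp: N_def)
      have "N u \<subseteq> {u}" using zu by blast
      then have "card (N u) \<le> 1" using card_mono[of "{u}" "N u"] by simp
      then have "real (card (N u)) * M powi (int (length u) + q u) \<le> 1 * M powi (int (length u) + q u)"
        using M by (intro mult_right_mono) auto
      then show ?thesis using qL[OF u] 0 by simp
    qed (use M in auto)
  next
    case (Suc n)
    let ?h = "\<lambda>x. M powi (q u - 1 - q (u @ [x]))"
    let ?E = "\<lambda>e. (1 + real n * D) ^ e * M ^ t"
    define e where "e = s - tok u"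
    have nD: "1 + real n * D \<ge> 1" using D by simp
    have lu: "length u < t" using Suc.prems by simp
    have "N u \<subseteq> (\<Union>x\<in>ext u. N (u @ [x]))"
    proof
      fix z assume z: "z \<in> N u"
      then have "take (Suc (length u)) z = u @ [z ! length u]"
        using len[of z] lu by (simp add: N_def take_Suc_conv_app_nth)
      then show "z \<in> (\<Union>x\<in>ext u. N (u @ [x]))" using z by (auto simp: N_def ext_def)
    qed
    then have "card (N u) \<le> card (\<Union>x\<in>ext u. N (u @ [x]))"
      by (rule card_mono[rotated]) (auto simp: finN fin_ext)
    also have "\<dots> \<le> (\<Sum>x\<in>ext u. card (N (u @ [x])))" by (rule card_UN_le[OF fin_ext])
    finally have "real (card (N u)) * M powi (int (length u) + q u) \<le>
        (\<Sum>x\<in>ext u. real (card (N (u @ [x])))) * M powi (int (length u) + q u)"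
      using M by (intro mult_right_mono) (auto simp flip: of_nat_sum)
    also have "\<dots> = (\<Sum>x\<in>ext u. real (card (N (u @ [x]))) * M powi (int (length u) + q u))"
      by (simp add: sum_distrib_right)
    also have "\<dots> \<le> (\<Sum>x\<in>ext u. ?E (s - tok (u @ [x])) * ?h x)"
    proof (rule sum_mono)
      fix x
      have "M powi (int (length u) + q u) = M powi (int (length (u @ [x])) + q (u @ [x])) * ?h x"
        using M by (simp add: power_int_add[symmetric])
      moreover have "real (card (N (u @ [x]))) * M powi (int (length (u @ [x])) + q (u @ [x])) * ?h x
          \<le> ?E (s - tok (u @ [x])) * ?h x"
        using Suc.IH[of "u @ [x]"] Suc.prems M by (intro mult_right_mono) auto
      ultimately show "real (card (N (u @ [x]))) * M powi (int (length u) + q u) \<le>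
          ?E (s - tok (u @ [x])) * ?h x" by (simp add: mult.assoc)
    qed
    also have "\<dots> = (\<Sum>x\<in>{x\<in>ext u. \<not> sp u x}. ?E (s - tok (u @ [x])) * ?h x) +
        (\<Sum>x\<in>{x\<in>ext u. sp u x}. ?E (s - tok (u @ [x])) * ?h x)"
      by (subst sum.union_disjoint[symmetric]) (auto simp: fin_ext intro: sum.cong)
    also have "(\<Sum>x\<in>{x\<in>ext u. \<not> sp u x}. ?E (s - tok (u @ [x])) * ?h x) =
        ?E e * (\<Sum>x\<in>{x\<in>ext u. \<not> sp u x}. ?h x)"
      by (simp add: tok_snoc sum_distrib_left e_def)
    also have "(\<Sum>x\<in>{x\<in>ext u. sp u x}. ?E (s - tok (u @ [x])) * ?h x) =
        ?E (e - 1) * (\<Sum>x\<in>{x\<in>ext u. sp u x}. ?h x)"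
      by (simp add: tok_snoc sum_distrib_left e_def)
    also have "?E e * (\<Sum>x\<in>{x\<in>ext u. \<not> sp u x}. ?h x) \<le> ?E e * 1"
      using ordinary[OF lu] M nD by (intro mult_left_mono) auto
    \<comment> \<open>If \<open>e = 0\<close>, no special step is left and the second sum is empty.
      Otherwise one of them is spent, and \<open>(1 + n * D) ^ f * (1 + n * D + D)\<close> is
      absorbed by the next power of \<open>1 + Suc n * D\<close>.\<close>
    also have "?E e * 1 + ?E (e - 1) * (\<Sum>x\<in>{x\<in>ext u. sp u x}. ?h x) \<le> (1 + real (Suc n) * D) ^ e * M ^ t"
    proof (cases e)
      case 0
      have no_special: "{x\<in>ext u. sp u x} = {}"
      proof (rule ccontr)
        assume "{x\<in>ext u. sp u x} \<noteq> {}"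
        then obtain x z where "sp u x" "z \<in> L" "take (Suc (length u)) z = u @ [x]"
          by (auto simp: ext_def)
        then have "tok u + 1 \<le> s" using tok_le[of z "Suc (length u)"] tok_snoc[of u x] by simp
        then show False using 0 by (simp add: e_def)
      qed
      show ?thesis unfolding no_special using 0 by simp
    next
      case (Suc f)
      have "?E e * 1 + ?E (e - 1) * (\<Sum>x\<in>{x\<in>ext u. sp u x}. ?h x) \<le> ?E e * 1 + ?E (e - 1) * D"
        using special[OF lu] M nD by (intro add_left_mono mult_left_mono) auto
      also have "\<dots> = (1 + real n * D) ^ f * (1 + real n * D + D) * M ^ t"
        using Suc by (simp add: algebra_simps)
      also have "\<dots> \<le> (1 + real n * D + D) ^ f * (1 + real n * D + D) * M ^ t"
        using D M nD by (intro mult_right_mono power_mono) auto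
      also have "\<dots> = (1 + real n * D + D) ^ e * M ^ t" using Suc by simp
      also have "1 + real n * D + D = 1 + real (Suc n) * D" by (simp add: algebra_simps)
      finally show ?thesis .
    qed
    finally show ?case by (simp add: e_def)
  qed
  have "N [] = L" "tok [] = 0" by (auto simp: N_def tok_def)
  then show ?thesis using main[of "[]" t] q0 by simp
qed

section \<open>Crossing numbers and the potential\<close>

lemma crossings_snoc:
  "crossings (u @ [d]) e = crossings u e + (if d = e \<or> d = dinv e then 1 else 0)"
  by (simp add: crossings_def)

lemma crossings_dinv [simp]: "crossings u (dinv d) = crossings u d"
  by (induction u) (auto simp: crossings_def)

lemma crossings_eq_0_iff: "crossings u d = 0 \<longleftrightarrow> d \<notin> darts u"
proof -
  have "d \<in> dinv ` set u \<longleftrightarrow> dinv d \<in> set u" by (auto intro: image_eqI[of d dinv "dinv d"])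
  then show ?thesis by (auto simp: crossings_def filter_empty_conv darts_def)
qed

lemma crossings_append: "crossings (u @ v) d = crossings u d + crossings v d"
  by (simp add: crossings_def)

text \<open>Taking darts of \<open>u\<close> itself represents each edge by the one dart that
  crossed it, so the cardinality counts edges and not orientations.\<close>

definition single_edges :: "('v, 'a) dart list \<Rightarrow> ('v, 'a) dart set" where
  "single_edges u = {d \<in> set u. crossings u d = 1}"

text \<open>Only the edge under \<open>d\<close> changes its status. At a second crossing the
  element that leaves the set is the earlier dart \<open>e\<close>, which is \<open>d\<close> or its
  inverse.\<close>

lemma card_single_edges_snoc:
  "int (card (single_edges (u @ [d]))) = int (card (single_edges u)) +
    (if crossings u d = 0 then 1 else if crossings u d = 1 then - 1 else 0)"
proof -
  have fin: "finite (single_edges u)" by (simp add: single_edges_def)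
  consider "crossings u d = 0" | "crossings u d = 1" | "crossings u d \<ge> 2" by linarith
  then show ?thesis
  proof cases
    case 1
    then have "d \<notin> set u" "dinv d \<notin> set u"
      using crossings_eq_0_iff[of u d] crossings_eq_0_iff[of u "dinv d"] by (auto simp: darts_def)
    then have "single_edges (u @ [d]) = insert d (single_edges u)" "d \<notin> single_edges u"
      using 1 by (auto simp: single_edges_def crossings_snoc)
    then show ?thesis using 1 fin by simp
  next
    case 2
    then obtain e where e: "filter (\<lambda>e. e = d \<or> e = dinv d) u = [e]"
      by (auto simp: crossings_def length_Suc_conv)
    have "set u \<inter> {d, dinv d} = set (filter (\<lambda>e. e = d \<or> e = dinv d) u)" by auto
    also have "\<dots> = {e}" by (simp only: e) simp
    finally have e: "e \<in> set u" "e = d \<or> e = dinv d" "\<And>f. f \<in> set u \<Longrightarrow> f = d \<or> f = dinv d \<Longrightarrow> f = e"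
      by auto
    have ce: "crossings u e = 1" using e(2) 2 by auto
    have "f \<in> single_edges (u @ [d]) \<longleftrightarrow> f \<in> single_edges u - {e}" for f
    proof (cases "f = d \<or> f = dinv d")
      case True
      then have "d = f \<or> d = dinv f" "crossings u f = 1" using 2 by auto
      then have "f \<notin> single_edges (u @ [d])" by (simp add: single_edges_def crossings_snoc)
      moreover have "f \<notin> single_edges u - {e}" using e(3)[of f] True by (auto simp: single_edges_def)
      ultimately show ?thesis by blast
    next
      case False
      then have nd: "\<not> (d = f \<or> d = dinv f)" "f \<noteq> e" using e(2) by auto
      then have "crossings (u @ [d]) f = crossings u f" "f \<in> set (u @ [d]) \<longleftrightarrow> f \<in> set u"
        by (auto simp: crossings_snoc)
      then show ?thesis using nd(2) by (simp only: single_edges_def) simp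
    qed
    then have "single_edges (u @ [d]) = single_edges u - {e}" by blast
    moreover have "e \<in> single_edges u" using e(1) ce by (simp add: single_edges_def)
    ultimately show ?thesis using 2 fin using card_Suc_Diff1[OF fin, of e] by simp
  next
    case 3
    have "f \<in> single_edges (u @ [d]) \<longleftrightarrow> f \<in> single_edges u" for f
    proof (cases "d = f \<or> d = dinv f")
      case True
      then have "crossings u f \<ge> 2" using 3 by auto
      then show ?thesis by (auto simp: single_edges_def crossings_snoc)
    next
      case False
      then show ?thesis by (auto simp: single_edges_def crossings_snoc)
    qed
    then have "single_edges (u @ [d]) = single_edges u" by blast
    then show ?thesis using 3 by simp
  qed
qed

section \<open>Degrees in the traced graph\<close>

definition deg :: "('v, 'a) dart list \<Rightarrow> 'v \<Rightarrow> nat" where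
  "deg z a = card {d \<in> darts z. src d = a}"

lemma finite_darts [simp]: "finite (darts z)"
  by (simp add: darts_def)

lemma deg_mono: "darts u \<subseteq> darts z \<Longrightarrow> deg u a \<le> deg z a"
  unfolding deg_def by (rule card_mono) auto

lemma deg_pos:
  assumes "d \<in> darts z"
  shows "deg z (src d) \<ge> 1"
proof -
  have "card {d} \<le> deg z (src d)" unfolding deg_def by (rule card_mono) (use assms in auto)
  then show ?thesis by simp
qed

lemma finite_visited [simp]: "finite (visited a z)"
  by (simp add: visited_def)

lemma sum_deg:
  assumes "is_walk a z"
  shows "(\<Sum>b\<in>visited a z. deg z b) = card (darts z)"
proof -
  have "darts z = (\<Union>b\<in>visited a z. {d \<in> darts z. src d = b})"
    using darts_visited[OF assms] by auto
  then have "card (darts z) = card (\<Union>b\<in>visited a z. {d \<in> darts z. src d = b})" by simp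
  also have "\<dots> = (\<Sum>b\<in>visited a z. deg z b)"
    unfolding deg_def by (rule card_UN_disjoint) auto
  finally show ?thesis by simp
qed

definition cyc_reduced :: "'a word \<Rightarrow> bool" where
  "cyc_reduced w \<longleftrightarrow> reduced w \<and> (w \<noteq> [] \<longrightarrow> hd w \<noteq> flip (last w))"

text \<open>Passing through \<open>b\<close> uses a dart in and a dart out, and the latter is not
  the inverse of the former because the word is reduced. At the base point the last and the first
  step take these roles, which is where cyclic reduction enters.\<close>

lemma walk_deg_ge_2:
  assumes z: "is_walk a z" "walk_end a z = a" "cyc_reduced (map lab z)" "z \<noteq> []"
    and b: "b \<in> visited a z"
  shows "deg z b \<ge> 2"
proof -
  have two: "deg z b \<ge> 2" if "d \<in> darts z" "e \<in> darts z" "src d = b" "src e = b" "d \<noteq> e" for d e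
  proof -
    have "card {d, e} \<le> deg z b" unfolding deg_def by (rule card_mono) (use that in auto)
    then show ?thesis using that by simp
  qed
  obtain z1 d where zl: "z = z1 @ [d]" using z(4) by (metis append_butlast_last_id)
  obtain e z2 where zf: "z = e # z2" using z(4) by (cases z) auto
  show ?thesis
  proof (cases "b = a")
    case True
    have "src e = a" using z zf by simp
    moreover have "src (dinv d) = a" using z(2) by (simp add: zl walk_end_append)
    moreover have "lab e \<noteq> flip (lab d)"
    proof -
      have "hd (map lab z) = lab e" "last (map lab z) = lab d"
        using z(4) zf zl by (simp, metis last_map last_snoc)
      then show ?thesis using z(3,4) by (simp add: cyc_reduced_def)
    qed
    then have "e \<noteq> dinv d" by auto
    moreover have "e \<in> darts z" by (simp add: zf darts_def)
    moreover have "dinv d \<in> darts z" by (simp add: zl darts_def)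
    ultimately show ?thesis using two[of e "dinv d"] True by simp
  next
    case False
    then obtain f where "f \<in> set z" "tgt f = b" using b by (auto simp: visited_def)
    then obtain y1 y2 where y: "z = y1 @ f # y2" by (meson split_list)
    have "y2 \<noteq> []"
    proof
      assume "y2 = []"
      then show False using z(2) y \<open>tgt f = b\<close> False by (simp add: walk_end_append)
    qed
    then obtain g y3 where y2: "y2 = g # y3" by (cases y2) auto
    have "src g = b" using z(1) \<open>tgt f = b\<close> by (simp add: y y2 walk_append)
    moreover have "lab g \<noteq> flip (lab f)"
      using z(3) by (simp add: cyc_reduced_def y y2 reduced_append reduced_Cons)
    then have "g \<noteq> dinv f" by auto
    ultimately show ?thesis using two[of g "dinv f"] \<open>tgt f = b\<close> by (auto simp: darts_def y y2)
  qed
qed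

text \<open>The degrees add up to the number of darts, so the rank bound limits their total excess
  over two to \<open>2 * r - 2\<close>. As no summand is negative, a single vertex has at most that
  excess, hence degree at most \<open>2 * r\<close>.\<close>

lemma deg_excess:
  assumes z: "covers_twice r a z" "cyc_reduced (map lab z)" "z \<noteq> []"
  shows "(\<Sum>b\<in>visited a z. int (deg z b) - 2) \<le> 2 * int r - 2"
    and "\<And>b. b \<in> visited a z \<Longrightarrow> deg z b \<ge> 2"
    and "\<And>b. deg z b \<le> 2 * r"
proof -
  have w: "is_walk a z" "walk_end a z = a" using z by (auto simp: covers_twice_def)
  have d2: "deg z b \<ge> 2" if "b \<in> visited a z" for b
    using walk_deg_ge_2[OF w z(2,3) that] .
  have "(\<Sum>b\<in>visited a z. int (deg z b) - 2) = int (card (darts z)) - 2 * int (card (visited a z))"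
    by (simp add: sum_subtractf sum_deg[OF w(1), symmetric])
  also have "\<dots> \<le> 2 * int r - 2" using z(1) by (simp add: covers_twice_def visited_def)
  finally show s: "(\<Sum>b\<in>visited a z. int (deg z b) - 2) \<le> 2 * int r - 2" .
  show "deg z b \<le> 2 * r" for b
  proof (cases "b \<in> visited a z")
    case True
    have "int (deg z b) - 2 \<le> (\<Sum>b\<in>visited a z. int (deg z b) - 2)"
      by (rule member_le_sum[OF True]) (use d2 in force, simp)
    then show ?thesis using s by simp
  next
    case False
    then have no_darts: "{d \<in> darts z. src d = b} = {}" using darts_visited[OF w(1)] by auto
    show ?thesis unfolding deg_def no_darts by simp
  qed
  show "deg z b \<ge> 2" if "b \<in> visited a z" for b by (rule d2[OF that])
qed

text \<open>A step is ordinary if it continues an arc into unexplored territory, follows the only way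
  out of an explored vertex of degree two, or crosses an edge at least for the third time. The
  remaining steps are few (\<open>card_special_steps\<close>): an arc begins or ends at an explored vertex, or an
  edge at a branching vertex is crossed for the first or second time.\<close>

definition ordinary :: "(nat, 'a) dart list \<Rightarrow> (nat, 'a) dart \<Rightarrow> bool" where
  "ordinary u d \<longleftrightarrow> u \<noteq> [] \<and>
    (deg u (src d) = 1 \<and> crossings u d = 0 \<and> tgt d \<notin> visited 0 u \<or>
     deg u (src d) = 2 \<and> crossings u d \<ge> 1 \<or>
     deg u (src d) \<ge> 3 \<and> crossings u d \<ge> 2)"

lemma walk_take: "is_walk a z \<Longrightarrow> is_walk a (take i z)"
  by (metis append_take_drop_id walk_append)

lemma walk_nth:
  assumes "is_walk a z" "i < length z"
  shows "src (z ! i) = walk_end a (take i z)"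
  using assms by (metis id_take_nth_drop is_walk.simps(2) walk_append)

lemma dinv_last_dart:
  assumes "u \<noteq> []"
  shows "dinv (last u) \<in> darts u" "src (dinv (last u)) = walk_end a u"
  using assms walk_end_last[OF assms] by (auto simp: darts_def)

text \<open>The constant: the initial step counts 1. \<open>T2\<close> holds the steps that close a
  cycle by a new edge, at most edges - (vertices - 1), hence at most \<open>r\<close>. Vertices of
  final degree at least three carry at most \<open>6 * r\<close> darts, each of which serves at most
  once for a first and once for a second crossing of its edge; this gives
  \<open>12 * r\<close>.\<close>

lemma card_special_steps:
  assumes z: "covers_twice r 0 z" "cyc_reduced (map lab z)" "z \<noteq> []"
  shows "card {i. i < length z \<and> \<not> ordinary (take i z) (z ! i)} \<le> 13 * r + 1"
proof -
  let ?t = "length z" and ?u = "\<lambda>i. take i z"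
  have w: "is_walk 0 z" "walk_end 0 z = 0" using z by (auto simp: covers_twice_def)
  note ex = deg_excess[OF z]
  define N where "N = {i. i < ?t \<and> crossings (?u i) (z ! i) = 0}"
  define Fr where "Fr = {i. i < ?t \<and> tgt (z ! i) \<notin> visited 0 (?u i)}"
  define T2 where "T2 = {i \<in> N. tgt (z ! i) \<in> visited 0 (?u i)}"
  define H where "H = {d \<in> darts z. deg z (src d) \<ge> 3}"
  define T3 where "T3 c = {i. i < ?t \<and> crossings (?u i) (z ! i) = c \<and> deg z (src (z ! i)) \<ge> 3}" for c
  have du: "darts (?u i) \<subseteq> darts z" for i
    unfolding darts_def using set_take_subset[of i z] by blast
  have cross: "crossings (?u j) (z ! j) \<ge> crossings (?u i) (z ! i) + 1"
    if "i < j" "j < ?t" "z ! i = z ! j \<or> z ! i = dinv (z ! j)" for i j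
  proof -
    have "?u j = ?u (Suc i) @ drop (Suc i) (?u j)"
      using that(1) append_take_drop_id[of "Suc i" "?u j"] by (simp add: min_def)
    then have "crossings (?u j) (z ! j) \<ge> crossings (?u (Suc i)) (z ! j)"
      using crossings_append[of "?u (Suc i)" "drop (Suc i) (?u j)" "z ! j"] by simp
    also have "crossings (?u (Suc i)) (z ! j) = crossings (?u i) (z ! j) + 1"
      using that by (simp add: take_Suc_conv_app_nth crossings_snoc)
    also have "crossings (?u i) (z ! j) = crossings (?u i) (z ! i)"
      using that(3) by auto
    finally show ?thesis .
  qed
  have injT: "inj_on (\<lambda>i. z ! i) {i. i < ?t \<and> crossings (?u i) (z ! i) = c}" for c
  proof (rule inj_onI)
    fix i j assume "i \<in> {i. i < ?t \<and> crossings (?u i) (z ! i) = c}"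
      "j \<in> {i. i < ?t \<and> crossings (?u i) (z ! i) = c}" "z ! i = z ! j"
    then show "i = j" using cross[of i j] cross[of j i] by (cases i j rule: linorder_cases) auto
  qed
  have T3: "card (T3 c) \<le> card H" for c
    by (rule card_inj_on_le[where f = "\<lambda>i. z ! i"], rule inj_on_subset[OF injT[of c]])
      (auto simp: T3_def H_def darts_def)
  have "card H = (\<Sum>b\<in>{b \<in> visited 0 z. deg z b \<ge> 3}. deg z b)"
  proof -
    have "H = (\<Union>b\<in>{b \<in> visited 0 z. deg z b \<ge> 3}. {d \<in> darts z. src d = b})"
      using darts_visited[OF w(1)] by (auto simp: H_def)
    then have "card H = card (\<Union>b\<in>{b \<in> visited 0 z. deg z b \<ge> 3}. {d \<in> darts z. src d = b})" by simp
    also have "\<dots> = (\<Sum>b\<in>{b \<in> visited 0 z. deg z b \<ge> 3}. deg z b)"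
      unfolding deg_def[of z] by (rule card_UN_disjoint) auto
    finally show ?thesis .
  qed
  then have "int (card H) = (\<Sum>b\<in>{b \<in> visited 0 z. deg z b \<ge> 3}. int (deg z b))" by simp
  \<comment> \<open>From degree three on, a degree is at most three times its excess over two, so
    the bounded excess controls all darts at branching vertices.\<close>
  also have "\<dots> \<le> (\<Sum>b\<in>{b \<in> visited 0 z. deg z b \<ge> 3}. 3 * (int (deg z b) - 2))"
    by (rule sum_mono) auto
  also have "\<dots> \<le> (\<Sum>b\<in>visited 0 z. 3 * (int (deg z b) - 2))"
    by (rule sum_mono2) (use ex(2) in force)+
  also have "\<dots> = 3 * (\<Sum>b\<in>visited 0 z. int (deg z b) - 2)" by (simp add: sum_distrib_left)
  finally have H: "card H \<le> 6 * r" using ex(1) by linarith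

  have fin: "finite N" "finite Fr" "finite T2" by (auto simp: N_def Fr_def T2_def)
  \<comment> \<open>Different steps of \<open>N\<close> explore different edges, and each edge
    provides two darts.\<close>
  have "2 * card N \<le> card (darts z)"
  proof -
    let ?P = "(\<lambda>i. z ! i) ` N"
    have c: "card ?P = card N" using injT[of 0] by (simp add: N_def card_image)
    have d: "card (dinv ` ?P) = card ?P" by (rule card_image) (metis dinv_simps(4) inj_onI)
    have disj: "?P \<inter> dinv ` ?P = {}"
    proof (rule ccontr)
      assume "?P \<inter> dinv ` ?P \<noteq> {}"
      then obtain e where "e \<in> ?P" "e \<in> dinv ` ?P" by blast
      then obtain i j where ij: "i \<in> N" "j \<in> N" "z ! i = dinv (z ! j)" by blast
      then have "z ! j = dinv (z ! i)" by simp
      then show False using ij cross[of i j] cross[of j i] 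
        by (cases i j rule: linorder_cases) (auto simp: N_def, metis dinv_neq)
    qed
    have "card (?P \<union> dinv ` ?P) = 2 * card N"
      using disj fin by (subst card_Un_disjoint) (auto simp: c d)
    moreover have "card (?P \<union> dinv ` ?P) \<le> card (darts z)"
      by (rule card_mono) (auto simp: darts_def N_def)
    ultimately show ?thesis by simp
  qed
  moreover have "card (visited 0 z) \<le> card Fr + 1"
  proof -
    have "visited 0 z \<subseteq> insert 0 ((\<lambda>i. tgt (z ! i)) ` Fr)"
    proof
      fix b assume b: "b \<in> visited 0 z"
      show "b \<in> insert 0 ((\<lambda>i. tgt (z ! i)) ` Fr)"
      proof (cases "b = 0")
        case False
        define i where "i = (LEAST i. i < ?t \<and> tgt (z ! i) = b)"
        have "\<exists>i. i < ?t \<and> tgt (z ! i) = b" using b False by (auto simp: visited_def in_set_conv_nth) (metis snd_conv)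
        then have i: "i < ?t \<and> tgt (z ! i) = b" unfolding i_def by (rule LeastI_ex)
        have "tgt (z ! j) \<noteq> b" if "j < i" for j
          using not_less_Least[of j "\<lambda>i. i < ?t \<and> tgt (z ! i) = b"] that i unfolding i_def by auto
        moreover have "\<exists>j<i. tgt (z ! j) = b" if bv: "b \<in> visited 0 (?u i)"
        proof -
          obtain d where "d \<in> set (?u i)" "tgt d = b" using bv False by (auto simp: visited_def)
          then show ?thesis using i unfolding in_set_conv_nth by auto
        qed
        ultimately have "b \<notin> visited 0 (?u i)" by blast
        then show ?thesis using i by (auto simp: Fr_def)
      qed simp
    qed
    then have "card (visited 0 z) \<le> card (insert 0 ((\<lambda>i. tgt (z ! i)) ` Fr))"
      by (rule card_mono[rotated]) (simp add: fin)
    also have "\<dots> \<le> card ((\<lambda>i. tgt (z ! i)) ` Fr) + 1" using fin by (simp add: card_insert_if)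
    also have "\<dots> \<le> card Fr + 1" by (simp add: card_image_le fin)
    finally show ?thesis .
  qed
  moreover have "card T2 + card Fr \<le> card N"
  proof -
    have "Fr \<subseteq> N"
    proof
      fix i assume "i \<in> Fr"
      then show "i \<in> N"
        using darts_visited[OF walk_take[OF w(1)], of "z ! i" i]
        by (auto simp: Fr_def N_def crossings_eq_0_iff simp del: split_paired_All)
    qed
    then have "T2 \<union> Fr \<subseteq> N" by (auto simp: T2_def)
    then have "card (T2 \<union> Fr) \<le> card N" by (rule card_mono[OF fin(1)])
    moreover have "card (T2 \<union> Fr) = card T2 + card Fr"
      by (rule card_Un_disjoint) (use fin in \<open>auto simp: T2_def Fr_def\<close>)
    ultimately show ?thesis by simp
  qed
  moreover have "card (darts z) + 2 \<le> 2 * card (visited 0 z) + 2 * r"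
    using z(1) by (simp add: covers_twice_def visited_def)
  ultimately have T2: "card T2 \<le> r" by linarith

  have "{i. i < ?t \<and> \<not> ordinary (?u i) (z ! i)} \<subseteq> {0} \<union> (T2 \<union> (T3 0 \<union> T3 1))"
  proof
    fix i assume "i \<in> {i. i < ?t \<and> \<not> ordinary (?u i) (z ! i)}"
    then have i: "i < ?t" and no: "\<not> ordinary (?u i) (z ! i)" by auto
    show "i \<in> {0} \<union> (T2 \<union> (T3 0 \<union> T3 1))"
    proof (cases "i = 0")
      case False
      define d where "d = z ! i"
      \<comment> \<open>\<open>l\<close> is the way back along the last step. It is an explored dart
        at the current vertex which a reduced word cannot take; so if \<open>d\<close> is explored
        as well, the explored degree is at least two, and at explored degree one the step must open
        a new edge.\<close>
      define l where "l = dinv (last (?u i))"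
      have ne: "?u i \<noteq> []" using False i by auto
      have l: "l \<in> darts (?u i)" "src l = src d"
        using dinv_last_dart(1)[OF ne] dinv_last_dart(2)[OF ne, of 0] walk_nth[OF w(1) i] by (auto simp: d_def l_def)
      have last: "last (?u i) = z ! (i - 1)" using False i ne by (subst last_conv_nth) auto
      have "z = take (i - 1) z @ z ! (i - 1) # z ! i # drop (Suc i) z"
        using False i id_take_nth_drop[of "i - 1" z] Cons_nth_drop_Suc[OF i] by simp
      then have "reduced (map lab (take (i - 1) z @ z ! (i - 1) # z ! i # drop (Suc i) z))"
        using z(2) by (simp add: cyc_reduced_def)
      then have "lab d \<noteq> flip (lab (z ! (i - 1)))"
        by (simp add: reduced_append reduced_Cons d_def)
      then have dl: "d \<noteq> l" by (auto simp: l_def last)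
      have dz: "d \<in> darts z" using i by (simp add: darts_def d_def)
      have grow: "deg z (src d) \<ge> deg (?u i) (src d) + 1" if "crossings (?u i) d = 0"
      proof -
        have "insert d {e \<in> darts (?u i). src e = src d} \<subseteq> {e \<in> darts z. src e = src d}"
          using dz du[of i] by auto
        then have "card (insert d {e \<in> darts (?u i). src e = src d}) \<le> deg z (src d)"
          unfolding deg_def by (rule card_mono[rotated]) simp
        then show ?thesis using that by (simp add: crossings_eq_0_iff deg_def)
      qed
      have old: "deg (?u i) (src d) \<ge> 2" if "crossings (?u i) d \<noteq> 0"
      proof -
        have "card {d, l} \<le> deg (?u i) (src d)" unfolding deg_def
          by (rule card_mono) (use that l in \<open>auto simp: crossings_eq_0_iff\<close>)
        then show ?thesis using dl by simp
      qed
      have pos: "deg (?u i) (src d) \<ge> 1"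
        using deg_pos[OF l(1)] l(2) by simp
      have le: "deg (?u i) (src d) \<le> deg z (src d)" by (rule deg_mono[OF du])
      consider "deg (?u i) (src d) = 1" | "deg (?u i) (src d) = 2" | "deg (?u i) (src d) \<ge> 3"
        using pos by linarith
      then show ?thesis
      proof cases
        case 1
        then have "crossings (?u i) d = 0" using old by fastforce
        then show ?thesis using no 1 ne i by (auto simp: ordinary_def d_def T2_def N_def)
      next
        case 2
        \<comment> \<open>A new dart at a vertex of explored degree two makes its final degree at
          least three, so the step falls into \<open>T3 0\<close>.\<close>
        then have "crossings (?u i) d = 0" using no ne by (auto simp: ordinary_def d_def)
        then show ?thesis using grow 2 i by (auto simp: T3_def d_def)
      next
        case 3
        then have "crossings (?u i) d = 0 \<or> crossings (?u i) d = 1"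
          using no ne by (auto simp: ordinary_def d_def)
        then show ?thesis using le 3 i by (auto simp: T3_def d_def)
      qed
    qed simp
  qed
  then have "card {i. i < ?t \<and> \<not> ordinary (?u i) (z ! i)} \<le> card ({0} \<union> (T2 \<union> (T3 0 \<union> T3 1)))"
    by (rule card_mono[rotated]) (auto simp: fin T3_def)
  also have "\<dots> \<le> 1 + (card T2 + (card (T3 0) + card (T3 1)))"
    using card_Un_le[of "{0}" "T2 \<union> (T3 0 \<union> T3 1)"] card_Un_le[of T2 "T3 0 \<union> T3 1"]
      card_Un_le[of "T3 0" "T3 1"] by simp
  also have "\<dots> \<le> 13 * r + 1" using T2 T3[of 0] T3[of 1] H by linarith
  finally show ?thesis .
qed

lemma sum_le_const:
  fixes f :: "'x \<Rightarrow> real"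
  assumes "finite S" "\<And>x. x \<in> S \<Longrightarrow> f x \<le> c" "card S \<le> n" "c \<ge> 0"
  shows "sum f S \<le> real n * c"
proof -
  have "sum f S \<le> real (card S) * c" using assms(2) by (rule sum_bounded_above)
  also have "\<dots> \<le> real n * c" using assms(3,4) by (intro mult_right_mono) auto
  finally show ?thesis .
qed

text \<open>With the number of edges crossed once as potential, a first, second or later crossing
  has weight \<open>1 / M ^ 2\<close>, \<open>1\<close> or \<open>1 / M\<close>. The lower bounds on
  \<open>M\<close> make up for the \<open>2 * card A - 1\<close> labels of an exploring step and the
  \<open>2 * r - 1\<close> ways to cross an edge again. The factor
  \<open>2 * card A * (t + 1)\<close> bounds all continuations of a prefix: the source is the
  current vertex, which leaves a label and a name for the target.\<close>

lemma card_cyc_reduced_covers_twice: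
  fixes A :: "'a set" and M :: real
  assumes A: "finite A" and M: "M \<ge> 1" "M\<^sup>2 \<ge> 2 * real (card A) - 1" "M \<ge> 2 * real r - 1" and t: "t > 0"
  shows "real (card {w. cyc_reduced w \<and> fst ` set w \<subseteq> A \<and> length w = t \<and>
      (\<exists>(a :: 'v) z. map lab z = w \<and> covers_twice r a z)}) \<le>
    (1 + real t * (2 * real (card A) * (real t + 1))) ^ (13 * r + 1) * M ^ t"
proof -
  define L where "L = {z :: (nat, 'a) dart list. length z = t \<and> covers_twice r 0 z \<and> canonical z \<and>
    cyc_reduced (map lab z) \<and> fst ` set (map lab z) \<subseteq> A}"
  define ext where "ext u = {d. \<exists>z\<in>L. take (Suc (length u)) z = u @ [d]}" for u
  define q where "q u = int (card (single_edges u))" for u :: "(nat, 'a) dart list"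
  define X where "X = A \<times> (UNIV :: bool set)"
  have X: "finite X" "card X = 2 * card A" using A by (auto simp: X_def card_cartesian_product)
  have zw: "is_walk 0 z" "z \<noteq> []" "length z = t" "covers_twice r 0 z" "cyc_reduced (map lab z)" if "z \<in> L" for z
  proof -
    show l: "length z = t" "covers_twice r 0 z" "cyc_reduced (map lab z)"
      using that unfolding L_def by blast+
    show "is_walk 0 z" using l(2) by (simp add: covers_twice_def)
    show "z \<noteq> []" using l(1) t by auto
  qed
  have tgt_le: "visited 0 (take i z) \<subseteq> {..i}" if "z \<in> L" "i \<le> t" for z i
    using that(2)
  proof (induction i)
    case (Suc i)
    have "tgt (z ! i) \<in> insert (Suc i) (visited 0 (take i z))"
      using that(1) Suc.prems by (auto simp: L_def canonical_def)
    moreover have "visited 0 (take (Suc i) z) = insert (tgt (z ! i)) (visited 0 (take i z))"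
      using Suc.prems zw(3)[OF that(1)] by (auto simp: visited_def take_Suc_conv_app_nth)
    ultimately show ?case using Suc by auto
  qed (simp add: visited_def)
  have lab_X: "lab d \<in> X" if "z \<in> L" "d \<in> set z" for z d
    using that by (cases "lab d") (force simp: L_def X_def)
  have finL: "finite L"
  proof (rule finite_subset)
    show "L \<subseteq> {z. set z \<subseteq> {..t} \<times> X \<times> {..t} \<and> length z = t}"
    proof
      fix z assume z: "z \<in> L"
      have "d \<in> {..t} \<times> X \<times> {..t}" if d: "d \<in> set z" for d
      proof -
        have "visited 0 z \<subseteq> {..t}" using tgt_le[OF z, of t] zw[OF z] by simp
        moreover have "src d \<in> visited 0 z" by (rule src_in_visited[OF zw(1)[OF z] d])
        moreover have "tgt d \<in> visited 0 z" using d by (simp add: visited_def)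
        ultimately have "src d \<in> {..t}" "tgt d \<in> {..t}" by blast+
        then show ?thesis using lab_X[OF z d] by (cases d) auto
      qed
      then show "z \<in> {z. set z \<subseteq> {..t} \<times> X \<times> {..t} \<and> length z = t}"
        using zw(3)[OF z] by blast
    qed
    show "finite {z. set z \<subseteq> {..t} \<times> X \<times> {..t} \<and> length z = t}"
      by (rule finite_lists_length_eq) (simp add: X)
  qed
  have ext_d: "src d = walk_end 0 u" "lab d \<in> X" "tgt d \<in> insert (Suc (length u)) (visited 0 u)"
    "tgt d \<le> t" "u \<noteq> [] \<Longrightarrow> lab d \<noteq> flip (lab (last u)) \<and> lab (last u) \<in> X"
    "deg u b \<le> 2 * r"
    if d: "d \<in> ext u" and lu: "length u < t" for u d b
  proof -
    obtain z where z: "z \<in> L" "take (Suc (length u)) z = u @ [d]" using d by (auto simp: ext_def)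
    let ?n = "length u"
    have n: "?n < length z" using zw(3)[OF z(1)] lu by simp
    have u: "u = take ?n z" "d = z ! ?n"
      using z(2) n by (auto simp: take_Suc_conv_app_nth)
    have dz: "d \<in> set z" using u(2) n by simp
    show "src d = walk_end 0 u" using walk_nth[OF zw(1)[OF z(1)] n] u by simp
    show "lab d \<in> X" by (rule lab_X[OF z(1) dz])
    show td: "tgt d \<in> insert (Suc ?n) (visited 0 u)" using z(1) n u by (auto simp: L_def canonical_def)
    show "tgt d \<le> t" using td tgt_le[OF z(1), of ?n] u lu by auto
    show "lab d \<noteq> flip (lab (last u)) \<and> lab (last u) \<in> X" if ne: "u \<noteq> []"
    proof -
      obtain v e where v: "u = v @ [e]" using ne by (metis append_butlast_last_id)
      have "z = (v @ [e, d]) @ drop (Suc ?n) z"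
        using append_take_drop_id[of "Suc ?n" z] unfolding z(2) by (simp add: v)
      then have "reduced (map lab ((v @ [e, d]) @ drop (Suc ?n) z))"
        using zw(5)[OF z(1)] by (simp add: cyc_reduced_def)
      then have "lab d \<noteq> flip (lab e)" by (simp add: reduced_append reduced_Cons)
      moreover have "e \<in> set z" using u(1) v by (metis in_set_takeD in_set_conv_decomp)
      ultimately show ?thesis using lab_X[OF z(1)] v by simp
    qed
    have "darts u \<subseteq> darts z" unfolding darts_def using set_take_subset[of ?n z] u(1) by (metis Un_mono image_mono)
    then show "deg u b \<le> 2 * r"
      using deg_mono[of u z b] deg_excess(3)[OF zw(4,5,2)[OF z(1)], of b] by linarith
  qed
  have fin_ext: "finite (ext u)" "card (ext u) \<le> 2 * card A * (t + 1)" if lu: "length u < t" for u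
  proof -
    have inj: "inj_on (\<lambda>d. (lab d, tgt d)) (ext u)"
    proof (rule inj_onI)
      fix d e assume "d \<in> ext u" "e \<in> ext u" "(lab d, tgt d) = (lab e, tgt e)"
      then show "d = e" using ext_d(1)[OF _ lu, of d] ext_d(1)[OF _ lu, of e] by (simp add: prod_eq_iff)
    qed
    have sub: "(\<lambda>d. (lab d, tgt d)) ` ext u \<subseteq> X \<times> {..t}"
    proof (rule image_subsetI)
      fix d assume "d \<in> ext u"
      then show "(lab d, tgt d) \<in> X \<times> {..t}" using ext_d(2,4)[OF _ lu, of d] by (simp add: mem_Times_iff)
    qed
    show "finite (ext u)" using inj sub X by (meson finite_SigmaI finite_atMost finite_imageD finite_subset)
    have "card (ext u) \<le> card (X \<times> {..t})" by (rule card_inj_on_le[OF inj sub]) (simp add: X)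
    then show "card (ext u) \<le> 2 * card A * (t + 1)" by (simp add: X card_cartesian_product)
  qed
  have weight: "M powi (q u - 1 - q (u @ [d])) =
      (if crossings u d = 0 then 1 / M\<^sup>2 else if crossings u d = 1 then 1 else 1 / M)" for u d
  proof -
    have "M powi (- 2) = 1 / M\<^sup>2" "M powi (- 1) = 1 / M"
      by (simp_all add: power_int_minus field_simps)
    then show ?thesis by (simp add: q_def card_single_edges_snoc)
  qed
  have weight_le: "M powi (q u - 1 - q (u @ [d])) \<le> 1" for u d
    using M(1) by (auto simp: weight one_le_power)
  have weight_ge: "M powi (q u - 1 - q (u @ [d])) \<ge> 0" for u d
    using M(1) by (auto simp: weight)
  have ord: "(\<Sum>d\<in>{d \<in> ext u. \<not> \<not> ordinary u d}. M powi (q u - 1 - q (u @ [d]))) \<le> 1"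
    if lu: "length u < t" for u
  proof (cases "{d \<in> ext u. ordinary u d} = {}")
    case False
    let ?S = "{d \<in> ext u. ordinary u d}"
    let ?b = "walk_end 0 u"
    obtain e where e: "e \<in> ext u" "ordinary u e" using False by blast
    have ne: "u \<noteq> []" using e by (simp add: ordinary_def)
    let ?l = "dinv (last u)"
    have l: "?l \<in> darts u" "src ?l = ?b" by (rule dinv_last_dart[OF ne])+
    have src: "src d = ?b" if "d \<in> ext u" for d by (rule ext_d(1)[OF that lu])
    have fin: "finite ?S" using fin_ext[OF lu] by simp
    \<comment> \<open>Continuations along explored edges are explored darts at the current vertex
      other than the way back, hence the loss of one.\<close>
    have old: "card ?S \<le> deg u ?b - 1" if "\<And>d. d \<in> ?S \<Longrightarrow> crossings u d \<ge> 1"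
    proof -
      have "?S \<subseteq> {d \<in> darts u. src d = ?b} - {?l}"
      proof
        fix d assume d: "d \<in> ?S"
        have "d \<in> darts u" using that[OF d] crossings_eq_0_iff[of u d] by auto
        moreover have "lab d \<noteq> lab ?l" using ext_d(5)[OF _ lu ne, of d] d by simp
        ultimately show "d \<in> {d \<in> darts u. src d = ?b} - {?l}" using src d by auto
      qed
      then have "card ?S \<le> card ({d \<in> darts u. src d = ?b} - {?l})" by (rule card_mono[rotated]) simp
      then show ?thesis using l by (simp add: deg_def)
    qed
    have pos: "deg u ?b \<ge> 1"
      using deg_pos[OF l(1)] l(2) by simp
    consider "deg u ?b = 1" | "deg u ?b = 2" | "deg u ?b \<ge> 3" using pos by linarith
    then have "sum (\<lambda>d. M powi (q u - 1 - q (u @ [d]))) ?S \<le> 1"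
    proof cases
      case 1
      \<comment> \<open>Canonical naming fixes the target of a step to an unvisited vertex, so these
        continuations differ in their labels alone, and the inverse of the last label is
        excluded.\<close>
      have new: "crossings u d = 0" "tgt d = Suc (length u)" "src d = ?b" if d: "d \<in> ?S" for d
        using d 1 src[of d] ext_d(3)[OF _ lu, of d] by (auto simp: ordinary_def)
      have inj: "inj_on lab ?S"
      proof (rule inj_onI)
        fix d e assume "d \<in> ?S" "e \<in> ?S" "lab d = lab e"
        then show "d = e" using new[of d] new[of e] by (simp add: prod_eq_iff)
      qed
      have ll: "lab (last u) \<in> X" using ext_d(5)[OF e(1) lu ne] by simp
      have "lab ` ?S \<subseteq> X - {flip (lab (last u))}"
      proof (rule image_subsetI)
        fix d assume "d \<in> ?S"
        then show "lab d \<in> X - {flip (lab (last u))}" using ext_d(2,5)[OF _ lu, of d] ne by simp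
      qed
      then have "card ?S \<le> card (X - {flip (lab (last u))})"
        by (rule card_inj_on_le[OF inj]) (simp add: X)
      moreover have "flip (lab (last u)) \<in> X" using ll by (auto simp: X_def flip_def)
      ultimately have c: "card ?S \<le> 2 * card A - 1" by (simp add: X)
      have A1: "card A \<ge> 1" using ll A by (auto simp: X_def Suc_le_eq card_gt_0_iff)
      have "sum (\<lambda>d. M powi (q u - 1 - q (u @ [d]))) ?S \<le> real (2 * card A - 1) * (1 / M\<^sup>2)"
        by (rule sum_le_const[OF fin _ c]) (use new in \<open>auto simp: weight\<close>)
      also have "\<dots> \<le> 1" using M A1 by (simp add: of_nat_diff divide_le_eq)
      finally show ?thesis .
    next
      case 2
      have "card ?S \<le> 1" using old 2 src by (force simp: ordinary_def)
      then have "sum (\<lambda>d. M powi (q u - 1 - q (u @ [d]))) ?S \<le> real 1 * 1"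
        by (intro sum_le_const[OF fin weight_le]) auto
      then show ?thesis by simp
    next
      case 3
      have cr: "crossings u d \<ge> 2" if d: "d \<in> ?S" for d
        using d 3 src[of d] by (auto simp: ordinary_def)
      have dr: "deg u ?b \<le> 2 * r" by (rule ext_d(6)[OF e(1) lu])
      have "card ?S \<le> deg u ?b - 1" by (rule old) (use cr in fastforce)
      then have c: "card ?S \<le> 2 * r - 1" using dr by linarith
      have "sum (\<lambda>d. M powi (q u - 1 - q (u @ [d]))) ?S \<le> real (2 * r - 1) * (1 / M)"
      proof (rule sum_le_const[OF fin _ c])
        fix d assume "d \<in> ?S"
        then have "crossings u d \<ge> 2" by (rule cr)
        then show "M powi (q u - 1 - q (u @ [d])) \<le> 1 / M" by (simp add: weight)
      qed (use M in simp)
      also have "\<dots> \<le> 1" using M 3 dr by (simp add: of_nat_diff divide_le_eq)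
      finally show ?thesis .
    qed
    then show ?thesis by simp
  next
    case True
    show ?thesis unfolding not_not True by simp
  qed
  have spec: "(\<Sum>d\<in>{d \<in> ext u. \<not> ordinary u d}. M powi (q u - 1 - q (u @ [d]))) \<le>
      2 * real (card A) * (real t + 1)" if lu: "length u < t" for u
  proof -
    have "card {d \<in> ext u. \<not> ordinary u d} \<le> card (ext u)"
      by (rule card_mono) (auto simp: fin_ext(1)[OF lu])
    also have "\<dots> \<le> 2 * card A * (t + 1)" by (rule fin_ext(2)[OF lu])
    finally have "(\<Sum>d\<in>{d \<in> ext u. \<not> ordinary u d}. M powi (q u - 1 - q (u @ [d]))) \<le>
        real (2 * card A * (t + 1)) * 1"
      by (intro sum_le_const weight_le) (auto simp: fin_ext(1)[OF lu])
    then show ?thesis by (simp add: algebra_simps)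
  qed
  have "real (card L) \<le> (1 + real t * (2 * real (card A) * (real t + 1))) ^ (13 * r + 1) * M ^ t"
  proof (rule card_tree_le[where sp = "\<lambda>u d. \<not> ordinary u d" and q = q, OF finL])
    show "length z = t" if "z \<in> L" for z by (rule zw(3)[OF that])
    show "card {i. i < t \<and> \<not> ordinary (take i z) (z ! i)} \<le> 13 * r + 1" if "z \<in> L" for z
      using card_special_steps[OF zw(4,5,2)[OF that]] zw(3)[OF that] by simp
    show "q z = 0" if "z \<in> L" for z
    proof -
      have "crossings z d \<ge> 2" if "d \<in> set z" for d
        using zw(4)[OF \<open>z \<in> L\<close>] that by (simp add: covers_twice_def)
      then have none: "single_edges z = {}" by (force simp: single_edges_def)
      show ?thesis by (simp add: q_def none)
    qed
    show "q [] = 0" by (simp add: q_def single_edges_def)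
    show "(\<Sum>x\<in>{x \<in> {x. \<exists>z\<in>L. take (Suc (length u)) z = u @ [x]}. \<not> \<not> ordinary u x}. M powi (q u - 1 - q (u @ [x]))) \<le> 1"
      if "length u < t" for u using ord[OF that] unfolding ext_def .
    show "(\<Sum>x\<in>{x \<in> {x. \<exists>z\<in>L. take (Suc (length u)) z = u @ [x]}. \<not> ordinary u x}. M powi (q u - 1 - q (u @ [x]))) \<le>
      2 * real (card A) * (real t + 1)"
      if "length u < t" for u using spec[OF that] unfolding ext_def .
  qed (use M in auto)
  moreover have "card {w. cyc_reduced w \<and> fst ` set w \<subseteq> A \<and> length w = t \<and>
      (\<exists>(a :: 'v) z. map lab z = w \<and> covers_twice r a z)} \<le> card L"
  proof -
    have "{w. cyc_reduced w \<and> fst ` set w \<subseteq> A \<and> length w = t \<and>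
      (\<exists>(a :: 'v) z. map lab z = w \<and> covers_twice r a z)} \<subseteq> map lab ` L"
    proof
      fix w assume "w \<in> {w. cyc_reduced w \<and> fst ` set w \<subseteq> A \<and> length w = t \<and>
        (\<exists>(a :: 'v) z. map lab z = w \<and> covers_twice r a z)}"
      then obtain a :: 'v and z where w: "cyc_reduced w" "fst ` set w \<subseteq> A" "length w = t"
        "map lab z = w" "covers_twice r a z" by blast
      obtain z' where z': "map lab z' = w" "covers_twice r 0 z'" "canonical z'"
        using covers_twice_canonical[OF w(5)] w(4) by blast
      have "length z' = t" using z'(1) w(3) by (metis length_map)
      then have "z' \<in> L" using w z' by (simp add: L_def del: set_map)
      then show "w \<in> map lab ` L" using z'(1) by blast
    qed
    then show ?thesis using finL by (meson card_image_le card_mono finite_imageI le_trans)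
  qed
  ultimately show ?thesis by linarith
qed

section \<open>Words of bounded primitivity rank\<close>

lemma Inf_enat_le_enatE:
  assumes "Inf X \<le> enat r"
  obtains x where "x \<in> X" "x \<le> enat r"
  using assms that by (auto simp: Inf_enat_def split: if_splits) (metis LeastI)

lemma primitivity_rank_leE:
  assumes "primitivity_rank G w \<le> enat r"
  obtains J C where "subgroup J G" "w \<in> J" "\<not> primitive_in G J w" "is_basis G J C" "finite C" "card C \<le> r"
proof -
  obtain J where J: "subgroup J G" "w \<in> J" "\<not> primitive_in G J w" "free_rank G J \<le> enat r"
    using Inf_enat_le_enatE[OF assms[unfolded primitivity_rank_def]] by auto
  obtain C where "is_basis G J C" "ecard C \<le> enat r"
    using Inf_enat_le_enatE[OF J(4)[unfolded free_rank_def]] by auto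
  then show ?thesis using that[OF J(1-3)] by (auto simp: ecard_def split: if_splits)
qed

lemma reduced_map_inj:
  assumes "inj_on f (fst ` set z)"
  shows "reduced (map (\<lambda>(b, e). (f b, e)) z) \<longleftrightarrow> reduced z"
  using assms
proof (induction z)
  case (Cons x z)
  have "reduced (map (\<lambda>(b, e). (f b, e)) z) = reduced z" using Cons by (auto intro: inj_on_subset)
  then show ?case using Cons.prems
    by (cases z) (auto simp: reduced_Cons flip_def inj_on_def split: prod.splits)
qed simp

text \<open>The inverse of \<open>word_value\<close> is transported along \<open>f\<close>: pull an
  element back to \<open>J\<close>, write it over \<open>B\<close>, and rename the letters by
  \<open>f\<close>.\<close>

lemma is_basis_hom_image:
  assumes G: "group G" and J: "subgroup J G" and B: "is_basis G J B"
    and f: "f \<in> hom G G" "inj_on f (carrier G)"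
  shows "is_basis G (f ` J) (f ` B)"
proof -
  interpret group G by fact
  interpret f: group_hom G G f by unfold_locales (use f in auto)
  have BJ: "B \<subseteq> J" "J \<subseteq> carrier G" using B J subgroup.subset by (auto simp: is_basis_def)
  define F where "F = map (\<lambda>(b, e :: bool). (f b, e))"
  let ?\<kappa> = "the_inv_into (carrier (free_group B)) (word_value G)"
  have \<kappa>: "?\<kappa> (word_value G z) = z" if "z \<in> carrier (free_group B)" for z
    using basis_inj[OF B] that by (rule the_inv_into_f_f)
  have \<kappa>c: "?\<kappa> g \<in> carrier (free_group B)" "word_value G (?\<kappa> g) = g" if "g \<in> J" for g
    using basis_generates[OF B that] \<kappa> by metis+
  have inj: "inj_on f B" using f(2) BJ by (meson inj_on_subset subset_trans)
  have F_closed: "F z \<in> carrier (free_group (f ` B))" if "z \<in> carrier (free_group B)" for z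
    using that reduced_map_inj[OF inj_on_subset[OF inj], of z]
    by (auto simp: carrier_free_group F_def)
  have vF: "word_value G (F z) = f (word_value G z)" if "fst ` set z \<subseteq> carrier G" for z
    using that
  proof (induction z)
    case (Cons x z)
    then show ?case using word_value_closed[of z] by (cases x) (auto simp: F_def word_value_Cons)
  qed (simp add: F_def word_value_Nil)
  define finv where "finv = the_inv_into J f"
  have injJ: "inj_on f J" using f(2) BJ(2) by (rule inj_on_subset)
  have finv: "finv (f g) = g" if "g \<in> J" for g unfolding finv_def using injJ that by (rule the_inv_into_f_f)
  show ?thesis
  proof (rule is_basisI[OF G, where f = "\<lambda>h. F (?\<kappa> (finv h))"])
    show "subgroup (f ` J) G" by (rule f.subgroup_img_is_subgroup[OF J])
    show "f ` B \<subseteq> f ` J" using BJ by blast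
  next
    fix h assume "h \<in> f ` J"
    then obtain g where g: "g \<in> J" "h = f g" by blast
    show "F (?\<kappa> (finv h)) \<in> carrier (free_group (f ` B))" using F_closed[OF \<kappa>c(1)[OF g(1)]] finv g by simp
    have "fst ` set (?\<kappa> g) \<subseteq> carrier G" using \<kappa>c(1)[OF g(1)] BJ by (auto simp: carrier_free_group)
    then show "word_value G (F (?\<kappa> (finv h))) = h" using vF \<kappa>c(2)[OF g(1)] finv g by simp
  next
    fix y assume y: "y \<in> carrier (free_group (f ` B))"
    define z where "z = map (\<lambda>(b, e :: bool). (finv b, e)) y"
    have yl: "fst ` set y \<subseteq> f ` B" "reduced y" using y by (auto simp: carrier_free_group)
    have yz: "y = F z"
      using yl(1) BJ(1) finv unfolding F_def z_def by (induction y) (auto split: prod.splits)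
    have zB: "fst ` set z \<subseteq> B" using yl(1) BJ(1) finv unfolding z_def by force
    have zc: "z \<in> carrier (free_group B)"
      using reduced_map_inj[OF inj_on_subset[OF inj zB]] yl(2) zB
      by (simp add: carrier_free_group yz F_def)
    have "fst ` set z \<subseteq> carrier G" using zB BJ by blast
    then have "word_value G y = f (word_value G z)" using vF yz by simp
    then show "F (?\<kappa> (finv (word_value G y))) = y"
      using finv basis_word_value_closed[OF B zc] \<kappa>[OF zc] yz by simp
  qed
qed

text \<open>Conjugation is an automorphism: it pushes bases of \<open>J\<close> forward without
  enlarging them, and its inverse would pull back a basis that makes the conjugate of
  \<open>w\<close> primitive.\<close>

lemma primitivity_rank_conj_le:
  assumes G: "group G" and g: "g \<in> carrier G" and w: "w \<in> carrier G"
  shows "primitivity_rank G (g \<otimes>\<^bsub>G\<^esub> w \<otimes>\<^bsub>G\<^esub> inv\<^bsub>G\<^esub> g) \<le> primitivity_rank G w"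
proof -
  interpret group G by fact
  define c where "c h x = h \<otimes>\<^bsub>G\<^esub> x \<otimes>\<^bsub>G\<^esub> inv\<^bsub>G\<^esub> h" for h x
  have c_inv: "c (inv\<^bsub>G\<^esub> h) (c h x) = x" if "h \<in> carrier G" "x \<in> carrier G" for h x
    using that by (simp add: c_def m_assoc inv_solve_left) (simp add: m_assoc[symmetric])
  have c_hom: "c h \<in> hom G G" if h: "h \<in> carrier G" for h
  proof (rule homI)
    fix x y assume xy: "x \<in> carrier G" "y \<in> carrier G"
    then have "inv\<^bsub>G\<^esub> h \<otimes>\<^bsub>G\<^esub> (h \<otimes>\<^bsub>G\<^esub> (y \<otimes>\<^bsub>G\<^esub> inv\<^bsub>G\<^esub> h)) = y \<otimes>\<^bsub>G\<^esub> inv\<^bsub>G\<^esub> h"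
      using h by (simp add: m_assoc[symmetric])
    then show "c h (x \<otimes>\<^bsub>G\<^esub> y) = c h x \<otimes>\<^bsub>G\<^esub> c h y" using h xy by (simp add: c_def m_assoc)
  qed (use h in \<open>simp add: c_def\<close>)
  have c_inj: "inj_on (c h) (carrier G)" if "h \<in> carrier G" for h
    by (rule inj_on_inverseI) (rule c_inv[OF that])
  have "primitivity_rank G (c g w) \<le> free_rank G J"
    if J: "subgroup J G" "w \<in> J" "\<not> primitive_in G J w" for J
  proof -
    have JG: "J \<subseteq> carrier G" by (rule subgroup.subset[OF J(1)])
    interpret c: group_hom G G "c g" by unfold_locales (use c_hom[OF g] in auto)
    have cJ: "subgroup (c g ` J) G" by (rule c.subgroup_img_is_subgroup[OF J(1)])
    have "\<not> primitive_in G (c g ` J) (c g w)"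
    proof
      assume "primitive_in G (c g ` J) (c g w)"
      then obtain B where B: "is_basis G (c g ` J) B" "c g w \<in> B" by (auto simp: primitive_in_def)
      have ig: "inv\<^bsub>G\<^esub> g \<in> carrier G" using g by simp
      have "is_basis G (c (inv\<^bsub>G\<^esub> g) ` c g ` J) (c (inv\<^bsub>G\<^esub> g) ` B)"
        by (rule is_basis_hom_image[OF G cJ B(1) c_hom[OF ig] c_inj[OF ig]])
      moreover have "c (inv\<^bsub>G\<^esub> g) ` c g ` J = J"
      proof -
        have "c (inv\<^bsub>G\<^esub> g) ` c g ` J = (\<lambda>x. x) ` J"
          unfolding image_image by (rule image_cong[OF refl], rule c_inv[OF g]) (rule subsetD[OF JG])
        then show ?thesis by simp
      qed
      moreover have "w \<in> c (inv\<^bsub>G\<^esub> g) ` B" using B(2) c_inv[OF g w] by (metis imageI)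
      ultimately show False using J(3) by (auto simp: primitive_in_def)
    qed
    then have "primitivity_rank G (c g w) \<le> free_rank G (c g ` J)"
      unfolding primitivity_rank_def using cJ J(2) by (intro Inf_lower) blast
    also have "\<dots> \<le> free_rank G J"
      unfolding free_rank_def[of G J]
    proof (rule Inf_greatest, clarify)
      fix B assume B: "is_basis G J B"
      have "free_rank G (c g ` J) \<le> ecard (c g ` B)"
        unfolding free_rank_def
        using is_basis_hom_image[OF G J(1) B c_hom[OF g] c_inj[OF g]] by (intro Inf_lower) blast
      also have "\<dots> \<le> ecard B" by (simp add: ecard_def card_image_le)
      finally show "free_rank G (c g ` J) \<le> ecard B" .
    qed
    finally show ?thesis .
  qed
  then show ?thesis unfolding primitivity_rank_def[of G w] c_def by (intro Inf_greatest) blast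
qed

lemma primitivity_rank_conj:
  assumes g: "g \<in> carrier (free_group S)" and w: "w \<in> carrier (free_group S)"
  shows "primitivity_rank (free_group S) (g \<star> (w \<star> winv g)) = primitivity_rank (free_group S) w"
proof (rule antisym)
  have le: "primitivity_rank (free_group S) (g \<star> (w \<star> winv g)) \<le> primitivity_rank (free_group S) w"
    if g: "g \<in> carrier (free_group S)" and w: "w \<in> carrier (free_group S)" for g w
  proof -
    have "reduced (winv g)" using g by (simp add: carrier_free_group)
    then show ?thesis
      using primitivity_rank_conj_le[OF group_free_group g w] inv_free_group[OF g]
      by (simp add: mult_free_group wmult_assoc)
  qed
  show "primitivity_rank (free_group S) (g \<star> (w \<star> winv g)) \<le> primitivity_rank (free_group S) w"
    by (rule le[OF g w])
  have r: "reduced g" "reduced w" using g w by (auto simp: carrier_free_group)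
  have c: "g \<star> (w \<star> winv g) \<in> carrier (free_group S)" using g w by (intro wmult_closed winv_closed)
  have "winv g \<star> ((g \<star> (w \<star> winv g)) \<star> winv (winv g)) = w"
    using r by (simp add: wmult_assoc winv_wmult_cancel wmult_winv_left mult_Nil)
  then show "primitivity_rank (free_group S) w \<le> primitivity_rank (free_group S) (g \<star> (w \<star> winv g))"
    using le[OF winv_closed[OF g] c] by simp
qed

section \<open>Counting all words through their cyclic reductions\<close>

lemma cyclic_reduction:
  assumes "reduced w"
  obtains g c where "w = g @ c @ winv g" "cyc_reduced c"
  using assms
proof (induction "length w" arbitrary: w thesis rule: less_induct)
  case less
  show ?case
  proof (cases "cyc_reduced w")
    case True
    then show ?thesis using less.prems(1)[of "[]" w] by simp
  next
    case False
    then have w: "w \<noteq> []" "hd w = flip (last w)" using less.prems(2) by (auto simp: cyc_reduced_def)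
    obtain x v where v: "w = x # v" using w by (cases w) auto
    have "v \<noteq> []" using w v by auto
    then obtain u where u: "w = x # u @ [flip x]" using w v by (metis append_butlast_last_id flip_flip last_ConsR list.sel(1))
    have "reduced u" using less.prems(2) u by (simp add: reduced_Cons reduced_append)
    then obtain g c where "u = g @ c @ winv g" "cyc_reduced c" using less.hyps[of u] u by auto
    then show ?thesis using less.prems(1)[of "x # g" c] u by simp
  qed
qed

lemma finite_words: "finite A \<Longrightarrow> finite {w :: 'a word. P w \<and> fst ` set w \<subseteq> A \<and> length w = n}"
  by (rule finite_subset[OF _ finite_lists_length_eq[of "A \<times> UNIV" n]]) force+

lemma card_reduced_Cons:
  assumes "finite A" "fst x \<in> A"
  shows "card {w. reduced (x # w) \<and> fst ` set w \<subseteq> A \<and> length w = n} = (2 * card A - 1) ^ n"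
  using assms(2)
proof (induction n arbitrary: x)
  case 0
  have "{w. reduced (x # w) \<and> fst ` set w \<subseteq> A \<and> length w = 0} = {[]}" by (auto simp: reduced_Cons)
  then show ?case by simp
next
  case (Suc n)
  let ?S = "\<lambda>y n. {w. reduced (y # w) \<and> fst ` set w \<subseteq> A \<and> length w = n}"
  let ?Y = "A \<times> (UNIV :: bool set) - {flip x}"
  have "?S x (Suc n) = (\<Union>y\<in>?Y. (#) y ` ?S y n)"
  proof (intro equalityI subsetI)
    fix w assume w: "w \<in> ?S x (Suc n)"
    then obtain y v where "w = y # v" by (cases w) auto
    then show "w \<in> (\<Union>y\<in>?Y. (#) y ` ?S y n)" using w by (cases y) (auto simp: reduced_Cons)
  qed (auto simp: reduced_Cons image_subset_iff)
  moreover have "card (\<Union>y\<in>?Y. (#) y ` ?S y n) = (\<Sum>y\<in>?Y. card ((#) y ` ?S y n))"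
    by (rule card_UN_disjoint) (use assms(1) finite_words[OF assms(1)] in auto)
  moreover have "card ((#) y ` ?S y n) = (2 * card A - 1) ^ n" if "y \<in> ?Y" for y
    using Suc.IH[of y] that by (subst card_image) auto
  moreover have "card ?Y = 2 * card A - 1"
  proof -
    have "flip x \<in> A \<times> UNIV" using Suc.prems by (simp add: mem_Times_iff)
    then show ?thesis using assms(1) by (simp add: card_cartesian_product)
  qed
  ultimately show ?case by simp
qed

lemma card_reduced_Suc:
  assumes "finite A"
  shows "card {w. reduced w \<and> fst ` set w \<subseteq> A \<and> length w = Suc n} = 2 * card A * (2 * card A - 1) ^ n"
proof -
  let ?S = "\<lambda>y n. {w. reduced (y # w) \<and> fst ` set w \<subseteq> A \<and> length w = n}"
  let ?Y = "A \<times> (UNIV :: bool set)"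
  have "{w. reduced w \<and> fst ` set w \<subseteq> A \<and> length w = Suc n} = (\<Union>y\<in>?Y. (#) y ` ?S y n)"
  proof (intro equalityI subsetI)
    fix w assume w: "w \<in> {w. reduced w \<and> fst ` set w \<subseteq> A \<and> length w = Suc n}"
    then obtain y v where "w = y # v" by (cases w) auto
    then show "w \<in> (\<Union>y\<in>?Y. (#) y ` ?S y n)" using w by (cases y) auto
  qed (auto simp: reduced_Cons image_subset_iff)
  moreover have "card (\<Union>y\<in>?Y. (#) y ` ?S y n) = (\<Sum>y\<in>?Y. card ((#) y ` ?S y n))"
    by (rule card_UN_disjoint) (use assms(1) finite_words[OF assms(1)] in auto)
  moreover have "card ((#) y ` ?S y n) = (2 * card A - 1) ^ n" if "y \<in> ?Y" for y
    using card_reduced_Cons[OF assms, of y n] that by (subst card_image) auto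
  ultimately show ?thesis by (simp add: card_cartesian_product)
qed

lemma covers_twice_mono: "covers_twice r a z \<Longrightarrow> r \<le> s \<Longrightarrow> covers_twice s a z"
  by (auto simp: covers_twice_def)

text \<open>In a reduced word made of \<open>g\<close>, a cyclically reduced \<open>c\<close> and
  \<open>winv g\<close>, a prefix \<open>g\<close> of length \<open>s\<close> has at most
  \<open>2 * a * (2 * a - 1) ^ s \<le> 2 * a * M ^ (2 * s)\<close> choices, where
  \<open>2 * s\<close> is the length used by \<open>g\<close> and its inverse. So only the factor
  \<open>2 * a\<close> and the at most \<open>t + 1\<close> values of \<open>s\<close> are lost.
  Letters are restricted to \<open>A\<close> while ranks are taken in \<open>free_group S\<close>:
  the lower bound uses this for the first \<open>m\<close> generators inside
  \<open>Fk k\<close>.\<close>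

lemma card_primitivity_rank_le:
  fixes A S :: "'a set" and M :: real
  assumes A: "finite A" "A \<subseteq> S" and M: "M \<ge> 1" "M\<^sup>2 \<ge> 2 * real (card A) - 1" "M \<ge> 2 * real r - 1"
    and t: "t > 0"
  shows "real (card {w. reduced w \<and> fst ` set w \<subseteq> A \<and> length w = t \<and> primitivity_rank (free_group S) w \<le> enat r}) \<le>
    2 * real (card A) * real (t + 1) * (1 + real t * (2 * real (card A) * (real t + 1))) ^ (13 * r + 1) * M ^ t"
proof (cases "A = {}")
  case True
  then have "{w. reduced w \<and> fst ` set w \<subseteq> A \<and> length w = t \<and> primitivity_rank (free_group S) w \<le> enat r} = {}"
    using t by auto
  then show ?thesis using True by simp
next
  case False
  define a where "a = real (card A)"
  have a: "a \<ge> 1" using False A by (simp add: a_def Suc_le_eq card_gt_0_iff)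
  let ?W = "{w. reduced w \<and> fst ` set w \<subseteq> A \<and> length w = t \<and> primitivity_rank (free_group S) w \<le> enat r}"
  let ?R = "\<lambda>n. {w. reduced w \<and> fst ` set w \<subseteq> A \<and> length w = n}"
  let ?C = "\<lambda>n. {w. cyc_reduced w \<and> fst ` set w \<subseteq> A \<and> length w = n \<and>
      (\<exists>(b :: 'a word set) z. map lab z = w \<and> covers_twice r b z)}"
  define P where "P n = (1 + real n * (2 * a * (real n + 1))) ^ (13 * r + 1)" for n
  let ?I = "{s. 2 * s < t}"
  have finI: "finite ?I" by (rule finite_subset[of _ "{..t}"]) auto
  have "?I \<subseteq> {..t}" by auto
  then have cardI: "card ?I \<le> t + 1" using card_mono[of "{..t}" ?I] by simp
  have finC: "finite (?C n)" for n using finite_words[OF A(1), of cyc_reduced n] by (rule rev_finite_subset) auto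
  have finR: "finite (?R n)" for n by (rule finite_words[OF A(1)])
  have "?W \<subseteq> (\<Union>s\<in>?I. (\<lambda>(g, c). g @ c @ winv g) ` (?R s \<times> ?C (t - 2 * s)))"
  proof
    fix w assume "w \<in> ?W"
    then have w: "reduced w" "fst ` set w \<subseteq> A" "length w = t" "primitivity_rank (free_group S) w \<le> enat r" by auto
    obtain g c where gc: "w = g @ c @ winv g" "cyc_reduced c" using cyclic_reduction[OF w(1)] by metis
    have c: "reduced c" "fst ` set c \<subseteq> A" "reduced g" "fst ` set g \<subseteq> A"
      using w(1,2) by (auto simp: gc(1) reduced_append)
    \<comment> \<open>This makes \<open>2 * s < t\<close>, so that the bound for cyclically reduced
      words is applied to a positive length.\<close>
    have "c \<noteq> []"
    proof
      assume c0: "c = []"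
      show False
      proof (cases "g = []")
        case True
        then show ?thesis using c0 gc w t by simp
      next
        case False
        then have "hd (winv g) = flip (last g)" by (simp add: winv_def hd_rev last_map)
        then show ?thesis using w(1) c0 False by (simp add: gc(1) reduced_append winv_def)
      qed
    qed
    have cc: "c \<in> carrier (free_group S)" "g \<in> carrier (free_group S)"
      using c A(2) by (auto simp: carrier_free_group)
    have "w = g \<star> (c \<star> winv g)"
      using wmult_reduced_append[of g "c @ winv g"] wmult_reduced_append[of c "winv g"] w(1)
      by (simp add: gc(1) reduced_append)
    then have "primitivity_rank (free_group S) c \<le> enat r" using primitivity_rank_conj[OF cc(2,1)] w(4) by simp
    then obtain J C where JC: "subgroup J (free_group S)" "c \<in> J" "\<not> primitive_in (free_group S) J c"
      "is_basis (free_group S) J C" "finite C" "card C \<le> r" by (rule primitivity_rank_leE)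
    obtain b and z :: "('a word set, 'a) dart list" where z: "map lab z = c" "covers_twice (card C) b z"
      using nonprimitive_covers_twice[OF JC(1-5)] by blast
    have "covers_twice r b z" by (rule covers_twice_mono[OF z(2) JC(6)])
    then have "\<exists>(b :: 'a word set) z. map lab z = c \<and> covers_twice r b z" using z(1) by blast
    moreover have len: "t = 2 * length g + length c" using w(3) by (simp add: gc(1))
    ultimately have "(g, c) \<in> ?R (length g) \<times> ?C (t - 2 * length g)" using c gc(2) by simp
    moreover have "length g \<in> ?I" using len \<open>c \<noteq> []\<close> by simp
    ultimately show "w \<in> (\<Union>s\<in>?I. (\<lambda>(g, c). g @ c @ winv g) ` (?R s \<times> ?C (t - 2 * s)))"
      unfolding gc(1) by (intro UN_I[of "length g"]) (auto intro!: image_eqI[of _ _ "(g, c)"])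
  qed
  then have "card ?W \<le> card (\<Union>s\<in>?I. (\<lambda>(g, c). g @ c @ winv g) ` (?R s \<times> ?C (t - 2 * s)))"
    by (rule card_mono[rotated]) (intro finite_UN_I finI finite_imageI finite_cartesian_product finR finC)
  also have "\<dots> \<le> (\<Sum>s\<in>?I. card ((\<lambda>(g, c). g @ c @ winv g) ` (?R s \<times> ?C (t - 2 * s))))"
    by (rule card_UN_le[OF finI])
  also have "\<dots> \<le> (\<Sum>s\<in>?I. card (?R s) * card (?C (t - 2 * s)))"
  proof (rule sum_mono)
    fix s
    have "card ((\<lambda>(g, c). g @ c @ winv g) ` (?R s \<times> ?C (t - 2 * s))) \<le> card (?R s \<times> ?C (t - 2 * s))"
      by (rule card_image_le) (intro finite_cartesian_product finR finC)
    then show "card ((\<lambda>(g, c). g @ c @ winv g) ` (?R s \<times> ?C (t - 2 * s))) \<le> card (?R s) * card (?C (t - 2 * s))"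
      by (simp only: card_cartesian_product)
  qed
  finally have "real (card ?W) \<le> real (\<Sum>s\<in>?I. card (?R s) * card (?C (t - 2 * s)))"
    by (simp only: of_nat_le_iff)
  also have "\<dots> = (\<Sum>s\<in>?I. real (card (?R s)) * real (card (?C (t - 2 * s))))" by (simp only: of_nat_sum of_nat_mult)
  also have "\<dots> \<le> (\<Sum>s\<in>?I. 2 * a * P t * M ^ t)"
  proof (rule sum_mono)
    fix s assume "s \<in> ?I"
    then have s: "2 * s < t" by simp
    have a1: "real (2 * card A - 1) = 2 * a - 1" "2 * a - 1 \<ge> 1" using a by (auto simp: a_def of_nat_diff)
    have "real (card (?R s)) \<le> 2 * a * (2 * a - 1) ^ s"
    proof (cases s)
      case 0
      have "?R 0 = {[]}" by auto
      then show ?thesis using a 0 by simp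
    next
      case (Suc n)
      have "real (card (?R s)) = 2 * a * (2 * a - 1) ^ n"
        unfolding Suc card_reduced_Suc[OF A(1)] by (simp only: of_nat_mult of_nat_power a1) (simp add: a_def)
      also have "\<dots> \<le> 2 * a * (2 * a - 1) ^ s"
        using a a1(2) Suc by (intro mult_left_mono power_increasing) auto
      finally show ?thesis .
    qed
    also have "\<dots> \<le> 2 * a * (M\<^sup>2) ^ s"
      using a a1(2) M(2) by (intro mult_left_mono power_mono) (auto simp: a_def)
    finally have R: "real (card (?R s)) \<le> 2 * a * M ^ (2 * s)" by (simp only: power_mult)
    have "real (card (?C (t - 2 * s))) \<le> P (t - 2 * s) * M ^ (t - 2 * s)"
      unfolding P_def a_def by (rule card_cyc_reduced_covers_twice[OF A(1) M]) (use s in simp)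
    also have "\<dots> \<le> P t * M ^ (t - 2 * s)"
      unfolding P_def using a M(1)
      by (intro mult_right_mono power_mono add_mono mult_mono order_refl) auto
    finally have C: "real (card (?C (t - 2 * s))) \<le> P t * M ^ (t - 2 * s)" .
    have "real (card (?R s)) * real (card (?C (t - 2 * s))) \<le> (2 * a * M ^ (2 * s)) * (P t * M ^ (t - 2 * s))"
      using R C a M(1) by (intro mult_mono) auto
    also have "\<dots> = 2 * a * P t * (M ^ (2 * s) * M ^ (t - 2 * s))" by (simp only: ac_simps)
    also have "M ^ (2 * s) * M ^ (t - 2 * s) = M ^ t" using s by (simp flip: power_add)
    finally show "real (card (?R s)) * real (card (?C (t - 2 * s))) \<le> 2 * a * P t * M ^ t" .
  qed
  also have "\<dots> = real (card ?I) * (2 * a * P t * M ^ t)" by simp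
  also have "\<dots> \<le> real (t + 1) * (2 * a * P t * M ^ t)"
    using cardI a M(1) by (intro mult_right_mono) (auto simp: P_def)
  finally show ?thesis unfolding P_def a_def by (simp only: ac_simps)
qed

section \<open>Even words\<close>

lemma word_value_subalphabet:
  assumes "A \<subseteq> S" "fst ` set z \<subseteq> carrier (free_group A)"
  shows "word_value (free_group S) z = word_value (free_group A) z"
  using assms(2)
proof (induction z)
  case Nil
  then show ?case by (simp add: word_value_Nil one_free_group)
next
  case (Cons x z)
  have "fst x \<in> carrier (free_group A)" "fst x \<in> carrier (free_group S)"
    using Cons.prems assms(1) by (auto simp: carrier_free_group)
  then show ?case
    using Cons by (cases x) (auto simp: word_value_Cons mult_free_group inv_free_group)
qed

lemma subgroup_subalphabet:
  assumes "A \<subseteq> S"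
  shows "subgroup (carrier (free_group A)) (free_group S)"
proof (rule group.subgroupI[OF group_free_group])
  show sub: "carrier (free_group A) \<subseteq> carrier (free_group S)" using assms by (auto simp: carrier_free_group)
  show "carrier (free_group A) \<noteq> {}" by (auto simp: carrier_free_group intro!: exI[of _ "[]"])
  fix u assume u: "u \<in> carrier (free_group A)"
  show "inv\<^bsub>free_group S\<^esub> u \<in> carrier (free_group A)"
    using winv_closed[OF u] inv_free_group[OF subsetD[OF sub u]] by simp
  fix v assume v: "v \<in> carrier (free_group A)"
  show "u \<otimes>\<^bsub>free_group S\<^esub> v \<in> carrier (free_group A)"
    using wmult_closed[OF u v] by (simp add: mult_free_group)
qed

lemma is_basis_subalphabet:
  assumes "A \<subseteq> S"
  shows "is_basis (free_group S) (carrier (free_group A)) ((\<lambda>a. [(a, True)]) ` A)"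
proof -
  let ?B = "(\<lambda>a. [(a, True)]) ` A"
  let ?\<kappa> = "the_inv_into (carrier (free_group ?B)) (word_value (free_group A))"
  note B = is_basis_gens[of A]
  have Bc: "?B \<subseteq> carrier (free_group A)" using B by (simp add: is_basis_def)
  have eq: "word_value (free_group S) z = word_value (free_group A) z" if "z \<in> carrier (free_group ?B)" for z
    using that by (intro word_value_subalphabet[OF assms] subset_trans[OF _ Bc]) (simp add: carrier_free_group)
  have \<kappa>: "?\<kappa> (word_value (free_group A) z) = z" if "z \<in> carrier (free_group ?B)" for z
    using basis_inj[OF B] that by (rule the_inv_into_f_f)
  have \<kappa>c: "?\<kappa> g \<in> carrier (free_group ?B)" "word_value (free_group A) (?\<kappa> g) = g"
    if g: "g \<in> carrier (free_group A)" for g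
  proof -
    obtain z where "z \<in> carrier (free_group ?B)" "word_value (free_group A) z = g"
      using basis_generates[OF B g] by blast
    then show "?\<kappa> g \<in> carrier (free_group ?B)" "word_value (free_group A) (?\<kappa> g) = g"
      using \<kappa>[of z] by auto
  qed
  show ?thesis
  proof (rule is_basisI[OF group_free_group subgroup_subalphabet[OF assms] Bc])
    show "?\<kappa> g \<in> carrier (free_group ?B)" if "g \<in> carrier (free_group A)" for g by (rule \<kappa>c(1)[OF that])
    show "word_value (free_group S) (?\<kappa> g) = g" if "g \<in> carrier (free_group A)" for g
      using eq[OF \<kappa>c(1)[OF that]] \<kappa>c(2)[OF that] by simp
    show "?\<kappa> (word_value (free_group S) z) = z" if "z \<in> carrier (free_group ?B)" for z
      using eq[OF that] \<kappa>[OF that] by simp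
  qed
qed

definition even_word :: "'a word \<Rightarrow> bool" where
  "even_word w \<longleftrightarrow> (\<forall>a. even (length (filter (\<lambda>x. fst x = a) w)))"

lemma even_word_filter:
  assumes "even_word w"
  shows "even (length (filter (\<lambda>x. P (fst x)) w))"
proof -
  let ?T = "{a \<in> fst ` set w. P a}"
  have "length (filter (\<lambda>x. P (fst x)) w) = (\<Sum>a\<in>?T. length (filter (\<lambda>x. fst x = a) w))"
  proof -
    have "length (filter (\<lambda>x. P (fst x)) w) = (\<Sum>a\<in>T. length (filter (\<lambda>x. fst x = a \<and> P a) w))"
      if "finite T" "fst ` set w \<subseteq> T" for T
      using that(2)
    proof (induction w)
      case (Cons x w)
      have "(\<Sum>a\<in>T. length (filter (\<lambda>x. fst x = a \<and> P a) (x # w))) =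
          (\<Sum>a\<in>T. (if a = fst x then (if P (fst x) then 1 else 0) else 0) + length (filter (\<lambda>x. fst x = a \<and> P a) w))"
        by (rule sum.cong) auto
      also have "\<dots> = (if P (fst x) then 1 else 0) + (\<Sum>a\<in>T. length (filter (\<lambda>x. fst x = a \<and> P a) w))"
        using Cons.prems \<open>finite T\<close> by (simp add: sum.distrib)
      finally show ?case using Cons by simp
    qed simp
    then have "length (filter (\<lambda>x. P (fst x)) w) = (\<Sum>a\<in>fst ` set w. length (filter (\<lambda>x. fst x = a \<and> P a) w))"
      by blast
    also have "\<dots> = (\<Sum>a\<in>?T. length (filter (\<lambda>x. fst x = a) w))"
      by (rule sum.mono_neutral_cong_right) (auto intro: arg_cong[of _ _ length])
    finally show ?thesis .
  qed
  then show ?thesis using assms by (auto simp: even_word_def intro!: dvd_sum)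
qed

lemma even_word_not_primitive:
  assumes A: "A \<subseteq> S" and w: "w \<in> carrier (free_group A)" "even_word w"
  shows "\<not> primitive_in (free_group S) (carrier (free_group A)) w"
proof
  let ?J = "carrier (free_group A)" and ?G = "free_group S"
  assume "primitive_in ?G ?J w"
  then obtain B where B: "is_basis ?G ?J B" "w \<in> B" by (auto simp: primitive_in_def)
  note J = subgroup_subalphabet[OF A]
  obtain f where f: "parity_hom ?G ?J f" "\<And>b. b \<in> B \<Longrightarrow> f b \<longleftrightarrow> b \<in> B"
    using basis_parity_hom[OF group_free_group subgroup.subset[OF J] B(1)] by metis
  have one: "\<not> f []" using parity_hom_one[OF group_free_group J f(1)] by (simp add: one_free_group)
  have letter: "f [x] = f [(fst x, True)]" if "fst x \<in> A" for x
  proof -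
    have l: "[(fst x, True)] \<in> ?J" "[(fst x, True)] \<in> carrier ?G"
      using that A by (auto simp: carrier_free_group reduced_Cons)
    have "f [(fst x, False)] = f [(fst x, True)]"
      using parity_hom_inv[OF group_free_group J f(1) l(1)] inv_free_group[OF l(2)]
      by (simp add: flip_def)
    then show ?thesis by (cases x, cases "snd x") simp_all
  qed
  \<comment> \<open>On \<open>?J\<close> a parity homomorphism counts, modulo 2, the letters on
    whose generators it is \<open>True\<close>; signs do not affect it.\<close>
  have "f v \<longleftrightarrow> odd (length (filter (\<lambda>x. f [(fst x, True)]) v))" if "v \<in> ?J" for v
    using that
  proof (induction v)
    case Nil
    then show ?case by (simp add: one)
  next
    case (Cons x v)
    have v: "v \<in> ?J" "[x] \<in> ?J" "fst x \<in> A" using Cons.prems by (auto simp: carrier_free_group reduced_Cons)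
    have "[x] \<star> v = x # v"
      using wmult_reduced_append[of "[x]" v] Cons.prems by (simp add: carrier_free_group)
    moreover have "f ([x] \<otimes>\<^bsub>?G\<^esub> v) \<longleftrightarrow> f [x] \<noteq> f v"
      using f(1) v(1,2) unfolding parity_hom_def by blast
    ultimately have "f (x # v) \<longleftrightarrow> f [x] \<noteq> f v" by (simp only: mult_free_group)
    then show ?case using Cons.IH[OF v(1)] letter[OF v(3)] by simp
  qed
  then have "f w \<longleftrightarrow> odd (length (filter (\<lambda>x. f [(fst x, True)]) w))" using w(1) by blast
  then have "\<not> f w" using even_word_filter[OF w(2), of "\<lambda>a. f [(a, True)]"] by simp
  then show False using f(2) B(2) by blast
qed

lemma primitivity_rank_even_word_le:
  assumes A: "A \<subseteq> S" "finite A" and w: "w \<in> carrier (free_group A)" "even_word w"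
  shows "primitivity_rank (free_group S) w \<le> enat (card A)"
proof -
  let ?B = "(\<lambda>a. [(a, True)]) ` A"
  have "primitivity_rank (free_group S) w \<le> free_rank (free_group S) (carrier (free_group A))"
    unfolding primitivity_rank_def
    using subgroup_subalphabet[OF A(1)] w even_word_not_primitive[OF A(1) w] by (intro Inf_lower) blast
  also have "\<dots> \<le> ecard ?B"
    unfolding free_rank_def using is_basis_subalphabet[OF A(1)] by (intro Inf_lower) blast
  also have "ecard ?B = enat (card A)" using A by (simp add: ecard_def card_image inj_on_def)
  finally show ?thesis .
qed

lemma primitivity_rank_pos:
  assumes "w \<noteq> []"
  shows "\<not> primitivity_rank (free_group S) w \<le> enat 0"
proof
  assume "primitivity_rank (free_group S) w \<le> enat 0"
  then obtain J C where JC: "w \<in> J" "is_basis (free_group S) J C" "finite C" "card C \<le> 0"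
    by (rule primitivity_rank_leE)
  then obtain z where z: "z \<in> carrier (free_group C)" "word_value (free_group S) z = w"
    using basis_generates by metis
  have "z = []" using z(1) JC(3,4) by (simp add: carrier_free_group)
  then show False using z(2) assms by (simp add: word_value_Nil one_free_group)
qed

lemma reduced_if_distinct_letters: "distinct (map fst v) \<Longrightarrow> reduced v"
proof (induction v)
  case (Cons x v)
  then show ?case by (cases v) (auto simp: reduced_Cons flip_def)
qed simp

text \<open>Each generator with an odd count is appended once. If the generator of the last letter
  is among them, that letter comes first and is repeated with its own sign, so nothing cancels; at
  all other junctions the generators differ.\<close>

lemma exists_even_extension:
  assumes A: "finite A" and w: "reduced w" "fst ` set w \<subseteq> A" "w \<noteq> []"
  obtains v where "reduced (w @ v)" "fst ` set v \<subseteq> A" "length v \<le> card A" "even_word (w @ v)"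
proof -
  define x where "x = last w"
  define odds where "odds = {a \<in> A. odd (length (filter (\<lambda>y. fst y = a) w))}"
  have fin: "finite odds" using A by (simp add: odds_def)
  obtain l where l: "set l = odds - {fst x}" "distinct l"
    using finite_distinct_list[of "odds - {fst x}"] fin by blast
  define v where "v = (if fst x \<in> odds then [x] else []) @ map (\<lambda>a. (a, True)) l"
  have fv: "map fst v = (if fst x \<in> odds then [fst x] else []) @ l"
    by (simp add: v_def comp_def)
  have dv: "distinct (map fst v)" "set (map fst v) = odds" unfolding fv using l by auto
  have "hd v \<noteq> flip (last w)" if "v \<noteq> []"
  proof (cases "fst x \<in> odds")
    case False
    then have "fst (hd v) \<in> set l" using that by (cases l) (auto simp: v_def)
    then have "fst (hd v) \<noteq> fst (flip x)" using l by auto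
    then show ?thesis by (auto simp: x_def)
  qed (simp add: v_def x_def)
  then have r: "reduced (w @ v)"
    using w reduced_if_distinct_letters[OF dv(1)] by (simp add: reduced_append)
  have "length v = card odds" using distinct_card[OF dv(1)] dv(2) by simp
  also have "\<dots> \<le> card A" using A by (intro card_mono) (auto simp: odds_def)
  finally have lv: "length v \<le> card A" .
  have vA: "fst ` set v \<subseteq> A" using dv(2) by (auto simp: odds_def)
  have "even (length (filter (\<lambda>y. fst y = a) (w @ v)))" for a
  proof -
    have "length (filter (\<lambda>y. fst y = a) u) = (if a \<in> set (map fst u) then 1 else 0)"
      if "distinct (map fst u)" for u :: "'a word"
      using that by (induction u) (auto simp: filter_empty_conv, metis fst_conv)
    then have c: "length (filter (\<lambda>y. fst y = a) v) = (if a \<in> odds then 1 else 0)"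
      using dv by metis
    show ?thesis
    proof (cases "a \<in> A")
      case True
      then show ?thesis using c by (auto simp: odds_def)
    next
      case False
      then have "filter (\<lambda>y. fst y = a) w = []" using w(2) by (auto simp: filter_empty_conv)
      then show ?thesis using c False by (simp add: odds_def)
    qed
  qed
  then show ?thesis using that[OF r vA lv] by (simp only: even_word_def) blast
qed

text \<open>Evenness is repaired by at most \<open>m\<close> appended letters, and
  \<open>take n\<close> recovers the original word. How many letters are appended depends on the
  word, hence a window of lengths instead of a single one.\<close>

lemma card_even_words_ge:
  assumes A: "finite A" "card A = m" "m \<ge> 1" and n: "n \<ge> 1"
  shows "(2 * m - 1) ^ n \<le> (\<Sum>t=n..n+m. card {w. (reduced w \<and> even_word w) \<and> fst ` set w \<subseteq> A \<and> length w = t})"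
proof -
  let ?N = "{w. reduced w \<and> fst ` set w \<subseteq> A \<and> length w = n}"
  let ?E = "\<lambda>t. {w. (reduced w \<and> even_word w) \<and> fst ` set w \<subseteq> A \<and> length w = t}"
  have "\<exists>v. reduced (w @ v) \<and> fst ` set v \<subseteq> A \<and> length v \<le> card A \<and> even_word (w @ v)" if "w \<in> ?N" for w
  proof -
    have w: "reduced w" "fst ` set w \<subseteq> A" "w \<noteq> []" using that n by auto
    show ?thesis by (rule exists_even_extension[OF A(1) w]) blast
  qed
  then have "\<forall>w\<in>?N. \<exists>v. reduced (w @ v) \<and> fst ` set v \<subseteq> A \<and> length v \<le> card A \<and> even_word (w @ v)"
    by (rule ballI)
  from bchoice[OF this] obtain h where hall: "\<forall>w\<in>?N. reduced (w @ h w) \<and>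
      fst ` set (h w) \<subseteq> A \<and> length (h w) \<le> card A \<and> even_word (w @ h w)" by (elim exE)
  note h = bspec[OF hall]
  obtain n' where n': "n = Suc n'" using n by (cases n) auto
  have "(2 * m - 1) ^ n \<le> 2 * m * (2 * m - 1) ^ n'" unfolding n' by (simp add: mult_right_mono)
  also have "\<dots> = card ?N" using card_reduced_Suc[OF A(1), of n'] A(2) by (simp add: n')
  also have "\<dots> \<le> card (\<Union>t\<in>{n..n+m}. ?E t)"
  proof (rule card_inj_on_le)
    show "inj_on (\<lambda>w. w @ h w) ?N"
      by (rule inj_on_inverseI[of _ "take n"]) auto
    show "(\<lambda>w. w @ h w) ` ?N \<subseteq> (\<Union>t\<in>{n..n+m}. ?E t)"
    proof (rule image_subsetI)
      fix w assume w: "w \<in> ?N"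
      show "w @ h w \<in> (\<Union>t\<in>{n..n+m}. ?E t)"
        by (rule UN_I[of "length (w @ h w)"]) (use w h[OF w] A(2) in auto)
    qed
    show "finite (\<Union>t\<in>{n..n+m}. ?E t)" by (intro finite_UN_I finite_words A) simp
  qed
  also have "\<dots> \<le> (\<Sum>t=n..n+m. card (?E t))" by (rule card_UN_le) simp
  finally show ?thesis .
qed

section \<open>Growth rates\<close>

lemma limsup_root_le:
  fixes f :: "nat \<Rightarrow> real"
  assumes C: "C > 0" and M: "M \<ge> 0" and f: "\<And>t. t > 0 \<Longrightarrow> f t \<le> C * real t ^ d * M ^ t"
  shows "limsup (\<lambda>t. ereal (root t (f t))) \<le> ereal M"
proof -
  let ?g = "\<lambda>t. root t C * root t (real t) ^ d * M"
  have "?g \<longlonglongrightarrow> 1 * 1 ^ d * M"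
    by (intro tendsto_intros LIMSEQ_root LIMSEQ_root_const C)
  then have "(\<lambda>t. ereal (?g t)) \<longlonglongrightarrow> ereal M" by simp
  then have "limsup (\<lambda>t. ereal (?g t)) = ereal M"
    by (intro lim_imp_Limsup) auto
  moreover have "limsup (\<lambda>t. ereal (root t (f t))) \<le> limsup (\<lambda>t. ereal (?g t))"
  proof (rule Limsup_mono, rule eventually_mono[OF eventually_gt_at_top[of 0]])
    fix t :: nat assume t: "0 < t"
    have "root t (f t) \<le> root t (C * real t ^ d * M ^ t)" using t f[OF t] by simp
    also have "\<dots> = ?g t" using t M by (simp add: real_root_mult real_root_power real_root_power_cancel)
    finally show "ereal (root t (f t)) \<le> ereal (?g t)" by simp
  qed
  ultimately show ?thesis by simp
qed

lemma limsup_root_ge: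
  fixes f :: "nat \<Rightarrow> real"
  assumes c: "c > 0" and M: "M \<ge> 0" and f: "\<And>n. \<exists>t\<ge>n. c * M ^ t \<le> f t"
  shows "ereal M \<le> limsup (\<lambda>t. ereal (root t (f t)))"
proof (rule ccontr)
  assume "\<not> ereal M \<le> limsup (\<lambda>t. ereal (root t (f t)))"
  then have "limsup (\<lambda>t. ereal (root t (f t))) < ereal M" by (simp only: not_le)
  from ereal_dense2[OF this] obtain y where y: "limsup (\<lambda>t. ereal (root t (f t))) < ereal y" "y < M"
    by auto
  have "eventually (\<lambda>t. ereal (root t (f t)) < ereal y) sequentially"
    using y(1) by (rule Limsup_lessD)
  moreover have "(\<lambda>t. root t c * M) \<longlonglongrightarrow> 1 * M"
    by (intro tendsto_intros LIMSEQ_root_const c)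
  then have "eventually (\<lambda>t. root t c * M > y) sequentially"
    using y(2) by (intro order_tendstoD(1)) auto
  ultimately have "eventually (\<lambda>t. root t (f t) < root t c * M \<and> t > 0) sequentially"
    using eventually_gt_at_top[of "0::nat"] by eventually_elim auto
  then obtain n where n: "\<And>t. t \<ge> n \<Longrightarrow> root t (f t) < root t c * M \<and> t > 0"
    by (auto simp: eventually_at_top_linorder)
  obtain t where t: "t \<ge> n" "c * M ^ t \<le> f t" using f by blast
  then have "root t c * M \<le> root t (f t)"
    using n[OF t(1)] M by (metis real_root_le_mono real_root_mult real_root_power_cancel)
  then show False using n[OF t(1)] by simp
qed

lemma poly_times_power_tendsto_0:
  fixes q :: real
  assumes "0 \<le> q" "q < 1" "d > 0"
  shows "(\<lambda>t. real t ^ d * q ^ t) \<longlonglongrightarrow> 0"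
proof -
  define p where "p = root d q"
  have p: "0 \<le> p" "p < 1" "p ^ d = q" using assms by (auto simp: p_def)
  have "(\<lambda>t. real t * p ^ t) \<longlonglongrightarrow> 0" using powser_times_n_limit_0[of p] p by simp
  then have "(\<lambda>t. (real t * p ^ t) ^ d) \<longlonglongrightarrow> 0 ^ d" by (rule tendsto_power)
  moreover have "(real t * p ^ t) ^ d = real t ^ d * q ^ t" for t
    using p(3) by (simp add: power_mult_distrib power_commutes flip: power_mult) (simp add: mult.commute power_mult)
  ultimately show ?thesis using assms(3) by (simp add: zero_power)
qed

lemma card_primitivity_rank_le_poly:
  fixes A S :: "'a set" and M :: real
  assumes A: "finite A" "A \<subseteq> S" "A \<noteq> {}" and M: "M \<ge> 1" "M\<^sup>2 \<ge> 2 * real (card A) - 1" "M \<ge> 2 * real r - 1"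
  shows "\<exists>C>0. \<exists>d>0. \<forall>t>0. real (card {w. reduced w \<and> fst ` set w \<subseteq> A \<and> length w = t \<and>
    primitivity_rank (free_group S) w \<le> enat r}) \<le> C * real t ^ d * M ^ t"
proof -
  define a where "a = real (card A)"
  have a: "a \<ge> 1" using A by (simp add: a_def Suc_le_eq card_gt_0_iff)
  define e where "e = 13 * r + 1"
  \<comment> \<open>\<open>4 * a\<close> combines \<open>2 * a\<close> with
    \<open>t + 1 \<le> 2 * t\<close>. The base \<open>1 + 4 * a\<close> comes from bounding the
    quadratic factor by \<open>(1 + 4 * a) * t ^ 2\<close>, which also gives the degree
    \<open>2 * e + 1\<close>.\<close>
  define C where "C = 4 * a * (1 + 4 * a) ^ e"
  have C: "C > 0" using a by (simp add: C_def)
  have "real (card {w. reduced w \<and> fst ` set w \<subseteq> A \<and> length w = t \<and>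
    primitivity_rank (free_group S) w \<le> enat r}) \<le> C * real t ^ (2 * e + 1) * M ^ t" if t: "t > 0" for t
  proof -
    have t1: "real t \<ge> 1" using t by simp
    have "1 + real t * (2 * a * (real t + 1)) \<le> real t ^ 2 + real t * (2 * a * (2 * real t))"
      using t1 a by (intro add_mono mult_left_mono) (auto simp: one_le_power)
    also have "\<dots> = (1 + 4 * a) * real t ^ 2" by (simp add: algebra_simps power2_eq_square)
    finally have p: "1 + real t * (2 * a * (real t + 1)) \<le> (1 + 4 * a) * real t ^ 2" .
    have "real (card {w. reduced w \<and> fst ` set w \<subseteq> A \<and> length w = t \<and> primitivity_rank (free_group S) w \<le> enat r}) \<le>
      2 * a * real (t + 1) * (1 + real t * (2 * a * (real t + 1))) ^ e * M ^ t"
      unfolding a_def e_def by (rule card_primitivity_rank_le[OF A(1,2) M t])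
    also have "\<dots> \<le> 2 * a * (2 * real t) * ((1 + 4 * a) * real t ^ 2) ^ e * M ^ t"
      using t1 a M(1) p by (intro mult_mono power_mono mult_nonneg_nonneg) auto
    also have "\<dots> = C * real t ^ (2 * e + 1) * M ^ t"
      by (simp add: C_def power_mult_distrib power_mult[symmetric] power_add ac_simps)
    finally show ?thesis .
  qed
  then show ?thesis using C by (intro exI[of _ C] conjI exI[of _ "2 * e + 1"]) auto
qed

lemma primitivity_rank_count_eq:
  "primitivity_rank_count k m t =
    card {w. reduced w \<and> fst ` set w \<subseteq> {1..k} \<and> length w = t \<and> primitivity_rank (Fk k) w = enat m}"
  unfolding primitivity_rank_count_def by (rule arg_cong[of _ _ card]) (auto simp: carrier_free_group)

text \<open>The words that supply the bound are even, hence of even length, and are counted over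
  windows of lengths; so the estimate is asserted for arbitrarily large \<open>t\<close> and not for
  every \<open>t\<close>.\<close>

lemma primitivity_rank_count_ge:
  assumes m: "2 \<le> m" "m \<le> k"
  shows "\<exists>c>0. \<forall>n. \<exists>t\<ge>n. t > 0 \<and> c * (2 * real m - 1) ^ t \<le> real (primitivity_rank_count k m t)"
proof -
  let ?A = "{1..m}"
  define b where "b = 2 * real m - 1"
  \<comment> \<open>The rate of the upper bound for \<open>m\<close> generators and rank
    \<open>m - 1\<close>. It is strictly below \<open>b\<close>, so words of rank less than
    \<open>m\<close> are negligible among the even ones.\<close>
  define M where "M = max (sqrt b) (2 * real (m - 1) - 1)"
  have b: "b \<ge> 3" using m by (simp add: b_def)
  have "sqrt b < b" using b by (intro real_less_lsqrt) (auto simp: power2_eq_square)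
  then have M: "M \<ge> 1" "M\<^sup>2 \<ge> b" "M \<ge> 2 * real (m - 1) - 1" "M < b"
  proof -
    have "sqrt b \<ge> 1" using b by simp
    then show "M \<ge> 1" unfolding M_def by linarith
    have "(sqrt b)\<^sup>2 \<le> M\<^sup>2" using b by (intro power_mono) (auto simp: M_def)
    then show "M\<^sup>2 \<ge> b" using b by simp
    show "M \<ge> 2 * real (m - 1) - 1" by (simp add: M_def)
    show "M < b" using \<open>sqrt b < b\<close> m by (auto simp: M_def b_def of_nat_diff)
  qed
  let ?W = "\<lambda>t. {w. reduced w \<and> fst ` set w \<subseteq> ?A \<and> length w = t \<and> primitivity_rank (Fk k) w \<le> enat (m - 1)}"
  let ?E = "\<lambda>t. {w. (reduced w \<and> even_word w) \<and> fst ` set w \<subseteq> ?A \<and> length w = t}"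
  let ?c = "primitivity_rank_count k m"
  obtain C d where C: "C > 0" "d > 0" "\<And>t. t > 0 \<Longrightarrow> real (card (?W t)) \<le> C * real t ^ d * M ^ t"
    using card_primitivity_rank_le_poly[of ?A "{1..k}" M "m - 1"] M m by (auto simp: b_def)
  have E: "card (?E t) \<le> ?c t + card (?W t)" for t
  proof -
    let ?K = "{w. reduced w \<and> fst ` set w \<subseteq> {1..k} \<and> length w = t \<and> primitivity_rank (Fk k) w = enat m}"
    have "?E t \<subseteq> ?K \<union> ?W t"
    proof
      fix w assume w: "w \<in> ?E t"
      then have "primitivity_rank (Fk k) w \<le> enat (card ?A)"
        using m by (intro primitivity_rank_even_word_le) (auto simp: carrier_free_group)
      then obtain j where j: "primitivity_rank (Fk k) w = enat j" "j \<le> m"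
        by (cases "primitivity_rank (Fk k) w") auto
      have "fst ` set w \<subseteq> {1..k}" using w m by fastforce
      then show "w \<in> ?K \<union> ?W t" using w j by (cases "j = m") auto
    qed
    then have "card (?E t) \<le> card (?K \<union> ?W t)"
    proof (rule card_mono[rotated])
      have "finite ?K" by (rule rev_finite_subset[OF finite_words[of "{1..k}" reduced t]]) auto
      moreover have "finite (?W t)" by (rule rev_finite_subset[OF finite_words[of ?A reduced t]]) auto
      ultimately show "finite (?K \<union> ?W t)" by simp
    qed
    also have "\<dots> \<le> card ?K + card (?W t)" by (rule card_Un_le)
    finally show ?thesis by (simp only: primitivity_rank_count_eq)
  qed
  \<comment> \<open>Chosen for the contradiction: each of the \<open>m + 1\<close> lengths in the
    window contributes at most \<open>(c + c / 2) * b ^ (N + m)\<close>, with \<open>c\<close> for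
    words of rank \<open>m\<close> and \<open>c / 2\<close> for those of smaller rank. The total is
    \<open>3 / 4 * b ^ N\<close>, less than the \<open>b ^ N\<close> even words available.\<close>
  define c where "c = 1 / (2 * real (m + 1) * b ^ m)"
  have c: "c > 0" using b by (simp add: c_def)
  have "\<exists>t\<ge>n. t > 0 \<and> c * b ^ t \<le> real (?c t)" for n
  proof (rule ccontr)
    assume "\<not> ?thesis"
    then have small: "real (?c t) < c * b ^ t" if "t \<ge> n" "t > 0" for t using that by force
    have "(\<lambda>t. C * (real t ^ d * (M / b) ^ t)) \<longlonglongrightarrow> C * 0"
      by (intro tendsto_mult tendsto_const poly_times_power_tendsto_0) (use M b C in auto)
    then have "eventually (\<lambda>t. C * (real t ^ d * (M / b) ^ t) < c / 2) sequentially"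
      using c by (intro order_tendstoD(2)) auto
    then obtain n1 where n1: "\<And>t. t \<ge> n1 \<Longrightarrow> C * (real t ^ d * (M / b) ^ t) < c / 2"
      by (auto simp: eventually_at_top_linorder)
    define N where "N = max n (max n1 1)"
    have le: "real (card (?E t)) \<le> 3 / 2 * c * b ^ (N + m)" if t: "t \<in> {N..N+m}" for t
    proof -
      have tN: "t \<ge> n" "t \<ge> n1" "t > 0" using t by (auto simp: N_def)
      have "C * real t ^ d * M ^ t = C * (real t ^ d * (M / b) ^ t) * b ^ t"
        using b by (simp add: power_divide)
      also have "\<dots> \<le> c / 2 * b ^ t" using n1[OF tN(2)] b by (intro mult_right_mono) auto
      finally have "real (card (?W t)) \<le> c / 2 * b ^ t" using C(3)[OF tN(3)] by linarith
      moreover have "real (card (?E t)) \<le> real (?c t) + real (card (?W t))" using E[of t] by linarith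
      ultimately have "real (card (?E t)) \<le> 3 / 2 * c * b ^ t" using small[OF tN(1,3)] by simp
      also have "\<dots> \<le> 3 / 2 * c * b ^ (N + m)" using t b c by (intro mult_left_mono power_increasing) auto
      finally show ?thesis .
    qed
    have b_nat: "b = real (2 * m - 1)" using m by (simp add: b_def of_nat_diff)
    have "(2 * m - 1) ^ N \<le> (\<Sum>t=N..N+m. card (?E t))"
      by (rule card_even_words_ge) (use m in \<open>auto simp: N_def\<close>)
    then have "b ^ N \<le> real (\<Sum>t=N..N+m. card (?E t))" unfolding b_nat by (simp only: of_nat_power[symmetric] of_nat_le_iff)
    also have "\<dots> = (\<Sum>t=N..N+m. real (card (?E t)))" by simp
    also have "\<dots> \<le> real (card {N..N+m}) * (3 / 2 * c * b ^ (N + m))" by (rule sum_bounded_above) (rule le)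
    also have "\<dots> = 3 / 2 * (c * b ^ m * real (m + 1)) * b ^ N" by (simp add: power_add)
    also have "c * b ^ m * real (m + 1) = 1 / 2" using b by (simp add: c_def)
    finally show False using b by simp
  qed
  then show ?thesis using c unfolding b_def by blast
qed

text \<open>For \<open>m \<ge> 2\<close> the growth estimate provides the word. For
  \<open>m = 1\<close> the square of a generator serves: it is even, so its rank is at most one, and
  rank zero is reserved for the empty word.\<close>

lemma exists_word_of_primitivity_rank:
  assumes m: "1 \<le> m" "m \<le> k"
  obtains w where "w \<noteq> []" "w \<in> carrier (Fk k)" "primitivity_rank (Fk k) w = enat m"
proof (cases "m = 1")
  case True
  let ?w = "[(1, True), (1, True)] :: nat word"
  have w: "?w \<in> carrier (free_group {1})" by (simp add: carrier_free_group reduced_Cons flip_def)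
  have "primitivity_rank (Fk k) ?w \<le> enat (card {1 :: nat})"
    by (rule primitivity_rank_even_word_le[OF _ _ w]) (use m in \<open>auto simp: even_word_def\<close>)
  moreover have "\<not> primitivity_rank (Fk k) ?w \<le> enat 0" by (rule primitivity_rank_pos) simp
  ultimately have "primitivity_rank (Fk k) ?w = enat m"
    using True by (cases "primitivity_rank (Fk k) ?w") auto
  moreover have "?w \<in> carrier (Fk k)" using w m by (auto simp: carrier_free_group)
  ultimately show ?thesis using that by blast
next
  case False
  then obtain c where c: "c > 0" "\<And>n. \<exists>t\<ge>n. t > 0 \<and> c * (2 * real m - 1) ^ t \<le> real (primitivity_rank_count k m t)"
    using primitivity_rank_count_ge[of m k] m by auto
  obtain t where t: "t > 0" "c * (2 * real m - 1) ^ t \<le> real (primitivity_rank_count k m t)" using c(2) by blast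
  have "c * (2 * real m - 1) ^ t > 0" using c(1) m by (intro mult_pos_pos zero_less_power) auto
  then have "primitivity_rank_count k m t > 0" using t(2) by linarith
  then obtain w where "w \<in> carrier (Fk k)" "length w = t" "primitivity_rank (Fk k) w = enat m"
    unfolding primitivity_rank_count_def by (auto simp: card_gt_0_iff)
  then show ?thesis using that t(1) by auto
qed

text \<open>All conjugates \<open>winv (l # h) @ w @ (l # h)\<close> of one word \<open>w\<close>
  have its rank. The buffer letter \<open>l\<close> prevents cancellation against \<open>w\<close>
  and leaves \<open>2 * k - 1\<close> choices for each of the \<open>n\<close> letters of
  \<open>h\<close>, while the length grows by two per letter.\<close>

lemma primitivity_rank_count_ge_sqrt:
  assumes k: "k \<ge> 2" and m: "1 \<le> m" "m \<le> k"
  shows "\<exists>c>0. \<forall>n. \<exists>t\<ge>n. c * sqrt (2 * real k - 1) ^ t \<le> real (primitivity_rank_count k m t)"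
proof -
  obtain w where w: "w \<noteq> []" "w \<in> carrier (Fk k)" "primitivity_rank (Fk k) w = enat m"
    using exists_word_of_primitivity_rank[OF m] by metis
  define s where "s = sqrt (2 * real k - 1)"
  have s: "s > 0" "s\<^sup>2 = 2 * real k - 1" using k by (auto simp: s_def)
  \<comment> \<open>One letter is forbidden on each side of \<open>w\<close>, and two generators
    supply four letters.\<close>
  have "\<exists>l \<in> {1, 2} \<times> (UNIV :: bool set). l \<noteq> flip (last w) \<and> l \<noteq> hd w"
  proof (rule ccontr)
    assume "\<not> ?thesis"
    then have "{1, 2} \<times> UNIV \<subseteq> {flip (last w), hd w}" by blast
    then have "card ({1 :: nat, 2} \<times> (UNIV :: bool set)) \<le> card {flip (last w), hd w}"
      by (rule card_mono[rotated]) simp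
    also have "\<dots> \<le> 2" by (simp add: card_insert_if)
    finally show False by (simp add: card_cartesian_product)
  qed
  then obtain l where l: "l \<in> {1, 2} \<times> (UNIV :: bool set)" "l \<noteq> flip (last w)" "l \<noteq> hd w" by blast
  have lk: "fst l \<in> {1..k}" using l(1) k by (cases l) auto
  have wr: "reduced w" "fst ` set w \<subseteq> {1..k}" using w(2) by (auto simp: carrier_free_group)
  have count: "(2 * k - 1) ^ n \<le> primitivity_rank_count k m (2 * n + 2 + length w)" for n
  proof -
    let ?H = "{h. reduced (l # h) \<and> fst ` set h \<subseteq> {1..k} \<and> length h = n}"
    let ?K = "{v. reduced v \<and> fst ` set v \<subseteq> {1..k} \<and> length v = 2 * n + 2 + length w \<and> primitivity_rank (Fk k) v = enat m}"
    let ?f = "\<lambda>h. winv (l # h) @ w @ (l # h)"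
    have "card ?H \<le> card ?K"
    proof (rule card_inj_on_le)
      show "inj_on ?f ?H"
      proof (rule inj_onI)
        fix g h assume "g \<in> ?H" "h \<in> ?H" "?f g = ?f h"
        then show "g = h" by (simp add: append_eq_append_conv)
      qed
      show "finite ?K" using finite_words[of "{1..k}" reduced] by (rule rev_finite_subset) auto
      show "?f ` ?H \<subseteq> ?K"
      proof (rule image_subsetI)
        fix h assume h: "h \<in> ?H"
        have lh: "l # h \<in> carrier (Fk k)" using h lk by (auto simp: carrier_free_group)
        have r: "reduced (?f h)"
        proof -
          have "reduced (w @ (l # h))" using h wr l(2) by (simp add: reduced_append)
          moreover have "last (winv (l # h)) = flip l" by simp
          moreover have "reduced (winv (l # h))" using h by (simp only: reduced_winv) simp
          ultimately show ?thesis
            using l(3) w(1) unfolding reduced_append[of "winv (l # h)"] by auto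
        qed
        have "reduced (w @ (l # h))" using r unfolding reduced_append[of "winv (l # h)"] by blast
        then have "?f h = winv (l # h) \<star> (w \<star> winv (winv (l # h)))"
          by (simp only: winv_simps(2) wmult_reduced_append wmult_reduced_append[OF r])
        then have "primitivity_rank (Fk k) (?f h) = enat m"
          using primitivity_rank_conj[OF winv_closed[OF lh] w(2)] w(3) by simp
        moreover have "fst ` set (?f h) \<subseteq> {1..k}"
          using h wr(2) lk by (simp add: image_Un)
        moreover have "length (?f h) = 2 * n + 2 + length w" using h by simp
        ultimately show "?f h \<in> ?K" using r by blast
      qed
    qed
    then show ?thesis using card_reduced_Cons[of "{1..k}" l n] lk by (simp add: primitivity_rank_count_eq)
  qed
  \<comment> \<open>Compensates for the \<open>2 + length w\<close> letters that do not belong to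
    \<open>h\<close> or its inverse.\<close>
  define c where "c = 1 / s ^ (2 + length w)"
  have "\<exists>t\<ge>n. c * s ^ t \<le> real (primitivity_rank_count k m t)" for n
  proof (intro exI conjI)
    have "c * s ^ (2 * n + 2 + length w) = (s\<^sup>2) ^ n"
      using s(1) by (simp add: c_def power_add power_mult)
    also have "\<dots> = real ((2 * k - 1) ^ n)" using k by (simp add: s(2) of_nat_diff)
    also have "\<dots> \<le> real (primitivity_rank_count k m (2 * n + 2 + length w))" using count[of n] by (simp only: of_nat_le_iff)
    finally show "c * s ^ (2 * n + 2 + length w) \<le> real (primitivity_rank_count k m (2 * n + 2 + length w))" .
  qed simp
  then show ?thesis using s(1) by (intro exI[of _ c]) (auto simp: c_def s_def)
qed

theorem theorem41:
  fixes k m :: nat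
  assumes "k \<ge> 2" and "m \<in> {1..k}"
  shows "(2 * real m - 1 \<le> sqrt (2 * real k - 1) \<longrightarrow>
            limsup (\<lambda>t. ereal (root t (real (primitivity_rank_count k m t)))) = ereal (sqrt (2 * real k - 1)))
       \<and> (2 * real m - 1 \<ge> sqrt (2 * real k - 1) \<longrightarrow>
            limsup (\<lambda>t. ereal (root t (real (primitivity_rank_count k m t)))) = ereal (2 * real m - 1))"
proof -
  let ?L = "limsup (\<lambda>t. ereal (root t (real (primitivity_rank_count k m t))))"
  define s where "s = sqrt (2 * real k - 1)"
  define M where "M = max s (2 * real m - 1)"
  have m: "1 \<le> m" "m \<le> k" using assms by auto
  have s: "s\<^sup>2 = 2 * real k - 1" "s > 1" using assms(1) by (auto simp: s_def)
  have M: "M \<ge> 1" "M\<^sup>2 \<ge> 2 * real k - 1" "M \<ge> 2 * real m - 1"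
  proof -
    show "M \<ge> 1" "M \<ge> 2 * real m - 1" using s by (auto simp: M_def)
    have "s\<^sup>2 \<le> M\<^sup>2" using s by (intro power_mono) (auto simp: M_def)
    then show "M\<^sup>2 \<ge> 2 * real k - 1" using s by simp
  qed
  let ?W = "\<lambda>t. {w. reduced w \<and> fst ` set w \<subseteq> {1..k} \<and> length w = t \<and> primitivity_rank (Fk k) w \<le> enat m}"
  obtain C d where C: "C > 0" "\<And>t. t > 0 \<Longrightarrow> real (card (?W t)) \<le> C * real t ^ d * M ^ t"
    using card_primitivity_rank_le_poly[of "{1..k}" "{1..k}" M m] M assms(1) by auto
  have "primitivity_rank_count k m t \<le> card (?W t)" for t
    unfolding primitivity_rank_count_eq
    by (rule card_mono) (use finite_words[of "{1..k}" reduced t] in \<open>auto elim!: rev_finite_subset\<close>)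
  then have "real (primitivity_rank_count k m t) \<le> C * real t ^ d * M ^ t" if "t > 0" for t
    using C(2)[OF that] by (meson of_nat_le_iff order_trans)
  then have upper: "?L \<le> ereal M" using C(1) M(1) by (intro limsup_root_le[of C M]) auto
  obtain c where "c > 0" "\<And>n. \<exists>t\<ge>n. c * s ^ t \<le> real (primitivity_rank_count k m t)"
    using primitivity_rank_count_ge_sqrt[OF assms(1) m] unfolding s_def by blast
  then have lower_s: "ereal s \<le> ?L" using s by (intro limsup_root_ge[of c s]) auto
  have lower_m: "ereal (2 * real m - 1) \<le> ?L" if "s \<le> 2 * real m - 1"
  proof -
    \<comment> \<open>For \<open>m = 1\<close> the assumption would read \<open>s \<le> 1\<close>,
      whereas \<open>k \<ge> 2\<close> gives \<open>s > 1\<close>.\<close>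
    have "m \<ge> 2" using that s m by (cases "m = 1") auto
    then obtain c where "c > 0" "\<And>n. \<exists>t\<ge>n. c * (2 * real m - 1) ^ t \<le> real (primitivity_rank_count k m t)"
      using primitivity_rank_count_ge[of m k] m(2) by blast
    then show ?thesis using m by (intro limsup_root_ge[of c "2 * real m - 1"]) auto
  qed
  show ?thesis
    unfolding s_def[symmetric]
  proof (intro conjI impI)
    assume "2 * real m - 1 \<le> s"
    then have "M = s" by (simp add: M_def)
    then show "?L = ereal s" using upper lower_s by (intro antisym) auto
  next
    assume "s \<le> 2 * real m - 1"
    moreover from this have "M = 2 * real m - 1" by (simp add: M_def)
    ultimately show "?L = ereal (2 * real m - 1)" using upper lower_m by (intro antisym) auto
  qed
qed

end
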